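(* Let $n \geq 1$ and let $l \geq 1$ be a real number. There exist constants $C>0$ and $t_0>1$, independent of $t,u_0,u_1$, such that if $(u_0,u_1)\in (L^{1,1}(\mathbf{R}^n)\cap Y^{l+1})\times (L^{1,1}(\mathbf{R}^n)\cap Y^{l})$ and $u$ is the solution of $u_{tt}+Lu+(I+L)^{-1}u_t=0$, $u(0,\cdot)=u_0$, $u_t(0,\cdot)=u_1$, then with $$\varphi_1(t,\xi):=e^{-t\log(1+|\xi|^2)\,(1+\log(1+|\xi|^2))}\,(P_0+P_1)$$ the following holds for all $t\ge t_0$: (a) if ($n\le 2$ and $l\ge 1$) or ($n\ge 3$ and $l\ge n/2$), then $$\|u(t,\cdot)-\mathcal{F}^{-1}_{\xi\to x}(\varphi_1(t,\xi))(\cdot)\|_{L^2(\mathbf{R}^n)}\le C I_{0,l}\, t^{-\frac{n+2}{4}};$$ (b) if ($n\ge 4$ and $n/2-1<l\le n/2$) or ($n=3$ and $1\le l\le 3/2$), then $$\|u(t,\cdot)-\mathcal{F}^{-1}_{\xi\to x}(\varphi_1(t,\xi))(\cdot)\|_{L^2(\mathbf{R}^n)}\le C I_{0,l}\, t^{-\frac{l+1}{2}}.$$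
   Context: The Fourier transform is $\mathcal F(f)(\xi)=\hat f(\xi)=\int_{\mathbf{R}^n}e^{-ix\cdot\xi}f(x)\,dx$ (extended to $L^2(\mathbf{R}^n)$), with inverse $\mathcal{F}^{-1}_{\xi\to x}$. The operator $L$ on $L^2(\mathbf{R}^n)$ is the Fourier multiplier $\widehat{Lf}(\xi)=\log(1+|\xi|^2)\hat f(\xi)$ with its maximal domain. For $\delta\ge 0$, $Y^\delta=\{f\in L^2(\mathbf{R}^n):\int_{\mathbf{R}^n}(1+\log(1+|\xi|^2))^\delta|\hat f(\xi)|^2d\xi<\infty\}$, with norm $\|f\|_{Y^\delta}=\big(\int_{\mathbf{R}^n}(1+\log(1+|\xi|^2))^\delta|\hat f(\xi)|^2d\xi\big)^{1/2}$. $L^{1,1}(\mathbf{R}^n)=\{f\in L^1(\mathbf{R}^n):\|f\|_{1,1}:=\int_{\mathbf{R}^n}(1+|x|)|f(x)|dx<\infty\}$. Cauchy problem: $u_{tt}+Lu+(I+L)^{-1}u_t=0$ on $(0,\infty)\times\mathbf{R}^n$, $u(0,\cdot)=u_0$, $u_t(0,\cdot)=u_1$. For $(u_0,u_1)\in Y^2\times Y^1$ the solution is the unique weak solution $u\in C([0,\infty),Y^2)\cap C^1([0,\infty),Y^1)\cap C^2([0,\infty),L^2(\mathbf{R}^n))$; for a.e. $\xi$, $\hat u(t,\xi)$ solves $\hat u_{tt}+\log(1+|\xi|^2)\hat u+(1+\log(1+|\xi|^2))^{-1}\hat u_t=0$ with $\hat u(0,\xi)=\hat u_0(\xi)$, $\hat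 u_t(0,\xi)=\hat u_1(\xi)$. Notation: $I_{0,l}:=\sqrt{\|u_0\|_{1,1}^2+\|u_1\|_{1,1}^2+\|u_0\|_{Y^{l+1}}^2+\|u_1\|_{Y^l}^2}$ and $P_j:=\int_{\mathbf{R}^n}u_j(x)\,dx$ ($j=0,1$). *)

theory Defs
  imports "HOL-Analysis.Analysis"
begin

text \<open>
  Elements of \<open>L\<^sup>2(R\<^sup>n)\<close> etc. are represented by complex-valued Lebesgue-measurable functions on
  \<open>real^'n\<close> (so \<open>n = CARD('n)\<close>); identities between them are stated almost everywhere.
\<close>

definition L2_space :: "(real^'n \<Rightarrow> complex) set" where
  "L2_space = {f \<in> borel_measurable lebesgue. integrable lebesgue (\<lambda>x. (cmod (f x))\<^sup>2)}"

definition L2_norm :: "(real^'n \<Rightarrow> complex) \<Rightarrow> real" where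
  "L2_norm f = sqrt (\<integral>x. (cmod (f x))\<^sup>2 \<partial>lebesgue)"

definition fourier_L1 :: "(real^'n \<Rightarrow> complex) \<Rightarrow> real^'n \<Rightarrow> complex" where
  "fourier_L1 f \<xi> = (\<integral>x. exp (- \<i> * of_real (x \<bullet> \<xi>)) * f x \<partial>lebesgue)"

text \<open>
  The graph of the extension of the Fourier transform to \<open>L\<^sup>2\<close> is the \<open>L\<^sup>2 \<times> L\<^sup>2\<close>-closure of
  the graph of the integral transform on \<open>L\<^sup>1 \<inter> L\<^sup>2\<close>. By Plancherel, \<open>g\<close> exists and is unique up to
  null sets for every \<open>f\<close> in \<open>L\<^sup>2\<close>; \<open>fourier_L2\<close> and \<open>inv_fourier_L2\<close> select a representative.
\<close>

definition is_fourier_L2 :: "(real^'n \<Rightarrow> complex) \<Rightarrow> (real^'n \<Rightarrow> complex) \<Rightarrow> bool" where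
  "is_fourier_L2 f g \<longleftrightarrow> f \<in> L2_space \<and> g \<in> L2_space \<and>
     (\<exists>F :: nat \<Rightarrow> real^'n \<Rightarrow> complex.
        (\<forall>k. integrable lebesgue (F k) \<and> F k \<in> L2_space \<and> fourier_L1 (F k) \<in> L2_space) \<and>
        (\<lambda>k. L2_norm (\<lambda>x. F k x - f x)) \<longlonglongrightarrow> 0 \<and>
        (\<lambda>k. L2_norm (\<lambda>\<xi>. fourier_L1 (F k) \<xi> - g \<xi>)) \<longlonglongrightarrow> 0)"

definition fourier_L2 :: "(real^'n \<Rightarrow> complex) \<Rightarrow> real^'n \<Rightarrow> complex" where
  "fourier_L2 f = (SOME g. is_fourier_L2 f g)"

definition inv_fourier_L2 :: "(real^'n \<Rightarrow> complex) \<Rightarrow> real^'n \<Rightarrow> complex" where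
  "inv_fourier_L2 g = (SOME f. f \<in> L2_space \<and> (AE \<xi> in lebesgue. fourier_L2 f \<xi> = g \<xi>))"

definition log_symbol :: "real^'n \<Rightarrow> real" where
  "log_symbol \<xi> = ln (1 + (norm \<xi>)\<^sup>2)"

definition dom_L :: "(real^'n \<Rightarrow> complex) set" where
  "dom_L = {f \<in> L2_space. (\<lambda>\<xi>. of_real (log_symbol \<xi>) * fourier_L2 f \<xi>) \<in> L2_space}"

definition L_op :: "(real^'n \<Rightarrow> complex) \<Rightarrow> real^'n \<Rightarrow> complex" where
  "L_op f = inv_fourier_L2 (\<lambda>\<xi>. of_real (log_symbol \<xi>) * fourier_L2 f \<xi>)"

text \<open>The operator \<open>(I + L)\<^sup>-\<^sup>1\<close> on \<open>L\<^sup>2\<close>, as the inverse of \<open>I + L\<close> on its domain.\<close>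

definition IL_inv :: "(real^'n \<Rightarrow> complex) \<Rightarrow> real^'n \<Rightarrow> complex" where
  "IL_inv f = (SOME g. g \<in> dom_L \<and> (AE x in lebesgue. g x + L_op g x = f x))"

definition Y_space :: "real \<Rightarrow> (real^'n \<Rightarrow> complex) set" where
  "Y_space \<delta> = {f \<in> L2_space.
     integrable lebesgue (\<lambda>\<xi>. (1 + log_symbol \<xi>) powr \<delta> * (cmod (fourier_L2 f \<xi>))\<^sup>2)}"

definition Y_norm :: "real \<Rightarrow> (real^'n \<Rightarrow> complex) \<Rightarrow> real" where
  "Y_norm \<delta> f = sqrt (\<integral>\<xi>. (1 + log_symbol \<xi>) powr \<delta> * (cmod (fourier_L2 f \<xi>))\<^sup>2 \<partial>lebesgue)"

definition L11_space :: "(real^'n \<Rightarrow> complex) set" where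
  "L11_space = {f. integrable lebesgue f \<and> integrable lebesgue (\<lambda>x. (1 + norm x) * cmod (f x))}"

definition L11_norm :: "(real^'n \<Rightarrow> complex) \<Rightarrow> real" where
  "L11_norm f = (\<integral>x. (1 + norm x) * cmod (f x) \<partial>lebesgue)"

text \<open>
  Continuity of \<open>u : [0,\<infinity>) \<rightarrow> X\<close>, and \<open>u' = v\<close> on \<open>[0,\<infinity>)\<close> (one-sided at \<open>0\<close>), for a space \<open>X\<close>
  with (semi)norm \<open>N\<close>. Values of \<open>u\<close> at negative times are irrelevant.
\<close>

definition continuous_into ::
  "(real^'n \<Rightarrow> complex) set \<Rightarrow> ((real^'n \<Rightarrow> complex) \<Rightarrow> real) \<Rightarrow> (real \<Rightarrow> real^'n \<Rightarrow> complex) \<Rightarrow> bool" where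
  "continuous_into X N u \<longleftrightarrow> (\<forall>t\<ge>0. u t \<in> X) \<and>
     (\<forall>s\<ge>0. ((\<lambda>t. N (\<lambda>x. u t x - u s x)) \<longlongrightarrow> 0) (at s within {0..}))"

definition C1_into ::
  "(real^'n \<Rightarrow> complex) set \<Rightarrow> ((real^'n \<Rightarrow> complex) \<Rightarrow> real) \<Rightarrow> (real \<Rightarrow> real^'n \<Rightarrow> complex) \<Rightarrow>
    (real \<Rightarrow> real^'n \<Rightarrow> complex) \<Rightarrow> bool" where
  "C1_into X N u v \<longleftrightarrow> continuous_into X N u \<and> continuous_into X N v \<and>
     (\<forall>s\<ge>0. ((\<lambda>t. N (\<lambda>x. (u t x - u s x) / of_real (t - s) - v s x)) \<longlongrightarrow> 0) (at s within {0..}))"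

text \<open>
  Solutions of \<open>u\<^sub>t\<^sub>t + L u + (I + L)\<^sup>-\<^sup>1 u\<^sub>t = 0\<close> in \<open>C([0,\<infinity>), Y\<^sup>2) \<inter> C\<^sup>1([0,\<infinity>), Y\<^sup>1) \<inter> C\<^sup>2([0,\<infinity>), L\<^sup>2)\<close>.
  In this class every term of the equation is continuous in time with values in \<open>L\<^sup>2\<close> (note that
  \<open>Y\<^sup>2\<close> is the domain of \<open>L\<close>), so the weak form is the same as the identity in \<open>L\<^sup>2\<close> at each time.
\<close>

definition is_solution ::
  "(real^'n \<Rightarrow> complex) \<Rightarrow> (real^'n \<Rightarrow> complex) \<Rightarrow> (real \<Rightarrow> real^'n \<Rightarrow> complex) \<Rightarrow> bool" where
  "is_solution u0 u1 u \<longleftrightarrow>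
     (\<exists>ut utt. continuous_into (Y_space 2) (Y_norm 2) u \<and>
        C1_into (Y_space 1) (Y_norm 1) u ut \<and>
        C1_into L2_space L2_norm ut utt \<and>
        (\<forall>t>0. AE x in lebesgue. utt t x + L_op (u t) x + IL_inv (ut t) x = 0) \<and>
        (AE x in lebesgue. u 0 x = u0 x) \<and>
        (AE x in lebesgue. ut 0 x = u1 x))"

definition data_norm :: "real \<Rightarrow> (real^'n \<Rightarrow> complex) \<Rightarrow> (real^'n \<Rightarrow> complex) \<Rightarrow> real" where
  "data_norm l u0 u1 = sqrt ((L11_norm u0)\<^sup>2 + (L11_norm u1)\<^sup>2 +
     (Y_norm (l + 1) u0)\<^sup>2 + (Y_norm l u1)\<^sup>2)"

definition phi1 ::
  "(real^'n \<Rightarrow> complex) \<Rightarrow> (real^'n \<Rightarrow> complex) \<Rightarrow> real \<Rightarrow> real^'n \<Rightarrow> complex" where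
  "phi1 u0 u1 t \<xi> = of_real (exp (- t * log_symbol \<xi> * (1 + log_symbol \<xi>))) *
     ((\<integral>x. u0 x \<partial>lebesgue) + (\<integral>x. u1 x \<partial>lebesgue))"

end

theory Submission
  imports Defs "HOL-Probability.Characteristic_Functions" "HOL-Probability.Sinc_Integral"
begin

text \<open>
  Write \<open>x = log (1 + |\<xi>|\<^sup>2)\<close>. On the Fourier side the equation is an oscillator with characteristic roots
  \<open>r, r'\<close> of \<open>r\<^sup>2 + r / (1 + x) + x = 0\<close>. The combination \<open>exp (- r t) (v - r' u)\<close> of the transforms \<open>u, v\<close> of
  the solution and its time derivative has vanishing \<open>L\<^sup>2\<close>-derivative on every ball, so it is constant in time.
  This gives the solution formula off the sphere where \<open>r = r'\<close>, a null set. For \<open>x \<ge> 1/10\<close> both roots satisfy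
  \<open>Re r \<le> - 1 / (10 (1 + x))\<close>, and \<open>exp (- y) \<le> C y powr (- p)\<close> trades the regularity weights for the decay
  \<open>t powr (- (l + 1) / 2)\<close>. For \<open>x \<le> 1/10\<close> the larger root is \<open>- x (1 + x) + O(x\<^sup>2)\<close> and the transforms of the
  data differ from their integrals by \<open>O(|\<xi>|)\<close>, so the error is \<open>O(|\<xi>| exp (- t |\<xi>|\<^sup>2 / 4))\<close>, of \<open>L\<^sup>2\<close>-norm
  \<open>O(t powr (- (n + 2) / 4))\<close>.

  The Plancherel theorem comes from the identity
  \<open>\<integral> |fourier f \<xi>|\<^sup>2 gauss (s \<xi>) d\<xi> = \<integral> f(x) cnj (\<integral> f(y) kern s (y - x) dy) dx\<close>, whose right-hand side is
  bounded by \<open>(2 \<pi>)\<^sup>n \<parallel>f\<parallel>\<^sup>2\<close> and converges to it for continuous compactly supported \<open>f\<close> as \<open>s \<rightarrow> 0\<close>.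
\<close>

section \<open>The space of square-integrable functions\<close>

text \<open>The solution is differentiable in time only as a map into L2, so the oscillator cannot
  be solved separately at each frequency; it is factored as an identity between L2-valued functions.
  The roots grow with the frequency and become bounded multipliers only after restriction to a ball.
  The threshold 1/10 leaves a margin on both sides. Below it the discriminant
  \<open>(1 / (1 + x))^2 - 4 * x\<close> is at least 36/100, so the roots are real and separated.
  Above it the square root of the discriminant, when real, is at most 8/10 of
  \<open>1 / (1 + x)\<close>, so the damping rate stays comparable to \<open>1 / (1 + x)\<close>.
  The squared error is bounded by a multiple of \<open>t^(-(n+2)/2) + t^(-(l+1))\<close>: the first
  rate belongs to the low frequencies, the second is the price of the weak damping at high ones. The
  two cases of the theorem record which rate is the slower. The starting time \<open>n/2 + 1\<close>
  comes from the profile: its square is bounded by a multiple of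
  \<open>(1 + |\<xi>|^2)^(-2t)\<close>, which for such \<open>t\<close> is the integrable
  \<open>(1 + |\<xi>|^2)^(-n)\<close> times a factor that decays exponentially in \<open>t\<close>
  away from frequency zero.\<close>

lemma L2_spaceI:
  "f \<in> borel_measurable lebesgue \<Longrightarrow> integrable lebesgue (\<lambda>x. (cmod (f x))\<^sup>2) \<Longrightarrow> f \<in> L2_space"
  by (simp add: L2_space_def)

lemma L2_measurable [measurable_dest]: "f \<in> L2_space \<Longrightarrow> f \<in> borel_measurable lebesgue"
  by (simp add: L2_space_def)

lemma L2_integrable: "f \<in> L2_space \<Longrightarrow> integrable lebesgue (\<lambda>x. (cmod (f x))\<^sup>2)"
  by (simp add: L2_space_def)

lemma L2_norm_nonneg [simp]: "0 \<le> L2_norm f"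
  by (simp add: L2_norm_def)

lemma L2_norm_sq: "(L2_norm f)\<^sup>2 = (\<integral>x. (cmod (f x))\<^sup>2 \<partial>lebesgue)"
  by (simp add: L2_norm_def)

lemma L2_norm_zero [simp]: "L2_norm (\<lambda>x. 0) = 0"
  by (simp add: L2_norm_def)

lemma L2_zero [simp]: "(\<lambda>x. 0) \<in> L2_space"
  by (simp add: L2_space_def)

lemma L2_norm_minus_commute: "L2_norm (\<lambda>x. f x - g x) = L2_norm (\<lambda>x. g x - f x)"
  by (simp add: L2_norm_def norm_minus_commute)

lemma L2_norm_cong_AE:
  assumes "f \<in> borel_measurable lebesgue" "g \<in> borel_measurable lebesgue" "AE x in lebesgue. f x = g x"
  shows "L2_norm f = L2_norm g"
  unfolding L2_norm_def using assms by (intro arg_cong[where f=sqrt] integral_cong_AE) auto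

lemma L2_dominated:
  assumes g: "g \<in> L2_space" and f [measurable]: "f \<in> borel_measurable lebesgue"
    and le: "AE x in lebesgue. cmod (f x) \<le> C * cmod (g x)" and C: "0 \<le> C"
  shows "f \<in> L2_space" "L2_norm f \<le> C * L2_norm g"
proof -
  have le2: "AE x in lebesgue. (cmod (f x))\<^sup>2 \<le> C\<^sup>2 * (cmod (g x))\<^sup>2"
    using le by eventually_elim (metis norm_ge_zero power_mono power_mult_distrib)
  have int: "integrable lebesgue (\<lambda>x. C\<^sup>2 * (cmod (g x))\<^sup>2)"
    using L2_integrable[OF g] by simp
  have "integrable lebesgue (\<lambda>x. (cmod (f x))\<^sup>2)"
    by (rule Bochner_Integration.integrable_bound[OF int]) (use le2 in auto)
  then show fS: "f \<in> L2_space" by (intro L2_spaceI) auto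
  have "(L2_norm f)\<^sup>2 \<le> (\<integral>x. C\<^sup>2 * (cmod (g x))\<^sup>2 \<partial>lebesgue)"
    unfolding L2_norm_sq by (intro integral_mono_AE le2 int L2_integrable fS)
  also have "\<dots> = (C * L2_norm g)\<^sup>2"
    by (simp add: L2_norm_sq power_mult_distrib)
  finally show "L2_norm f \<le> C * L2_norm g"
    by (rule power2_le_imp_le) (simp add: C)
qed

lemma L2_mult_left:
  assumes "f \<in> L2_space" shows "(\<lambda>x. c * f x) \<in> L2_space" "L2_norm (\<lambda>x. c * f x) = cmod c * L2_norm f"
proof -
  show "(\<lambda>x. c * f x) \<in> L2_space"
    by (rule L2_dominated[OF assms, of _ "cmod c"]) (use assms in \<open>auto simp: norm_mult intro: L2_measurable\<close>)
  show "L2_norm (\<lambda>x. c * f x) = cmod c * L2_norm f"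
    by (simp add: L2_norm_def norm_mult power_mult_distrib real_sqrt_mult)
qed

lemma L2_divide:
  assumes "f \<in> L2_space" shows "(\<lambda>x. f x / c) \<in> L2_space" "L2_norm (\<lambda>x. f x / c) = L2_norm f / cmod c"
proof -
  have eq: "(\<lambda>x. f x / c) = (\<lambda>x. inverse c * f x)" by (auto simp: divide_inverse)
  show "(\<lambda>x. f x / c) \<in> L2_space" unfolding eq by (rule L2_mult_left(1)[OF assms])
  show "L2_norm (\<lambda>x. f x / c) = L2_norm f / cmod c"
    unfolding eq L2_mult_left(2)[OF assms] by (simp add: divide_inverse norm_inverse)
qed

lemma L2_cnj:
  assumes "f \<in> L2_space" shows "(\<lambda>x. cnj (f x)) \<in> L2_space" "L2_norm (\<lambda>x. cnj (f x)) = L2_norm f"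
proof -
  have "(\<lambda>x. cnj (f x)) \<in> borel_measurable lebesgue"
    by (rule measurable_compose[OF L2_measurable[OF assms] borel_measurable_continuous_onI]) (intro continuous_intros)
  then show "(\<lambda>x. cnj (f x)) \<in> L2_space"
    using assms by (auto simp: L2_space_def)
  show "L2_norm (\<lambda>x. cnj (f x)) = L2_norm f" by (simp add: L2_norm_def)
qed

lemma L2_prod_integrable:
  assumes f: "f \<in> L2_space" and g: "g \<in> L2_space"
  shows "integrable lebesgue (\<lambda>x. f x * g x)"
proof (rule Bochner_Integration.integrable_bound)
  show "integrable lebesgue (\<lambda>x. (cmod (f x))\<^sup>2 + (cmod (g x))\<^sup>2)"
    using L2_integrable[OF f] L2_integrable[OF g] by simp
  show "(\<lambda>x. f x * g x) \<in> borel_measurable lebesgue"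
    using f g by (auto intro!: borel_measurable_times L2_measurable)
  show "AE x in lebesgue. norm (f x * g x) \<le> norm ((cmod (f x))\<^sup>2 + (cmod (g x))\<^sup>2)"
  proof (intro AE_I2)
    fix x
    have "2 * (cmod (f x) * cmod (g x)) \<le> (cmod (f x))\<^sup>2 + (cmod (g x))\<^sup>2"
      using sum_squares_bound[of "cmod (f x)" "cmod (g x)"] by (simp add: mult.assoc)
    moreover have "0 \<le> cmod (f x) * cmod (g x)" by simp
    ultimately have "cmod (f x) * cmod (g x) \<le> (cmod (f x))\<^sup>2 + (cmod (g x))\<^sup>2" by linarith
    then show "norm (f x * g x) \<le> norm ((cmod (f x))\<^sup>2 + (cmod (g x))\<^sup>2)"
      by (simp add: norm_mult)
  qed
qed

text \<open>Cauchy-Schwarz for nonnegative integrals asks for no integrability. Since the product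
  and both squares are integrable here, every integral is a finite real and the inequality
  descends.\<close>

lemma L2_norm_mult_integral_le:
  assumes f: "f \<in> L2_space" and g: "g \<in> L2_space"
  shows "(\<integral>x. cmod (f x) * cmod (g x) \<partial>lebesgue) \<le> L2_norm f * L2_norm g"
proof -
  have int: "integrable lebesgue (\<lambda>x. cmod (f x) * cmod (g x))"
    using integrable_norm[OF L2_prod_integrable[OF f g]] by (simp add: norm_mult)
  let ?A = "\<integral>x. cmod (f x) * cmod (g x) \<partial>lebesgue"
  have [measurable]: "f \<in> borel_measurable lebesgue" "g \<in> borel_measurable lebesgue"
    using f g by (auto intro: L2_measurable)
  have A: "0 \<le> ?A" by (intro integral_nonneg_AE) auto
  have "(\<integral>\<^sup>+x. ennreal (cmod (f x)) * ennreal (cmod (g x)) \<partial>lebesgue)\<^sup>2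
      \<le> (\<integral>\<^sup>+x. ennreal (cmod (f x)) ^ 2 \<partial>lebesgue) * (\<integral>\<^sup>+x. ennreal (cmod (g x)) ^ 2 \<partial>lebesgue)"
    by (rule Cauchy_Schwarz_nn_integral) auto
  also have "(\<integral>\<^sup>+x. ennreal (cmod (f x)) * ennreal (cmod (g x)) \<partial>lebesgue) = ennreal ?A"
    by (subst nn_integral_eq_integral[symmetric, OF int]) (auto simp: ennreal_mult)
  also have "(\<integral>\<^sup>+x. ennreal (cmod (f x)) ^ 2 \<partial>lebesgue) = ennreal ((L2_norm f)\<^sup>2)"
    unfolding L2_norm_sq by (subst nn_integral_eq_integral[symmetric, OF L2_integrable[OF f]]) (auto simp: ennreal_power)
  also have "(\<integral>\<^sup>+x. ennreal (cmod (g x)) ^ 2 \<partial>lebesgue) = ennreal ((L2_norm g)\<^sup>2)"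
    unfolding L2_norm_sq by (subst nn_integral_eq_integral[symmetric, OF L2_integrable[OF g]]) (auto simp: ennreal_power)
  finally have "?A\<^sup>2 \<le> (L2_norm f * L2_norm g)\<^sup>2"
    using A by (simp add: ennreal_power power_mult_distrib flip: ennreal_mult)
  then show ?thesis by (rule power2_le_imp_le) simp
qed

lemma L2_Cauchy_Schwarz:
  assumes f: "f \<in> L2_space" and g: "g \<in> L2_space"
  shows "cmod (\<integral>x. f x * g x \<partial>lebesgue) \<le> L2_norm f * L2_norm g"
proof -
  have "cmod (\<integral>x. f x * g x \<partial>lebesgue) \<le> (\<integral>x. cmod (f x * g x) \<partial>lebesgue)" by simp
  also have "\<dots> \<le> L2_norm f * L2_norm g"
    using L2_norm_mult_integral_le[OF f g] by (simp add: norm_mult)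
  finally show ?thesis .
qed

lemma L2_add:
  assumes f: "f \<in> L2_space" and g: "g \<in> L2_space"
  shows "(\<lambda>x. f x + g x) \<in> L2_space" "L2_norm (\<lambda>x. f x + g x) \<le> L2_norm f + L2_norm g"
proof -
  note [measurable] = L2_measurable[OF f] L2_measurable[OF g]
  have int: "integrable lebesgue (\<lambda>x. cmod (f x) * cmod (g x))"
    using integrable_norm[OF L2_prod_integrable[OF f g]] by (simp add: norm_mult)
  let ?h = "\<lambda>x. (cmod (f x))\<^sup>2 + 2 * (cmod (f x) * cmod (g x)) + (cmod (g x))\<^sup>2"
  have inth: "integrable lebesgue ?h"
    by (intro Bochner_Integration.integrable_add integrable_mult_right int L2_integrable f g)
  have le: "(cmod (f x + g x))\<^sup>2 \<le> ?h x" for x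
  proof -
    have "(cmod (f x + g x))\<^sup>2 \<le> (cmod (f x) + cmod (g x))\<^sup>2"
      by (intro power_mono norm_triangle_ineq) auto
    then show ?thesis by (simp add: power2_sum algebra_simps)
  qed
  have "integrable lebesgue (\<lambda>x. (cmod (f x + g x))\<^sup>2)"
    by (rule Bochner_Integration.integrable_bound[OF inth])
       (use le in \<open>auto intro!: AE_I2 order_trans[OF le]\<close>)
  then show S: "(\<lambda>x. f x + g x) \<in> L2_space" by (intro L2_spaceI) auto
  have "(L2_norm (\<lambda>x. f x + g x))\<^sup>2 \<le> (\<integral>x. ?h x \<partial>lebesgue)"
    unfolding L2_norm_sq by (intro integral_mono L2_integrable[OF S] inth le)
  also have "\<dots> = (L2_norm f)\<^sup>2 + 2 * (\<integral>x. cmod (f x) * cmod (g x) \<partial>lebesgue) + (L2_norm g)\<^sup>2"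
    using int L2_integrable[OF f] L2_integrable[OF g] by (simp add: L2_norm_sq)
  also have "\<dots> \<le> (L2_norm f + L2_norm g)\<^sup>2"
    using L2_norm_mult_integral_le[OF f g] by (simp add: power2_sum)
  finally show "L2_norm (\<lambda>x. f x + g x) \<le> L2_norm f + L2_norm g"
    by (rule power2_le_imp_le) simp
qed

lemma L2_diff:
  assumes f: "f \<in> L2_space" and g: "g \<in> L2_space"
  shows "(\<lambda>x. f x - g x) \<in> L2_space" "L2_norm (\<lambda>x. f x - g x) \<le> L2_norm f + L2_norm g"
proof -
  have eq: "(\<lambda>x. f x - g x) = (\<lambda>x. f x + (- 1) * g x)" by auto
  show "(\<lambda>x. f x - g x) \<in> L2_space"
    unfolding eq by (rule L2_add(1)[OF f L2_mult_left(1)[OF g]])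
  show "L2_norm (\<lambda>x. f x - g x) \<le> L2_norm f + L2_norm g"
    unfolding eq using L2_add(2)[OF f L2_mult_left(1)[OF g, of "-1"]] L2_mult_left(2)[OF g, of "-1"] by simp
qed

lemma L2_norm_triangle:
  assumes "f \<in> L2_space" "g \<in> L2_space" "h \<in> L2_space"
  shows "L2_norm (\<lambda>x. f x - h x) \<le> L2_norm (\<lambda>x. f x - g x) + L2_norm (\<lambda>x. g x - h x)"
  using L2_add(2)[OF L2_diff(1)[OF assms(1,2)] L2_diff(1)[OF assms(2,3)]] by simp

lemma L2_norm_diff_le:
  assumes "f \<in> L2_space" "g \<in> L2_space"
  shows "\<bar>L2_norm f - L2_norm g\<bar> \<le> L2_norm (\<lambda>x. f x - g x)"
  using L2_norm_triangle[OF assms(1,2) L2_zero] L2_norm_triangle[OF assms(2,1) L2_zero]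
    L2_norm_minus_commute[of f g] by simp

lemma L2_norm_eq_0D:
  assumes f: "f \<in> L2_space" and "L2_norm f = 0" shows "AE x in lebesgue. f x = 0"
proof -
  have "(\<integral>x. (cmod (f x))\<^sup>2 \<partial>lebesgue) = 0"
    using assms L2_norm_sq[of f] by simp
  then show ?thesis
    by (subst (asm) integral_nonneg_eq_0_iff_AE) (use L2_integrable[OF f] in auto)
qed

lemma L2_norm_tendsto:
  assumes "\<And>k. F k \<in> L2_space" "f \<in> L2_space" "((\<lambda>k. L2_norm (\<lambda>x. F k x - f x)) \<longlongrightarrow> 0) A"
  shows "((\<lambda>k. L2_norm (F k)) \<longlongrightarrow> L2_norm f) A"
proof (rule LIM_zero_cancel, rule Lim_null_comparison[OF _ assms(3)])
  show "\<forall>\<^sub>F k in A. norm (L2_norm (F k) - L2_norm f) \<le> L2_norm (\<lambda>x. F k x - f x)"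
    using L2_norm_diff_le[OF assms(1,2)] by (intro always_eventually) auto
qed

text \<open>The difference of products splits as \<open>(F k - f) * G k + f * (G k - g)\<close>. The
  factor \<open>L2_norm (G k)\<close> converges, so it does not spoil the first term.\<close>

lemma L2_prod_tendsto:
  fixes F G :: "nat \<Rightarrow> real^'n \<Rightarrow> complex"
  assumes F: "\<And>k. F k \<in> L2_space" "f \<in> L2_space" "(\<lambda>k. L2_norm (\<lambda>x. F k x - f x)) \<longlonglongrightarrow> 0"
    and G: "\<And>k. G k \<in> L2_space" "g \<in> L2_space" "(\<lambda>k. L2_norm (\<lambda>x. G k x - g x)) \<longlonglongrightarrow> 0"
  shows "(\<lambda>k. \<integral>x. F k x * G k x \<partial>lebesgue) \<longlonglongrightarrow> (\<integral>x. f x * g x \<partial>lebesgue)"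
proof (rule LIM_zero_cancel, rule Lim_null_comparison)
  let ?R = "\<lambda>k. L2_norm (\<lambda>x. F k x - f x) * L2_norm (G k) + L2_norm f * L2_norm (\<lambda>x. G k x - g x)"
  have "?R \<longlonglongrightarrow> 0 * L2_norm g + L2_norm f * 0"
    by (intro tendsto_intros F G L2_norm_tendsto)
  then show "?R \<longlonglongrightarrow> 0" by simp
  have "norm ((\<integral>x. F k x * G k x \<partial>lebesgue) - (\<integral>x. f x * g x \<partial>lebesgue)) \<le> ?R k" for k
  proof -
    have "(\<integral>x. F k x * G k x \<partial>lebesgue) - (\<integral>x. f x * g x \<partial>lebesgue)
      = (\<integral>x. (F k x - f x) * G k x \<partial>lebesgue) + (\<integral>x. f x * (G k x - g x) \<partial>lebesgue)"
      using L2_prod_integrable[OF F(1) G(1), of k k] L2_prod_integrable[OF F(2) G(1), of k]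
        L2_prod_integrable[OF F(2) G(2)]
      by (simp add: left_diff_distrib right_diff_distrib)
    also have "norm \<dots> \<le> ?R k"
      by (intro order_trans[OF norm_triangle_ineq] add_mono L2_Cauchy_Schwarz L2_diff F G)
    finally show ?thesis .
  qed
  then show "\<forall>\<^sub>F k in sequentially. norm ((\<integral>x. F k x * G k x \<partial>lebesgue) - (\<integral>x. f x * g x \<partial>lebesgue)) \<le> ?R k"
    by (intro always_eventually) auto
qed

lemma L2_dominated_convergence:
  fixes F :: "nat \<Rightarrow> real^'n \<Rightarrow> complex" and w :: "real^'n \<Rightarrow> real"
  assumes F: "\<And>k. F k \<in> borel_measurable lebesgue" and f: "f \<in> borel_measurable lebesgue"
    and w: "integrable lebesgue (\<lambda>x. (w x)\<^sup>2)"
    and le: "\<And>k. AE x in lebesgue. cmod (F k x) \<le> w x"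
    and lim: "AE x in lebesgue. (\<lambda>k. F k x) \<longlonglongrightarrow> f x"
  shows "f \<in> L2_space" "\<And>k. F k \<in> L2_space" "(\<lambda>k. L2_norm (\<lambda>x. F k x - f x)) \<longlonglongrightarrow> 0"
proof -
  note [measurable] = F f
  have le_all: "AE x in lebesgue. \<forall>k. cmod (F k x) \<le> w x"
    using le by (simp add: AE_all_countable)
  have lef: "AE x in lebesgue. cmod (f x) \<le> w x"
    using le_all lim
  proof eventually_elim
    case (elim x)
    show ?case by (rule LIMSEQ_le_const2[OF tendsto_norm[OF elim(2)]]) (use elim in auto)
  qed
  have sq: "integrable lebesgue (\<lambda>x. (cmod (h x))\<^sup>2)"
    if "h \<in> borel_measurable lebesgue" "AE x in lebesgue. cmod (h x) \<le> w x" for h :: "real^'n \<Rightarrow> complex"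
    by (rule Bochner_Integration.integrable_bound[OF w])
       (use that in \<open>auto elim!: eventually_mono intro!: power_mono\<close>)
  show "f \<in> L2_space" by (intro L2_spaceI f sq lef)
  show "F k \<in> L2_space" for k by (intro L2_spaceI F sq le)
  have "(\<lambda>k. \<integral>x. (cmod (F k x - f x))\<^sup>2 \<partial>lebesgue) \<longlonglongrightarrow> (\<integral>x. 0 \<partial>(lebesgue :: (real^'n) measure))"
  \<comment> \<open>The limit inherits the bound \<open>w\<close>, so the difference is at most
    \<open>2 * w x\<close> and its square at most four times the square of
    \<open>w x\<close>.\<close>
  proof (rule integral_dominated_convergence[where w="\<lambda>x. 4 * (w x)\<^sup>2"])
    show "integrable lebesgue (\<lambda>x. 4 * (w x)\<^sup>2)" using w by simp
    show "AE x in lebesgue. (\<lambda>k. (cmod (F k x - f x))\<^sup>2) \<longlonglongrightarrow> 0"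
      using lim
    proof eventually_elim
      case (elim x)
      have "(\<lambda>k. (cmod (F k x - f x))\<^sup>2) \<longlonglongrightarrow> (cmod (f x - f x))\<^sup>2" by (intro tendsto_intros elim)
      then show ?case by simp
    qed
    show "AE x in lebesgue. norm ((cmod (F k x - f x))\<^sup>2) \<le> 4 * (w x)\<^sup>2" for k
      using le[of k] lef
    proof eventually_elim
      case (elim x)
      have "cmod (F k x - f x) \<le> 2 * w x" using elim norm_triangle_ineq4[of "F k x" "f x"] by simp
      then have "(cmod (F k x - f x))\<^sup>2 \<le> (2 * w x)\<^sup>2" by (intro power_mono) auto
      then show ?case by (simp add: power_mult_distrib)
    qed
  qed auto
  then have "(\<lambda>k. sqrt (\<integral>x. (cmod (F k x - f x))\<^sup>2 \<partial>lebesgue)) \<longlonglongrightarrow> sqrt 0"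
    by (intro tendsto_real_sqrt) simp
  then show "(\<lambda>k. L2_norm (\<lambda>x. F k x - f x)) \<longlonglongrightarrow> 0" by (simp add: L2_norm_def)
qed

section \<open>Density of continuous functions of compact support, and completeness\<close>

definition compactly_supported :: "(real^'n \<Rightarrow> complex) \<Rightarrow> bool" where
  "compactly_supported h \<longleftrightarrow> continuous_on UNIV h \<and> (\<exists>R. \<forall>x. R \<le> norm x \<longrightarrow> h x = 0)"

lemma integrable_indicator_ball [simp]: "integrable lebesgue (indicat_real (ball x r))"
  using emeasure_bounded_finite[of "ball x r"] by (intro integrable_real_indicator) auto

lemma compactly_supported_bounded:
  assumes "compactly_supported h"
  obtains R B where "R > 0" "B > 0" "\<And>x. cmod (h x) \<le> B * indicator (ball 0 R) x"
proof -
  obtain R where R: "\<And>x. R \<le> norm x \<Longrightarrow> h x = 0" and cont: "continuous_on UNIV h"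
    using assms by (auto simp: compactly_supported_def)
  have "compact (h ` cball 0 \<bar>R\<bar>)"
    by (intro compact_continuous_image continuous_on_subset[OF cont]) auto
  then obtain B where B: "B > 0" "\<And>x. x \<in> cball 0 \<bar>R\<bar> \<Longrightarrow> cmod (h x) \<le> B"
    using compact_imp_bounded[of "h ` cball 0 \<bar>R\<bar>"] by (auto simp: bounded_pos)
  show thesis
  proof (rule that[of "\<bar>R\<bar> + 1" B])
    fix x show "cmod (h x) \<le> B * indicator (ball 0 (\<bar>R\<bar> + 1)) x"
    proof (cases "norm x \<le> \<bar>R\<bar>")
      case True
      then show ?thesis using B(2)[of x] by (simp add: indicator_def)
    next
      case False
      then show ?thesis using R[of x] B(1) by (simp add: indicator_def)
    qed
  qed (use B in auto)
qed

lemma compactly_supported_borel: "compactly_supported h \<Longrightarrow> h \<in> borel_measurable borel"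
  by (simp add: compactly_supported_def borel_measurable_continuous_onI)

lemma compactly_supported_lebesgue: "compactly_supported h \<Longrightarrow> h \<in> borel_measurable lebesgue"
  using measurable_completion[of h lborel borel] by (simp add: compactly_supported_borel)

lemma compactly_supported_integrable:
  assumes "compactly_supported h"
  shows "integrable lebesgue h"
proof -
  obtain R B where *: "R > 0" "B > 0" "\<And>x. cmod (h x) \<le> B * indicator (ball 0 R) x"
    using compactly_supported_bounded[OF assms] by blast
  have "integrable lebesgue (\<lambda>x. B * indicat_real (ball 0 R) x)" by simp
  then show ?thesis
  proof (rule Bochner_Integration.integrable_bound[OF _ compactly_supported_lebesgue[OF assms] AE_I2])
    show "norm (h x) \<le> norm (B * indicat_real (ball 0 R) x)" for x
      unfolding real_norm_def by (rule order_trans[OF *(3) abs_ge_self])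
  qed
qed

lemma compactly_supported_L2:
  assumes "compactly_supported h"
  shows "h \<in> L2_space"
proof -
  obtain R B where *: "R > 0" "B > 0" "\<And>x. cmod (h x) \<le> B * indicator (ball 0 R) x"
    using compactly_supported_bounded[OF assms] by blast
  have int: "integrable lebesgue (\<lambda>x. B^2 * indicat_real (ball 0 R) x)" by simp
  have le: "(cmod (h x))\<^sup>2 \<le> B\<^sup>2 * indicat_real (ball 0 R) x" for x
    using power_mono[OF *(3)[of x], of 2] by (auto simp: power_mult_distrib indicator_def)
  note [measurable] = compactly_supported_lebesgue[OF assms]
  show ?thesis
  proof (intro L2_spaceI Bochner_Integration.integrable_bound[OF int] AE_I2)
    show "norm ((cmod (h x))\<^sup>2) \<le> norm (B\<^sup>2 * indicat_real (ball 0 R) x)" for x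
      unfolding real_norm_def using le[of x] by simp
  qed auto
qed

text \<open>\<open>cut m x z\<close> multiplies by a continuous bump living on the ball of radius
  \<open>m\<close> and pulls values of modulus above \<open>m\<close> back to the circle of radius
  \<open>m\<close>. For positive \<open>m\<close> it is continuous in \<open>x\<close> and
  \<open>z\<close>, so it preserves continuity of functions. It also supplies the dominating
  functions: \<open>cmod (f x)\<close> when \<open>f\<close> is cut, and \<open>m\<close> on the
  ball when continuous approximants of \<open>f\<close> are cut.\<close>

lemma L2_approx_compactly_supported:
  fixes f :: "real^'n \<Rightarrow> complex"
  assumes f: "f \<in> L2_space" and e: "e > 0"
  shows "\<exists>h. compactly_supported h \<and> L2_norm (\<lambda>x. h x - f x) < e"
proof -
  define cut :: "real \<Rightarrow> real^'n \<Rightarrow> complex \<Rightarrow> complex"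
    where "cut m x z = of_real (max 0 (min 1 (m - norm x))) * (z / of_real (max 1 (cmod z / m)))" for m x z
  define b where "b m x = max 0 (min 1 (m - norm x))" for m and x :: "real^'n"
  have b: "0 \<le> b m x" "b m x \<le> 1" for m x by (auto simp: b_def)
  have norm_cut: "cmod (cut m x z) = b m x * (cmod z / max 1 (cmod z / m))" for m x z
    by (simp add: cut_def b_def norm_mult norm_divide)
  have cut_le1: "cmod (cut m x z) \<le> cmod z" for m x z
  proof -
    have "cmod z / max 1 (cmod z / m) \<le> cmod z"
      by (simp add: divide_le_eq mult_left_le le_max_iff_disj) (smt (verit) mult_left_mono mult_cancel_left2 norm_ge_zero)
    then show ?thesis unfolding norm_cut
      using b[of m x] by (smt (verit) mult_left_le_one_le divide_nonneg_nonneg norm_ge_zero)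
  qed
  have cut_le2: "cmod (cut m x z) \<le> m * indicator (ball 0 m) x" if "m > 0" for m x z
  proof -
    have "cmod z / max 1 (cmod z / m) \<le> m"
      using that by (auto simp: divide_le_eq max_def field_simps)
    moreover have "b m x = 0" if "x \<notin> ball 0 m" using that by (simp add: b_def)
    moreover have "b m x * (cmod z / max 1 (cmod z / m)) \<le> cmod z / max 1 (cmod z / m)"
      using b[of m x] by (intro mult_left_le_one_le) auto
    ultimately show ?thesis unfolding norm_cut by (auto simp: indicator_def)
  qed
  have cont_cut: "continuous_on UNIV (\<lambda>x. cut m x (g x))" if "continuous_on UNIV g" "m > 0" for m g
    unfolding cut_def using that by (intro continuous_intros) (auto simp: max_def)
  have meas_cut: "(\<lambda>x. cut m x (g x)) \<in> borel_measurable lebesgue" if [measurable]: "g \<in> borel_measurable lebesgue" for m g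
  proof -
    have [measurable]: "(\<lambda>x::real^'n. norm x) \<in> borel_measurable lebesgue"
      using measurable_completion[of norm lborel borel] by simp
    show ?thesis unfolding cut_def by measurable
  qed
  have comp_cut: "compactly_supported (\<lambda>x. cut m x (g x))" if "continuous_on UNIV g" "m > 0" for m g
    unfolding compactly_supported_def using cont_cut[OF that] by (auto intro!: exI[of _ m] simp: cut_def)
  note fm = L2_measurable[OF f]
  have step1: "(\<lambda>m. L2_norm (\<lambda>x. cut (real m) x (f x) - f x)) \<longlonglongrightarrow> 0"
  proof (rule L2_dominated_convergence(3)[where w="\<lambda>x. cmod (f x)"])
    show "AE x in lebesgue. (\<lambda>m. cut (real m) x (f x)) \<longlonglongrightarrow> f x"
    proof (intro AE_I2 tendsto_eventually eventually_sequentiallyI)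
      \<comment> \<open>From this index on neither the bump nor the truncation of the modulus alters
        \<open>f x\<close>.\<close>
      fix x k assume k: "nat \<lceil>norm x + 1 + cmod (f x)\<rceil> \<le> k"
      then have "norm x + 1 + cmod (f x) \<le> real k" by linarith
      then have "real k - norm x \<ge> 1" "cmod (f x) \<le> real k" "real k > 0"
        by (smt (verit) norm_ge_zero)+
      then show "cut (real k) x (f x) = f x"
        by (simp add: cut_def max_def min_def divide_le_eq)
    qed
  qed (auto intro!: meas_cut[OF fm] fm L2_integrable[OF f] cut_le1)
  then have "\<forall>\<^sub>F m in sequentially. L2_norm (\<lambda>x. cut (real m) x (f x) - f x) < e / 2"
    using e by (intro order_tendstoD) auto
  then obtain m :: nat where m: "m > 0" "L2_norm (\<lambda>x. cut m x (f x) - f x) < e / 2"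
    using eventually_happens'[OF sequentially_bot eventually_conj[OF eventually_gt_at_top[of 0]]] by blast
  \<comment> \<open>This notion of measurability yields continuous \<open>g n\<close> converging to
    \<open>f\<close> off a negligible set, without control of their size; \<open>cut\<close>
    provides that control.\<close>
  have "f measurable_on UNIV"
    by (rule lebesgue_measurable_imp_measurable_on) (auto intro: fm)
  then obtain N g where N: "negligible N" and g: "\<And>n. continuous_on UNIV (g n)"
    and lim: "\<And>x. x \<notin> N \<Longrightarrow> (\<lambda>n. g n x) \<longlonglongrightarrow> f x"
    by (auto simp: measurable_on_def)
  have gm: "g n \<in> borel_measurable lebesgue" for n
    using measurable_completion[of "g n" lborel borel] borel_measurable_continuous_onI[OF g] by simp
  have cutf: "(\<lambda>x. cut m x (f x)) \<in> L2_space"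
    by (rule L2_dominated(1)[OF f, of _ 1]) (auto intro!: meas_cut[OF fm] cut_le1)
  have step2: "(\<lambda>n. L2_norm (\<lambda>x. cut m x (g n x) - cut m x (f x))) \<longlonglongrightarrow> 0"
  proof (rule L2_dominated_convergence(3)[where w="\<lambda>x. real m * indicat_real (ball 0 (real m)) x"])
    have "(\<lambda>x::real^'n. (real m * indicat_real (ball 0 (real m)) x)\<^sup>2) = (\<lambda>x. (real m)\<^sup>2 * indicat_real (ball 0 (real m)) x)"
      by (auto simp: indicator_def power_mult_distrib)
    then show "integrable lebesgue (\<lambda>x::real^'n. (real m * indicat_real (ball 0 (real m)) x)\<^sup>2)" by simp
    show "AE x in lebesgue. (\<lambda>k. cut (real m) x (g k x)) \<longlonglongrightarrow> cut (real m) x (f x)"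
    proof (rule AE_I')
      have tend: "(\<lambda>k. cut (real m) x (y k)) \<longlonglongrightarrow> cut (real m) x z" if "y \<longlonglongrightarrow> z" for x y z
        unfolding cut_def by (intro tendsto_intros that) (use m in \<open>auto simp: max_def\<close>)
      show "N \<in> null_sets lebesgue" using N by (simp add: negligible_iff_null_sets)
      show "{x \<in> space lebesgue. \<not> (\<lambda>k. cut (real m) x (g k x)) \<longlonglongrightarrow> cut (real m) x (f x)} \<subseteq> N"
        using tend lim by blast
    qed
  qed (use m in \<open>auto intro!: meas_cut fm gm cut_le2\<close>)
  then have "\<forall>\<^sub>F n in sequentially. L2_norm (\<lambda>x. cut m x (g n x) - cut m x (f x)) < e / 2"
    using e by (intro order_tendstoD) auto
  then obtain n where n: "L2_norm (\<lambda>x. cut m x (g n x) - cut m x (f x)) < e / 2"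
    by (auto simp: eventually_sequentially)
  have cs: "compactly_supported (\<lambda>x. cut m x (g n x))"
    using comp_cut g m by simp
  have "L2_norm (\<lambda>x. cut m x (g n x) - f x) < e"
    using L2_norm_triangle[OF compactly_supported_L2[OF cs] cutf f] n m by linarith
  with cs show ?thesis by blast
qed

lemma L2_dense_compactly_supported:
  fixes f :: "real^'n \<Rightarrow> complex"
  assumes f: "f \<in> L2_space"
  obtains F where "\<And>k. compactly_supported (F k)" "(\<lambda>k. L2_norm (\<lambda>x. F k x - f x)) \<longlonglongrightarrow> 0"
proof -
  have "\<exists>h. compactly_supported h \<and> L2_norm (\<lambda>x. h x - f x) < 1 / real (Suc k)" for k
    by (rule L2_approx_compactly_supported[OF f]) simp
  then obtain F where F: "\<And>k. compactly_supported (F k)" "\<And>k. L2_norm (\<lambda>x. F k x - f x) < 1 / real (Suc k)"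
    by metis
  have "(\<lambda>k. L2_norm (\<lambda>x. F k x - f x)) \<longlonglongrightarrow> 0"
    by (rule Lim_null_comparison[OF _ LIMSEQ_inverse_real_of_nat])
       (use F(2) in \<open>auto intro!: always_eventually simp: inverse_eq_divide intro: less_imp_le\<close>)
  with F(1) show thesis by (rule that)
qed

text \<open>Along a subsequence with increments \<open>d n\<close> of norm at most \<open>2\<^sup>-\<^sup>n\<close> the series \<open>\<Sum> 2\<^sup>n |d n|\<^sup>2\<close> is integrable,
  hence finite almost everywhere, which forces pointwise convergence; Fatou gives convergence in norm.\<close>

lemma L2_complete:
  fixes F :: "nat \<Rightarrow> real^'n \<Rightarrow> complex"
  assumes F: "\<And>k. F k \<in> L2_space"
    and Cauchy: "\<And>e. e > 0 \<Longrightarrow> \<exists>K. \<forall>i\<ge>K. \<forall>j\<ge>K. L2_norm (\<lambda>x. F i x - F j x) < e"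
  obtains g where "g \<in> L2_space" "(\<lambda>k. L2_norm (\<lambda>x. F k x - g x)) \<longlonglongrightarrow> 0"
proof -
  note [measurable] = L2_measurable[OF F]
  have nn: "(\<integral>\<^sup>+x. ennreal ((cmod (h x))\<^sup>2) \<partial>lebesgue) = ennreal ((L2_norm h)\<^sup>2)"
    if "h \<in> L2_space" for h :: "real^'n \<Rightarrow> complex"
    unfolding L2_norm_sq by (rule nn_integral_eq_integral) (use L2_integrable[OF that] in auto)
  have "\<exists>r::nat\<Rightarrow>nat. \<forall>n. (\<forall>i\<ge>r n. \<forall>j\<ge>r n. L2_norm (\<lambda>x. F i x - F j x) < (1/2)^n) \<and> r n \<le> r (Suc n)"
  proof (rule dependent_nat_choice)
    show "\<exists>K. \<forall>i\<ge>K. \<forall>j\<ge>K. L2_norm (\<lambda>x. F i x - F j x) < (1/2)^0" using Cauchy[of 1] by simp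
    fix K n
    obtain K' where "\<forall>i\<ge>K'. \<forall>j\<ge>K'. L2_norm (\<lambda>x. F i x - F j x) < (1/2)^Suc n" using Cauchy[of "(1/2)^Suc n"] by auto
    then show "\<exists>K'. (\<forall>i\<ge>K'. \<forall>j\<ge>K'. L2_norm (\<lambda>x. F i x - F j x) < (1/2)^Suc n) \<and> K \<le> K'"
      by (intro exI[of _ "max K K'"]) auto
  qed
  then obtain r where r: "\<And>n i j. i \<ge> r n \<Longrightarrow> j \<ge> r n \<Longrightarrow> L2_norm (\<lambda>x. F i x - F j x) < (1/2)^n"
    and mono: "\<And>n. r n \<le> r (Suc n)" by blast
  define d where "d n x = F (r (Suc n)) x - F (r n) x" for n x
  have dS: "d n \<in> L2_space" for n unfolding d_def by (intro L2_diff F)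
  note [measurable] = L2_measurable[OF dS]
  have d: "L2_norm (d n) \<le> (1/2)^n" for n
    unfolding d_def using r[of n "r (Suc n)" "r n"] mono by (simp add: less_imp_le)
  have "(\<integral>\<^sup>+x. (\<Sum>n. ennreal (2^n * (cmod (d n x))\<^sup>2)) \<partial>lebesgue) = (\<Sum>n. \<integral>\<^sup>+x. ennreal (2^n * (cmod (d n x))\<^sup>2) \<partial>lebesgue)"
    by (rule nn_integral_suminf) auto
  also have "\<dots> \<le> (\<Sum>n. ennreal ((1/2)^n))"
  proof (intro suminf_le)
    fix n
    have "(\<integral>\<^sup>+x. ennreal (2^n * (cmod (d n x))\<^sup>2) \<partial>lebesgue) = ennreal (2^n) * ennreal ((L2_norm (d n))\<^sup>2)"
      unfolding nn[OF dS, symmetric] by (subst nn_integral_cmult[symmetric]) (auto simp: ennreal_mult)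
    also have "\<dots> \<le> ennreal ((1/2)^n)"
    proof -
      have "2^n * (L2_norm (d n))\<^sup>2 \<le> 2^n * ((1/2)^n)\<^sup>2"
        by (intro mult_left_mono power_mono d) auto
      also have "\<dots> = (1/2)^n" by (simp add: power2_eq_square power_divide)
      finally show ?thesis by (simp add: ennreal_leI flip: ennreal_mult)
    qed
    finally show "(\<integral>\<^sup>+x. ennreal (2^n * (cmod (d n x))\<^sup>2) \<partial>lebesgue) \<le> ennreal ((1/2)^n)" .
  qed auto
  also have "(\<Sum>n. ennreal ((1/2)^n)) = ennreal (\<Sum>n. (1/2)^n)"
    by (intro suminf_ennreal2 summable_geometric) auto
  also have "\<dots> < \<infinity>" by simp
  finally have "AE x in lebesgue. (\<Sum>n. ennreal (2^n * (cmod (d n x))\<^sup>2)) \<noteq> \<infinity>"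
    by (intro nn_integral_PInf_AE) auto
  then have conv: "AE x in lebesgue. convergent (\<lambda>n. F (r n) x)"
  proof eventually_elim
    case (elim x)
    have sm: "summable (\<lambda>n. 2^n * (cmod (d n x))\<^sup>2)"
      using elim by (intro summable_suminf_not_top) auto
    have "summable (\<lambda>n. cmod (d n x))"
    proof (rule summable_comparison_test'[OF summable_add[OF sm summable_geometric[of "1/2"]]])
      fix n
      \<comment> \<open>The weight passes from squares to first powers: \<open>cmod (d n x)\<close>
        is at most \<open>2^n\<close> times its square plus \<open>(1/2)^n\<close>, and both of
        these are summable.\<close>
      have "2 * (2^n * cmod (d n x)) \<le> (2^n * cmod (d n x))\<^sup>2 + 1"
        using sum_squares_bound[of "2^n * cmod (d n x)" 1] by simp
      then have "2^n * cmod (d n x) \<le> (2^n * cmod (d n x))\<^sup>2 + 1"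
        by (smt (verit) norm_ge_zero zero_le_mult_iff zero_le_power)
      also have "\<dots> = 2^n * (2^n * (cmod (d n x))\<^sup>2 + (1/2)^n)"
        by (simp add: power_mult_distrib power2_eq_square algebra_simps power_divide)
      finally show "norm (cmod (d n x)) \<le> 2 ^ n * (cmod (d n x))\<^sup>2 + (1 / 2) ^ n" by simp
    qed simp
    then have "summable (\<lambda>n. d n x)" by (rule summable_norm_cancel)
    then have "convergent (\<lambda>n. \<Sum>i<n. d i x)" by (simp add: summable_iff_convergent)
    moreover have "(\<Sum>i<n. d i x) = F (r n) x - F (r 0) x" for n
      by (induction n) (auto simp: d_def)
    ultimately have "convergent (\<lambda>n. (F (r n) x - F (r 0) x) + F (r 0) x)"
      by (intro convergent_add convergent_const) simp
    then show ?case by simp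
  qed
  define g where "g x = lim (\<lambda>n. F (r n) x)" for x
  have gm [measurable]: "g \<in> borel_measurable lebesgue"
    unfolding g_def by (intro borel_measurable_lim_metric) auto
  have lim: "AE x in lebesgue. (\<lambda>n. F (r n) x) \<longlonglongrightarrow> g x"
    using conv by eventually_elim (simp add: g_def convergent_LIMSEQ_iff)
  have Fatou: "(\<integral>\<^sup>+x. ennreal ((cmod (F k x - g x))\<^sup>2) \<partial>lebesgue) \<le> ennreal (((1/2)^n)\<^sup>2)" if k: "k \<ge> r n" for k n
  proof -
    have "(\<integral>\<^sup>+x. ennreal ((cmod (F k x - g x))\<^sup>2) \<partial>lebesgue) =
        (\<integral>\<^sup>+x. liminf (\<lambda>j. ennreal ((cmod (F k x - F (r j) x))\<^sup>2)) \<partial>lebesgue)"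
    proof (intro nn_integral_cong_AE)
      show "AE x in lebesgue. ennreal ((cmod (F k x - g x))\<^sup>2) = liminf (\<lambda>j. ennreal ((cmod (F k x - F (r j) x))\<^sup>2))"
        using lim
      proof eventually_elim
        case (elim x)
        have "(\<lambda>j. ennreal ((cmod (F k x - F (r j) x))\<^sup>2)) \<longlonglongrightarrow> ennreal ((cmod (F k x - g x))\<^sup>2)"
          by (intro tendsto_ennrealI tendsto_intros elim)
        then show ?case by (metis lim_imp_Liminf sequentially_bot)
      qed
    qed
    also have "\<dots> \<le> liminf (\<lambda>j. \<integral>\<^sup>+x. ennreal ((cmod (F k x - F (r j) x))\<^sup>2) \<partial>lebesgue)"
      by (rule nn_integral_liminf) auto
    also have "\<dots> = liminf (\<lambda>j. ennreal ((L2_norm (\<lambda>x. F k x - F (r j) x))\<^sup>2))"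
      by (simp add: nn L2_diff F)
    also have "\<dots> \<le> liminf (\<lambda>j. ennreal (((1/2)^n)\<^sup>2))"
    proof (rule Liminf_mono, rule eventually_sequentiallyI)
      fix j assume "n \<le> j"
      then have "r n \<le> r j" using lift_Suc_mono_le[of r] mono by blast
      then show "ennreal ((L2_norm (\<lambda>x. F k x - F (r j) x))\<^sup>2) \<le> ennreal (((1/2)^n)\<^sup>2)"
        using r[of n k "r j"] k by (intro ennreal_leI power_mono) (auto intro: less_imp_le)
    qed
    finally show ?thesis by (simp add: Liminf_const)
  qed
  have diffS: "(\<lambda>x. F k x - g x) \<in> L2_space" if "k \<ge> r 0" for k
    by (intro L2_spaceI integrableI_bounded) (use Fatou[OF that] in \<open>auto simp: le_less_trans\<close>)
  \<comment> \<open>Fatou controls only \<open>F k - g\<close>; the limit itself is recovered as a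
    difference of two square-integrable functions.\<close>
  have "(\<lambda>x. F (r 0) x - (F (r 0) x - g x)) \<in> L2_space" by (intro L2_diff F diffS) simp
  then have gS: "g \<in> L2_space" by simp
  have "\<exists>K. \<forall>k\<ge>K. norm (L2_norm (\<lambda>x. F k x - g x) - 0) < e" if "e > 0" for e
  proof -
    have "\<exists>n. (1/2)^n < e" by (rule real_arch_pow_inv) (use that in auto)
    then obtain n where n: "(1/2)^n < e" by blast
    have "L2_norm (\<lambda>x. F k x - g x) \<le> (1/2)^n" if "k \<ge> r n" for k
    proof (rule power2_le_imp_le)
      show "(L2_norm (\<lambda>x. F k x - g x))\<^sup>2 \<le> ((1 / 2) ^ n)\<^sup>2"
        using Fatou[OF that] nn[OF L2_diff(1)[OF F gS]] by (simp add: ennreal_le_iff)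
    qed simp
    then have "L2_norm (\<lambda>x. F k x - g x) < e" if "k \<ge> r n" for k
      using n that by (meson order.strict_trans1)
    then show ?thesis by (intro exI[of _ "r n"]) auto
  qed
  then have "(\<lambda>k. L2_norm (\<lambda>x. F k x - g x)) \<longlonglongrightarrow> 0" by (rule LIMSEQ_I)
  with gS show thesis by (rule that)
qed

section \<open>Gaussians and the Fourier transform of integrable functions\<close>

definition gauss :: "'a::euclidean_space \<Rightarrow> real" where
  "gauss x = exp (- (norm x)\<^sup>2 / 2)"

text \<open>The integral of \<open>fourier_L1\<close>, but against \<open>lborel\<close> and on any
  Euclidean space: Fubini and affine substitutions are carried out there, and the results are
  transported to the completion \<open>lebesgue\<close> afterwards.\<close>

definition fourier :: "('a::euclidean_space \<Rightarrow> complex) \<Rightarrow> 'a \<Rightarrow> complex" where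
  "fourier f \<xi> = (\<integral>x. exp (- \<i> * of_real (x \<bullet> \<xi>)) * f x \<partial>lborel)"

text \<open>\<open>lborel\<close> is the image of the product of one-dimensional Lebesgue measures
  under the coordinate map, so integrals of tensor products factor.\<close>

lemma has_bochner_integral_lborel_prod:
  fixes f :: "'a::euclidean_space \<Rightarrow> real \<Rightarrow> complex"
  assumes "\<And>b. b \<in> Basis \<Longrightarrow> integrable lborel (f b)"
  shows "has_bochner_integral lborel (\<lambda>x. \<Prod>b\<in>Basis. f b (x \<bullet> b)) (\<Prod>b\<in>Basis. \<integral>x. f b x \<partial>lborel)"
proof -
  interpret product_sigma_finite "\<lambda>_::'a. lborel :: real measure" ..
  have [measurable]: "\<And>b. b \<in> Basis \<Longrightarrow> f b \<in> borel_measurable borel"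
    using borel_measurable_integrable[OF assms] by simp
  have "has_bochner_integral (\<Pi>\<^sub>M b\<in>Basis. lborel) (\<lambda>x. \<Prod>b\<in>Basis. f b (x b)) (\<Prod>b\<in>(Basis::'a set). \<integral>x. f b x \<partial>lborel)"
    using product_integrable_prod[of Basis f] product_integral_prod[of Basis f] assms
    by (simp add: has_bochner_integral_iff)
  then have "has_bochner_integral (\<Pi>\<^sub>M b\<in>Basis. lborel) (\<lambda>x. \<Prod>b\<in>Basis. f b ((\<Sum>b\<in>Basis. x b *\<^sub>R b) \<bullet> b)) (\<Prod>b\<in>(Basis::'a set). \<integral>x. f b x \<partial>lborel)"
    by simp
  then show ?thesis
    unfolding lborel_eq[where 'a='a] by (intro has_bochner_integral_distr) auto
qed

lemma gauss_pos [simp]: "0 < gauss x" "0 \<le> gauss x"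
  by (simp_all add: gauss_def)

lemma gauss_le_1 [simp]: "gauss x \<le> 1"
  by (simp add: gauss_def)

lemma gauss_measurable [measurable]: "gauss \<in> borel_measurable borel"
  unfolding gauss_def by measurable

lemma gauss_minus [simp]: "gauss (- x) = gauss x"
  by (simp add: gauss_def)

lemma gauss_prod: "gauss (x :: 'a::euclidean_space) = (\<Prod>b\<in>Basis. exp (- (x \<bullet> b)\<^sup>2 / 2))"
proof -
  have "(norm x)\<^sup>2 = (\<Sum>b\<in>Basis. (x \<bullet> b)\<^sup>2)"
    unfolding power2_norm_eq_inner by (subst euclidean_inner) (simp add: power2_eq_square)
  then show ?thesis
    by (simp add: gauss_def exp_sum[symmetric] sum_negf sum_divide_distrib)
qed

lemma fourier_gauss_real:
  \<comment> \<open>Up to the factor \<open>sqrt (2 * pi)\<close> this is the characteristic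
    function of the standard normal distribution, taken at \<open>- t\<close> because of the sign in
    the exponent.\<close>
  "has_bochner_integral lborel (\<lambda>x::real. exp (- \<i> * of_real (x * t)) * of_real (exp (- x\<^sup>2 / 2))) (of_real (sqrt (2 * pi) * exp (- t\<^sup>2 / 2)))"
proof -
  let ?f = "\<lambda>x::real. exp (- \<i> * of_real (x * t)) * of_real (std_normal_density x) :: complex"
  have int: "integrable lborel ?f"
  proof (rule Bochner_Integration.integrable_bound)
    show "integrable lborel std_normal_density" by simp
    show "AE x in lborel. norm (?f x) \<le> norm (std_normal_density x)"
      by (intro AE_I2) (simp add: norm_mult norm_exp_i_times[of "- (_ * _)", simplified])
  qed measurable
  have "char std_normal_distribution (- t) = (\<integral>x. std_normal_density x *\<^sub>R iexp (- t * x) \<partial>lborel)"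
    unfolding char_def by (subst integral_density) auto
  also have "\<dots> = (\<integral>x. ?f x \<partial>lborel)"
    by (intro Bochner_Integration.integral_cong) (auto simp: scaleR_conv_of_real mult_ac)
  finally have "(\<integral>x. ?f x \<partial>lborel) = of_real (exp (- t\<^sup>2 / 2))"
    by (simp add: char_std_normal_distribution)
  with int have "has_bochner_integral lborel ?f (of_real (exp (- t\<^sup>2 / 2)))"
    by (simp add: has_bochner_integral_iff)
  then have "has_bochner_integral lborel (\<lambda>x. of_real (sqrt (2 * pi)) * ?f x) (of_real (sqrt (2 * pi)) * of_real (exp (- t\<^sup>2 / 2)))"
    by (rule has_bochner_integral_mult_right)
  then show ?thesis
    by (simp add: std_normal_density_def mult_ac)
qed

lemma fourier_gauss:
  "has_bochner_integral lborel (\<lambda>x::'a::euclidean_space. exp (- \<i> * of_real (x \<bullet> \<xi>)) * of_real (gauss x))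
     (of_real (sqrt (2 * pi) ^ DIM('a) * gauss \<xi>))"
proof -
  have eq: "exp (- \<i> * of_real (x \<bullet> \<xi>)) * of_real (gauss x) =
      (\<Prod>b\<in>Basis. exp (- \<i> * of_real ((x \<bullet> b) * (\<xi> \<bullet> b))) * complex_of_real (exp (- (x \<bullet> b)\<^sup>2 / 2)))" for x :: 'a
  proof -
    have "exp (- \<i> * of_real (x \<bullet> \<xi>)) = (\<Prod>b\<in>Basis. exp (- \<i> * of_real ((x \<bullet> b) * (\<xi> \<bullet> b))))"
      by (subst euclidean_inner) (simp add: exp_sum[symmetric] sum_distrib_left)
    then show ?thesis by (simp add: gauss_prod prod.distrib)
  qed
  note f1 = fourier_gauss_real
  have "has_bochner_integral lborel (\<lambda>x::'a. \<Prod>b\<in>Basis. exp (- \<i> * of_real ((x \<bullet> b) * (\<xi> \<bullet> b))) * complex_of_real (exp (- (x \<bullet> b)\<^sup>2 / 2)))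
     (\<Prod>b\<in>(Basis::'a set). \<integral>x. exp (- \<i> * of_real (x * (\<xi> \<bullet> b))) * complex_of_real (exp (- x\<^sup>2 / 2)) \<partial>lborel)"
    by (rule has_bochner_integral_lborel_prod) (use f1 in \<open>auto simp: has_bochner_integral_iff\<close>)
  also have "(\<Prod>b\<in>(Basis::'a set). \<integral>x. exp (- \<i> * of_real (x * (\<xi> \<bullet> b))) * complex_of_real (exp (- x\<^sup>2 / 2)) \<partial>lborel)
     = (\<Prod>b\<in>(Basis::'a set). of_real (sqrt (2 * pi) * exp (- (\<xi> \<bullet> b)\<^sup>2 / 2)))"
    using f1 by (intro prod.cong refl) (simp add: has_bochner_integral_iff)
  also have "\<dots> = of_real (sqrt (2 * pi) ^ DIM('a) * gauss \<xi>)"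
    by (simp add: gauss_prod prod.distrib)
  finally show ?thesis unfolding eq .
qed

lemma gauss_integrable [simp]: "integrable lborel (gauss :: 'a::euclidean_space \<Rightarrow> real)"
  using fourier_gauss[of "0::'a"] by (simp add: has_bochner_integral_iff complex_of_real_integrable_eq)

lemma gauss_integral: "(\<integral>x. gauss x \<partial>(lborel :: 'a::euclidean_space measure)) = sqrt (2 * pi) ^ DIM('a)"
proof -
  have "(\<integral>x. complex_of_real (gauss (x::'a)) \<partial>lborel) = of_real (sqrt (2 * pi) ^ DIM('a))"
    using fourier_gauss[of "0::'a"] by (simp add: has_bochner_integral_iff gauss_def)
  then show ?thesis by (simp only: integral_complex_of_real of_real_eq_iff)
qed

lemma lborel_integral_affine:
  fixes f :: "'a::euclidean_space \<Rightarrow> 'b::{banach, second_countable_topology}"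
  assumes [measurable]: "f \<in> borel_measurable borel" and c: "c > 0"
  shows "(\<integral>x. f x \<partial>lborel) = c ^ DIM('a) *\<^sub>R (\<integral>x. f (t + c *\<^sub>R x) \<partial>lborel)"
    and "integrable lborel (\<lambda>x. f (t + c *\<^sub>R x)) \<longleftrightarrow> integrable lborel f"
proof -
  have *: "lborel = density (distr lborel borel (\<lambda>x::'a. t + c *\<^sub>R x)) (\<lambda>_. ennreal (c ^ DIM('a)))"
    using lborel_affine[of c t] c by simp
  show "(\<integral>x. f x \<partial>lborel) = c ^ DIM('a) *\<^sub>R (\<integral>x. f (t + c *\<^sub>R x) \<partial>lborel)"
    by (subst *) (use c in \<open>simp add: integral_density integral_distr\<close>)
  show "integrable lborel (\<lambda>x. f (t + c *\<^sub>R x)) \<longleftrightarrow> integrable lborel f"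
  proof -
    have "integrable lborel f \<longleftrightarrow> integrable lborel (\<lambda>x. c ^ DIM('a) *\<^sub>R f (t + c *\<^sub>R x))"
      by (subst *) (use c in \<open>simp add: integrable_density integrable_distr_eq\<close>)
    also have "\<dots> \<longleftrightarrow> integrable lborel (\<lambda>x. f (t + c *\<^sub>R x))"
      using c integrable_scaleR_right[of "inverse (c ^ DIM('a))" lborel "\<lambda>x. c ^ DIM('a) *\<^sub>R f (t + c *\<^sub>R x)"] by auto
    finally show ?thesis by blast
  qed
qed

lemma lborel_nn_integral_affine:
  fixes f :: "'a::euclidean_space \<Rightarrow> ennreal"
  assumes [measurable]: "f \<in> borel_measurable borel" and c: "c > 0"
  shows "(\<integral>\<^sup>+x. f x \<partial>lborel) = ennreal (c ^ DIM('a)) * (\<integral>\<^sup>+x. f (t + c *\<^sub>R x) \<partial>lborel)"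
proof -
  have *: "lborel = density (distr lborel borel (\<lambda>x::'a. t + c *\<^sub>R x)) (\<lambda>_. ennreal (c ^ DIM('a)))"
    using lborel_affine[of c t] c by simp
  show ?thesis
    by (subst *) (use c in \<open>simp add: nn_integral_density nn_integral_distr nn_integral_cmult\<close>)
qed

section \<open>Gaussian means and the L2 bound for integrable functions\<close>

definition kern :: "real \<Rightarrow> 'a::euclidean_space \<Rightarrow> real" where
  "kern s x = (sqrt (2 * pi) / s) ^ DIM('a) * gauss (x /\<^sub>R s)"

lemma kern_measurable [measurable]: "kern s \<in> borel_measurable borel"
  unfolding kern_def by measurable

lemma kern_nonneg [simp]: "s > 0 \<Longrightarrow> 0 \<le> kern s x"
  by (simp add: kern_def)

lemma kern_minus [simp]: "kern s (- x) = kern s x"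
  by (simp add: kern_def)

lemma gauss_scale_integrable: "s > 0 \<Longrightarrow> integrable lborel (\<lambda>x::'a::euclidean_space. gauss (s *\<^sub>R x))"
  using lborel_integral_affine(2)[of gauss s 0] by simp

text \<open>This identifies \<open>kern s\<close> as the transform of a dilated Gaussian. It
  concentrates at the origin as \<open>s\<close> tends to 0 while its mass stays
  \<open>(2 * pi) ^ DIM('a)\<close>, which is the origin of the constant in Plancherel's
  theorem.\<close>

lemma fourier_gauss_scaled:
  fixes z :: "'a::euclidean_space"
  assumes s: "s > 0"
  shows "fourier (\<lambda>x. of_real (gauss (s *\<^sub>R x))) z = of_real (kern s z)"
proof -
  have "fourier (\<lambda>x. of_real (gauss (s *\<^sub>R x))) z
    = (1 / s) ^ DIM('a) *\<^sub>R (\<integral>x. exp (- \<i> * of_real ((0 + (1/s) *\<^sub>R x) \<bullet> z)) * of_real (gauss (s *\<^sub>R (0 + (1/s) *\<^sub>R x))) \<partial>lborel)"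
    unfolding fourier_def using s by (intro lborel_integral_affine(1)) auto
  also have "\<dots> = (1 / s) ^ DIM('a) *\<^sub>R (\<integral>x. exp (- \<i> * of_real (x \<bullet> (z /\<^sub>R s))) * of_real (gauss x) \<partial>lborel)"
    using s by (simp add: divide_inverse)
  also have "\<dots> = (1 / s) ^ DIM('a) *\<^sub>R of_real (sqrt (2 * pi) ^ DIM('a) * gauss (z /\<^sub>R s))"
    using fourier_gauss[of "z /\<^sub>R s"] by (simp add: has_bochner_integral_iff)
  finally show ?thesis
    by (simp add: kern_def scaleR_conv_of_real power_divide power_mult_distrib)
qed

lemma sqrt_2pi_power: "sqrt (2 * pi) ^ n * sqrt (2 * pi) ^ n = (2 * pi) ^ n"
  unfolding power_mult_distrib[symmetric] by simp

lemma nn_integral_kern: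
  assumes "s > 0"
  shows "(\<integral>\<^sup>+y. ennreal (kern s (y - x)) \<partial>(lborel :: 'a::euclidean_space measure)) = ennreal ((2 * pi) ^ DIM('a))"
proof -
  have "(\<integral>\<^sup>+y. ennreal (kern s (y - x)) \<partial>(lborel :: 'a measure))
    = ennreal (s ^ DIM('a)) * (\<integral>\<^sup>+y. ennreal (kern s (x + s *\<^sub>R y - x)) \<partial>lborel)"
    using assms by (intro lborel_nn_integral_affine) auto
  also have "\<dots> = (\<integral>\<^sup>+y. ennreal (sqrt (2 * pi) ^ DIM('a)) * ennreal (gauss (y::'a)) \<partial>lborel)"
    using assms by (subst nn_integral_cmult[symmetric])
      (auto intro!: nn_integral_cong simp: kern_def power_divide simp flip: ennreal_mult)
  also have "\<dots> = ennreal (sqrt (2 * pi) ^ DIM('a)) * ennreal (sqrt (2 * pi) ^ DIM('a))"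
    by (subst nn_integral_cmult) (auto simp: nn_integral_eq_integral gauss_integral)
  also have "\<dots> = ennreal ((2 * pi) ^ DIM('a))"
    by (subst ennreal_mult[symmetric]) (simp_all only: sqrt_2pi_power, auto)
  finally show ?thesis .
qed

lemma fourier_measurable [measurable]:
  assumes [measurable]: "f \<in> borel_measurable borel"
  shows "fourier f \<in> borel_measurable borel"
  unfolding fourier_def by measurable

lemma norm_exp_minus_i [simp]: "cmod (exp (- (\<i> * complex_of_real x))) = 1"
  using norm_exp_i_times[of "- x"] by simp

lemma fourier_bound: "cmod (fourier f \<xi>) \<le> (\<integral>x. cmod (f x) \<partial>lborel)"
proof -
  have "cmod (fourier f \<xi>) \<le> (\<integral>x. cmod (exp (- \<i> * of_real (x \<bullet> \<xi>)) * f x) \<partial>lborel)"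
    unfolding fourier_def by (rule integral_norm_bound)
  then show ?thesis by (simp add: norm_mult)
qed

text \<open>Fubini for \<open>f x * g \<xi>\<close> times a phase of modulus one. Symmetry of the
  inner product makes the integral over \<xi> a transform again.\<close>

lemma fourier_multiplication:
  fixes f g :: "'a::euclidean_space \<Rightarrow> complex"
  assumes f: "integrable lborel f" and g: "integrable lborel g"
  shows "(\<integral>\<xi>. fourier f \<xi> * g \<xi> \<partial>lborel) = (\<integral>x. f x * fourier g x \<partial>lborel)"
proof -
  have [measurable]: "f \<in> borel_measurable borel" "g \<in> borel_measurable borel"
    using f g by auto
  let ?F = "\<lambda>x \<xi>. exp (- \<i> * of_real (x \<bullet> \<xi>)) * f x * g \<xi>"
  have "integrable (lborel \<Otimes>\<^sub>M lborel) (case_prod ?F)"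
  proof (rule lborel_pair.Fubini_integrable)
    show "integrable lborel (\<lambda>x. \<integral>y. norm (case (x, y) of (x, y) \<Rightarrow> ?F x y) \<partial>lborel)"
      using f by (simp add: norm_mult)
    show "AE x in lborel. integrable lborel (\<lambda>y. case (x, y) of (x, y) \<Rightarrow> ?F x y)"
    proof (intro AE_I2)
      fix x
      show "integrable lborel (\<lambda>y. case (x, y) of (x, y) \<Rightarrow> ?F x y)"
        by (rule Bochner_Integration.integrable_bound[OF integrable_mult_right[OF g, of "f x"]]) (auto simp: norm_mult)
    qed
  qed measurable
  then have eq: "(\<integral>\<xi>. (\<integral>x. ?F x \<xi> \<partial>lborel) \<partial>lborel) = (\<integral>x. (\<integral>\<xi>. ?F x \<xi> \<partial>lborel) \<partial>lborel)"
    by (rule lborel_pair.Fubini_integral)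
  have 1: "(\<integral>x. ?F x \<xi> \<partial>lborel) = fourier f \<xi> * g \<xi>" for \<xi>
    unfolding fourier_def by simp
  have 2: "(\<integral>\<xi>. ?F x \<xi> \<partial>lborel) = f x * fourier g x" for x
  proof -
    have "(\<integral>\<xi>. ?F x \<xi> \<partial>lborel) = (\<integral>\<xi>. f x * (exp (- \<i> * of_real (\<xi> \<bullet> x)) * g \<xi>) \<partial>lborel)"
      by (intro Bochner_Integration.integral_cong) (auto simp: inner_commute)
    then show ?thesis unfolding fourier_def by simp
  qed
  show ?thesis using eq unfolding 1 2 .
qed

text \<open>The squared modulus is \<open>fourier f\<close> times its conjugate. At this stage the
  transform is only known to be bounded, so it is the Gaussian weight that makes the conjugate
  factor integrable and allows the multiplication formula to move the transform off
  \<open>f\<close>.\<close>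

lemma fourier_gauss_mean:
  fixes f :: "'a::euclidean_space \<Rightarrow> complex"
  assumes f: "integrable lborel f" and s: "s > 0"
  shows "of_real (\<integral>\<xi>. (cmod (fourier f \<xi>))\<^sup>2 * gauss (s *\<^sub>R \<xi>) \<partial>lborel)
     = (\<integral>x. f x * cnj (\<integral>y. f y * of_real (kern s (y - x)) \<partial>lborel) \<partial>lborel)"
proof -
  have [measurable]: "f \<in> borel_measurable borel" using f by auto
  have cnjm [measurable]: "(\<lambda>x. cnj (u x)) \<in> borel_measurable borel" if "u \<in> borel_measurable borel" for u :: "'a \<Rightarrow> complex"
    by (rule measurable_compose[OF that borel_measurable_continuous_onI]) (intro continuous_intros)
  let ?h = "\<lambda>\<xi>. cnj (fourier f \<xi>) * of_real (gauss (s *\<^sub>R \<xi>))"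
  have h: "integrable lborel ?h"
  proof (rule Bochner_Integration.integrable_bound)
    show "integrable lborel (\<lambda>\<xi>::'a. (\<integral>x. cmod (f x) \<partial>lborel) * gauss (s *\<^sub>R \<xi>))"
      by (simp add: gauss_scale_integrable s)
    show "AE \<xi> in lborel. norm (?h \<xi>) \<le> norm ((\<integral>x. cmod (f x) \<partial>lborel) * gauss (s *\<^sub>R \<xi>))"
      by (intro AE_I2) (use fourier_bound[of f] in \<open>auto simp: norm_mult abs_mult intro!: mult_right_mono order_trans[OF _ abs_ge_self]\<close>)
  qed measurable
  \<comment> \<open>After conjugation this is the multiplication formula once more, for
    \<open>f\<close> and a modulated Gaussian; modulation by \<open>x\<close> shifts the argument of
    the kernel to \<open>y - x\<close>.\<close>
  have fh: "fourier ?h x = cnj (\<integral>y. f y * of_real (kern s (y - x)) \<partial>lborel)" for x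
  proof -
    let ?g = "\<lambda>\<xi>. exp (\<i> * of_real (x \<bullet> \<xi>)) * complex_of_real (gauss (s *\<^sub>R \<xi>))"
    have g: "integrable lborel ?g"
      by (rule Bochner_Integration.integrable_bound[OF gauss_scale_integrable[OF s]]) (auto simp: norm_mult)
    have "fourier ?g y = fourier (\<lambda>\<xi>. of_real (gauss (s *\<^sub>R \<xi>))) (y - x)" for y
      unfolding fourier_def
      by (intro Bochner_Integration.integral_cong) (auto simp: inner_diff_right exp_diff exp_minus inner_commute field_simps)
    then have gy: "fourier ?g y = of_real (kern s (y - x))" for y
      by (simp add: fourier_gauss_scaled[OF s])
    have "fourier ?h x = (\<integral>\<xi>. cnj (fourier f \<xi> * ?g \<xi>) \<partial>lborel)"
      unfolding fourier_def[of ?h] by (intro Bochner_Integration.integral_cong) (auto simp: exp_cnj inner_commute mult_ac)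
    also have "\<dots> = cnj (\<integral>\<xi>. fourier f \<xi> * ?g \<xi> \<partial>lborel)"
      by (rule Bochner_Integration.integral_cnj)
    also have "(\<integral>\<xi>. fourier f \<xi> * ?g \<xi> \<partial>lborel) = (\<integral>y. f y * of_real (kern s (y - x)) \<partial>lborel)"
      by (simp add: fourier_multiplication[OF f g] gy)
    finally show ?thesis .
  qed
  have "complex_of_real (\<integral>\<xi>. (cmod (fourier f \<xi>))\<^sup>2 * gauss (s *\<^sub>R \<xi>) \<partial>lborel) = (\<integral>\<xi>. of_real ((cmod (fourier f \<xi>))\<^sup>2 * gauss (s *\<^sub>R \<xi>)) \<partial>lborel)"
    by (rule integral_complex_of_real[symmetric])
  also have "\<dots> = (\<integral>\<xi>. fourier f \<xi> * ?h \<xi> \<partial>lborel)"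
    by (intro Bochner_Integration.integral_cong) (auto simp: complex_norm_square simp del: of_real_power)
  also have "\<dots> = (\<integral>x. f x * fourier ?h x \<partial>lborel)"
    by (rule fourier_multiplication[OF f h])
  finally show ?thesis by (simp add: fh)
qed

text \<open>Schur test: \<open>|f x| |f y| \<le> (|f x|\<^sup>2 + |f y|\<^sup>2) / 2\<close> under the positive symmetric kernel \<open>kern s (y - x)\<close>.\<close>

lemma nn_integral_fourier_le:
  fixes f :: "'a::euclidean_space \<Rightarrow> complex"
  assumes f: "integrable lborel f"
  shows "(\<integral>\<^sup>+\<xi>. ennreal ((cmod (fourier f \<xi>))\<^sup>2) \<partial>lborel) \<le> ennreal ((2 * pi) ^ DIM('a)) * (\<integral>\<^sup>+x. ennreal ((cmod (f x))\<^sup>2) \<partial>lborel)"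
    (is "_ \<le> ?R")
proof -
  have [measurable]: "f \<in> borel_measurable borel" using f by auto
  have nle: "ennreal (norm (integral\<^sup>L lborel h)) \<le> (\<integral>\<^sup>+x. ennreal (norm (h x)) \<partial>lborel)" for h :: "'a \<Rightarrow> complex"
    by (cases "integrable lborel h") (auto simp: integral_norm_bound_ennreal not_integrable_integral_eq)
  have bound: "(\<integral>\<^sup>+\<xi>. ennreal ((cmod (fourier f \<xi>))\<^sup>2 * gauss (s *\<^sub>R \<xi>)) \<partial>lborel) \<le> ?R" if s: "s > 0" for s
  proof -
    have int: "integrable lborel (\<lambda>\<xi>. (cmod (fourier f \<xi>))\<^sup>2 * gauss (s *\<^sub>R \<xi>))"
    proof (rule Bochner_Integration.integrable_bound)
      show "integrable lborel (\<lambda>\<xi>::'a. (\<integral>x. cmod (f x) \<partial>lborel)\<^sup>2 * gauss (s *\<^sub>R \<xi>))"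
        by (simp add: gauss_scale_integrable s)
      show "AE \<xi> in lborel. norm ((cmod (fourier f \<xi>))\<^sup>2 * gauss (s *\<^sub>R \<xi>)) \<le> norm ((\<integral>x. cmod (f x) \<partial>lborel)\<^sup>2 * gauss (s *\<^sub>R \<xi>))"
        by (intro AE_I2) (use fourier_bound[of f] in \<open>auto simp: abs_mult intro!: mult_right_mono power_mono\<close>)
    qed measurable
    have "(\<integral>\<^sup>+\<xi>. ennreal ((cmod (fourier f \<xi>))\<^sup>2 * gauss (s *\<^sub>R \<xi>)) \<partial>lborel)
        = ennreal (\<integral>\<xi>. (cmod (fourier f \<xi>))\<^sup>2 * gauss (s *\<^sub>R \<xi>) \<partial>lborel)"
      by (rule nn_integral_eq_integral[OF int]) auto
    also have "\<dots> \<le> ennreal (norm (of_real (\<integral>\<xi>. (cmod (fourier f \<xi>))\<^sup>2 * gauss (s *\<^sub>R \<xi>) \<partial>lborel) :: complex))"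
      by (intro ennreal_leI) simp
    also have "\<dots> \<le> (\<integral>\<^sup>+x. ennreal (norm (f x * cnj (\<integral>y. f y * of_real (kern s (y - x)) \<partial>lborel))) \<partial>lborel)"
      unfolding fourier_gauss_mean[OF f s] by (rule nle)
    also have "\<dots> \<le> (\<integral>\<^sup>+x. (\<integral>\<^sup>+y. ennreal (cmod (f x) * cmod (f y) * kern s (y - x)) \<partial>lborel) \<partial>lborel)"
    proof (rule nn_integral_mono)
      fix x
      have "ennreal (norm (f x * cnj (\<integral>y. f y * of_real (kern s (y - x)) \<partial>lborel)))
          = ennreal (cmod (f x)) * ennreal (norm (\<integral>y. f y * of_real (kern s (y - x)) \<partial>lborel))"
        by (simp add: norm_mult ennreal_mult)
      also have "\<dots> \<le> ennreal (cmod (f x)) * (\<integral>\<^sup>+y. ennreal (norm (f y * of_real (kern s (y - x)))) \<partial>lborel)"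
        by (intro mult_left_mono nle) auto
      also have "\<dots> = (\<integral>\<^sup>+y. ennreal (cmod (f x) * cmod (f y) * kern s (y - x)) \<partial>lborel)"
        using s by (subst nn_integral_cmult[symmetric]) (auto simp: norm_mult ennreal_mult mult.assoc)
      finally show "ennreal (norm (f x * cnj (\<integral>y. f y * of_real (kern s (y - x)) \<partial>lborel)))
          \<le> (\<integral>\<^sup>+y. ennreal (cmod (f x) * cmod (f y) * kern s (y - x)) \<partial>lborel)" .
    qed
    also have "\<dots> \<le> (\<integral>\<^sup>+x. (\<integral>\<^sup>+y. ennreal ((cmod (f x))\<^sup>2 / 2 * kern s (y - x)) + ennreal ((cmod (f y))\<^sup>2 / 2 * kern s (y - x)) \<partial>lborel) \<partial>lborel)"
    proof (intro nn_integral_mono)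
      fix x y
      have "cmod (f x) * cmod (f y) \<le> (cmod (f x))\<^sup>2 / 2 + (cmod (f y))\<^sup>2 / 2"
        using sum_squares_bound[of "cmod (f x)" "cmod (f y)"] by simp
      then have "cmod (f x) * cmod (f y) * kern s (y - x) \<le> ((cmod (f x))\<^sup>2 / 2 + (cmod (f y))\<^sup>2 / 2) * kern s (y - x)"
        using s by (intro mult_right_mono) auto
      then show "ennreal (cmod (f x) * cmod (f y) * kern s (y - x)) \<le> ennreal ((cmod (f x))\<^sup>2 / 2 * kern s (y - x)) + ennreal ((cmod (f y))\<^sup>2 / 2 * kern s (y - x))"
        using s by (simp add: distrib_right ennreal_leI flip: ennreal_plus)
    qed
    also have "\<dots> = (\<integral>\<^sup>+x. (\<integral>\<^sup>+y. ennreal ((cmod (f x))\<^sup>2 / 2 * kern s (y - x)) \<partial>lborel) \<partial>lborel)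
        + (\<integral>\<^sup>+x. (\<integral>\<^sup>+y. ennreal ((cmod (f y))\<^sup>2 / 2 * kern s (y - x)) \<partial>lborel) \<partial>lborel)"
      by (subst nn_integral_add[symmetric]) (auto intro!: nn_integral_cong nn_integral_add)
    also have "(\<integral>\<^sup>+x. (\<integral>\<^sup>+y. ennreal ((cmod (f y))\<^sup>2 / 2 * kern s (y - x)) \<partial>lborel) \<partial>lborel)
        = (\<integral>\<^sup>+y. (\<integral>\<^sup>+x. ennreal ((cmod (f y))\<^sup>2 / 2 * kern s (y - x)) \<partial>lborel) \<partial>lborel)"
      by (rule lborel_pair.Fubini') measurable
    also have "\<dots> = (\<integral>\<^sup>+x. (\<integral>\<^sup>+y. ennreal ((cmod (f x))\<^sup>2 / 2 * kern s (y - x)) \<partial>lborel) \<partial>lborel)"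
      by (subst kern_minus[symmetric]) simp
    also have "(\<integral>\<^sup>+x. (\<integral>\<^sup>+y. ennreal ((cmod (f x))\<^sup>2 / 2 * kern s (y - x)) \<partial>lborel) \<partial>lborel)
        = (\<integral>\<^sup>+x. ennreal ((2 * pi) ^ DIM('a) / 2) * ennreal ((cmod (f x))\<^sup>2) \<partial>lborel)"
    proof (rule nn_integral_cong)
      fix x
      have "(\<integral>\<^sup>+y. ennreal ((cmod (f x))\<^sup>2 / 2 * kern s (y - x)) \<partial>lborel) = (\<integral>\<^sup>+y. ennreal ((cmod (f x))\<^sup>2 / 2) * ennreal (kern s (y - x)) \<partial>lborel)"
        using s by (intro nn_integral_cong) (simp add: ennreal_mult[symmetric])
      also have "\<dots> = ennreal ((cmod (f x))\<^sup>2 / 2) * ennreal ((2 * pi) ^ DIM('a))"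
        by (subst nn_integral_cmult) (auto simp: nn_integral_kern[OF s])
      also have "\<dots> = ennreal ((2 * pi) ^ DIM('a) / 2) * ennreal ((cmod (f x))\<^sup>2)"
        by (simp flip: ennreal_mult)
      finally show "(\<integral>\<^sup>+y. ennreal ((cmod (f x))\<^sup>2 / 2 * kern s (y - x)) \<partial>lborel) = ennreal ((2 * pi) ^ DIM('a) / 2) * ennreal ((cmod (f x))\<^sup>2)" .
    qed
    also have "\<dots> = ennreal ((2 * pi) ^ DIM('a) / 2) * (\<integral>\<^sup>+x. ennreal ((cmod (f x))\<^sup>2) \<partial>lborel)"
      by (rule nn_integral_cmult) auto
    also have "\<dots> + \<dots> = ?R"
      unfolding distrib_right[symmetric] by (subst ennreal_plus[symmetric]) (simp_all only: field_sum_of_halves, auto)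
    finally show ?thesis .
  qed
  \<comment> \<open>Fatou's lemma removes the Gaussian weight. Dominated convergence is out of
    reach, because finiteness of the unweighted integral is exactly what is being proved.\<close>
  have "(\<integral>\<^sup>+\<xi>. ennreal ((cmod (fourier f \<xi>))\<^sup>2) \<partial>lborel)
      = (\<integral>\<^sup>+\<xi>. liminf (\<lambda>k. ennreal ((cmod (fourier f \<xi>))\<^sup>2 * gauss ((1 / real (Suc k)) *\<^sub>R \<xi>))) \<partial>lborel)"
  proof (rule nn_integral_cong)
    fix \<xi> :: 'a
    have "(\<lambda>k. (cmod (fourier f \<xi>))\<^sup>2 * gauss ((1 / real (Suc k)) *\<^sub>R \<xi>)) \<longlonglongrightarrow> (cmod (fourier f \<xi>))\<^sup>2 * exp (- (norm (0 *\<^sub>R \<xi>))\<^sup>2 / 2)"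
      unfolding gauss_def by (intro tendsto_intros LIMSEQ_Suc[OF lim_1_over_n]) auto
    then have "(\<lambda>k. ennreal ((cmod (fourier f \<xi>))\<^sup>2 * gauss ((1 / real (Suc k)) *\<^sub>R \<xi>))) \<longlonglongrightarrow> ennreal ((cmod (fourier f \<xi>))\<^sup>2)"
      by (intro tendsto_ennrealI) simp
    then show "ennreal ((cmod (fourier f \<xi>))\<^sup>2) = liminf (\<lambda>k. ennreal ((cmod (fourier f \<xi>))\<^sup>2 * gauss ((1 / real (Suc k)) *\<^sub>R \<xi>)))"
      by (metis lim_imp_Liminf sequentially_bot)
  qed
  also have "\<dots> \<le> liminf (\<lambda>k. \<integral>\<^sup>+\<xi>. ennreal ((cmod (fourier f \<xi>))\<^sup>2 * gauss ((1 / real (Suc k)) *\<^sub>R \<xi>)) \<partial>lborel)"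
    by (rule nn_integral_liminf) auto
  also have "\<dots> \<le> liminf (\<lambda>k::nat. ?R)"
    by (rule Liminf_mono, intro always_eventually allI bound) simp
  finally show ?thesis by (simp add: Liminf_const)
qed

text \<open>Both sides of the Gaussian mean identity have a limit as the width parameter tends to 0.
  On the frequency side the squared transform dominates, integrable by the preceding bound. On the
  other side the means converge pointwise by continuity of \<open>f\<close> and are bounded
  uniformly because \<open>f\<close> is, so a multiple of \<open>cmod (f x)\<close>
  dominates.\<close>

lemma Plancherel_bounded_support:
  fixes f :: "'a::euclidean_space \<Rightarrow> complex"
  assumes cont: "continuous_on UNIV f" and bnd: "\<And>x. cmod (f x) \<le> B" and f: "integrable lborel f"
    and f2: "integrable lborel (\<lambda>x. (cmod (f x))\<^sup>2)"
  shows "(\<integral>\<xi>. (cmod (fourier f \<xi>))\<^sup>2 \<partial>lborel) = (2 * pi) ^ DIM('a) * (\<integral>x. (cmod (f x))\<^sup>2 \<partial>lborel)"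
proof -
  have [measurable]: "f \<in> borel_measurable borel" using f by auto
  have cnjm [measurable]: "(\<lambda>x. cnj (u x)) \<in> borel_measurable borel" if "u \<in> borel_measurable borel" for u :: "'a \<Rightarrow> complex"
    by (rule measurable_compose[OF that borel_measurable_continuous_onI]) (intro continuous_intros)
  define s where "s k = 1 / real (Suc k)" for k
  have s: "s k > 0" for k by (simp add: s_def)
  have slim: "s \<longlonglongrightarrow> 0" unfolding s_def by (rule LIMSEQ_Suc[OF lim_1_over_n])
  have B: "0 \<le> B" using order_trans[OF norm_ge_zero bnd] .
  let ?c = "sqrt (2 * pi) ^ DIM('a)"
  have fin: "(\<integral>\<^sup>+\<xi>. ennreal ((cmod (fourier f \<xi>))\<^sup>2) \<partial>lborel) < \<infinity>"
    using nn_integral_fourier_le[OF f] nn_integral_eq_integral[OF f2]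
    by (auto simp: ennreal_mult_less_top intro!: le_less_trans[OF nn_integral_fourier_le[OF f]])
  have int: "integrable lborel (\<lambda>\<xi>. (cmod (fourier f \<xi>))\<^sup>2)"
    by (rule integrableI_bounded) (use fin in auto)
  have "(\<lambda>k. \<integral>\<xi>. (cmod (fourier f \<xi>))\<^sup>2 * gauss (s k *\<^sub>R \<xi>) \<partial>lborel) \<longlonglongrightarrow> (\<integral>\<xi>. (cmod (fourier f \<xi>))\<^sup>2 \<partial>lborel)"
  proof (rule integral_dominated_convergence[OF _ _ int])
    show "AE \<xi> in lborel. (\<lambda>k. (cmod (fourier f \<xi>))\<^sup>2 * gauss (s k *\<^sub>R \<xi>)) \<longlonglongrightarrow> (cmod (fourier f \<xi>))\<^sup>2"
    proof (intro AE_I2)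
      fix \<xi> :: 'a
      have "(\<lambda>k. (cmod (fourier f \<xi>))\<^sup>2 * gauss (s k *\<^sub>R \<xi>)) \<longlonglongrightarrow> (cmod (fourier f \<xi>))\<^sup>2 * exp (- (norm (0 *\<^sub>R \<xi>))\<^sup>2 / 2)"
        unfolding gauss_def by (intro tendsto_intros slim) auto
      then show "(\<lambda>k. (cmod (fourier f \<xi>))\<^sup>2 * gauss (s k *\<^sub>R \<xi>)) \<longlonglongrightarrow> (cmod (fourier f \<xi>))\<^sup>2" by simp
    qed
    show "AE \<xi> in lborel. norm ((cmod (fourier f \<xi>))\<^sup>2 * gauss (s k *\<^sub>R \<xi>)) \<le> (cmod (fourier f \<xi>))\<^sup>2" for k
      by (intro AE_I2) (simp add: abs_mult mult_left_le)
  qed auto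
  then have lim1: "(\<lambda>k. complex_of_real (\<integral>\<xi>. (cmod (fourier f \<xi>))\<^sup>2 * gauss (s k *\<^sub>R \<xi>) \<partial>lborel)) \<longlonglongrightarrow> of_real (\<integral>\<xi>. (cmod (fourier f \<xi>))\<^sup>2 \<partial>lborel)"
    by (rule tendsto_of_real)
  define m where "m k x = (\<integral>y. f y * of_real (kern (s k) (y - x)) \<partial>lborel)" for k x
  have mm [measurable]: "m k \<in> borel_measurable borel" for k unfolding m_def by measurable
  \<comment> \<open>The substitution \<open>y = x + s k * w\<close> moves the dependence on
    \<open>k\<close> from the kernel into the argument of \<open>f\<close>, so one Gaussian serves
    as dominating function for all \<open>k\<close>.\<close>
  have m_eq: "m k x = (\<integral>w. f (x + s k *\<^sub>R w) * of_real (?c * gauss w) \<partial>lborel)" for k x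
  proof -
    have "m k x = (s k) ^ DIM('a) *\<^sub>R (\<integral>w. f (x + s k *\<^sub>R w) * of_real (kern (s k) (x + s k *\<^sub>R w - x)) \<partial>lborel)"
      unfolding m_def by (rule lborel_integral_affine(1)[OF _ s]) measurable
    also have "\<dots> = (\<integral>w. (s k) ^ DIM('a) *\<^sub>R (f (x + s k *\<^sub>R w) * of_real (kern (s k) (x + s k *\<^sub>R w - x))) \<partial>lborel)"
      by (rule integral_scaleR_right[symmetric])
    also have "\<dots> = (\<integral>w. f (x + s k *\<^sub>R w) * of_real (?c * gauss w) \<partial>lborel)"
      using s[of k] by (intro Bochner_Integration.integral_cong) (auto simp: kern_def scaleR_conv_of_real power_divide)
    finally show ?thesis .
  qed
  have gi: "integrable lborel (\<lambda>w::'a. B * (?c * gauss w))" by simp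
  \<comment> \<open>One factor is the normalisation inside \<open>kern\<close>, the other the mass
    of \<open>gauss\<close>.\<close>
  have cc: "?c * ?c = (2 * pi) ^ DIM('a)" by (rule sqrt_2pi_power)
  have lim_m: "(\<lambda>k. m k x) \<longlonglongrightarrow> f x * of_real ((2 * pi) ^ DIM('a))" for x
  proof -
    have "(\<lambda>k. \<integral>w. f (x + s k *\<^sub>R w) * of_real (?c * gauss w) \<partial>lborel) \<longlonglongrightarrow> (\<integral>w. f x * of_real (?c * gauss w) \<partial>(lborel :: 'a measure))"
    proof (rule integral_dominated_convergence[OF _ _ gi])
      show "AE w in lborel. (\<lambda>k. f (x + s k *\<^sub>R w) * complex_of_real (?c * gauss w)) \<longlonglongrightarrow> f x * of_real (?c * gauss w)"
      proof (intro AE_I2 tendsto_mult tendsto_const)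
        fix w :: 'a
        have "(\<lambda>k. x + s k *\<^sub>R w) \<longlonglongrightarrow> x + 0 *\<^sub>R w" by (intro tendsto_intros slim)
        then have "(\<lambda>k. x + s k *\<^sub>R w) \<longlonglongrightarrow> x" by simp
        then show "(\<lambda>k. f (x + s k *\<^sub>R w)) \<longlonglongrightarrow> f x"
          using cont by (intro continuous_on_tendsto_compose[OF cont]) auto
      qed
      show "AE w in lborel. norm (f (x + s k *\<^sub>R w) * complex_of_real (?c * gauss w)) \<le> B * (?c * gauss w)" for k
        by (intro AE_I2) (auto simp: norm_mult abs_mult simp del: of_real_mult of_real_power intro!: mult_right_mono bnd)
    qed auto
    also have "(\<integral>w. f x * of_real (?c * gauss w) \<partial>(lborel :: 'a measure)) = f x * of_real (\<integral>w. ?c * gauss (w::'a) \<partial>lborel)"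
      by (simp only: integral_mult_right_zero integral_complex_of_real)
    also have "(\<integral>w. ?c * gauss (w::'a) \<partial>lborel) = (2 * pi) ^ DIM('a)"
      by (simp add: gauss_integral cc)
    finally show ?thesis by (simp add: m_eq)
  qed
  have m_bnd: "cmod (m k x) \<le> B * (2 * pi) ^ DIM('a)" for k x
  proof -
    have "cmod (m k x) \<le> (\<integral>w. cmod (f (x + s k *\<^sub>R w) * of_real (?c * gauss w)) \<partial>lborel)"
      unfolding m_eq by (rule integral_norm_bound)
    also have "\<dots> \<le> (\<integral>w. B * (?c * gauss (w::'a)) \<partial>lborel)"
      by (rule integral_mono_AE'[OF gi]) (auto simp: norm_mult abs_mult B simp del: of_real_mult of_real_power intro!: mult_right_mono bnd)
    also have "\<dots> = B * (2 * pi) ^ DIM('a)" by (simp add: gauss_integral cc)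
    finally show ?thesis .
  qed
  have "(\<lambda>k. \<integral>x. f x * cnj (m k x) \<partial>lborel) \<longlonglongrightarrow> (\<integral>x. f x * cnj (f x * of_real ((2 * pi) ^ DIM('a))) \<partial>lborel)"
  proof (rule integral_dominated_convergence)
    show "integrable lborel (\<lambda>x. cmod (f x) * (B * (2 * pi) ^ DIM('a)))" using f by simp
    show "AE x in lborel. (\<lambda>k. f x * cnj (m k x)) \<longlonglongrightarrow> f x * cnj (f x * of_real ((2 * pi) ^ DIM('a)))"
      by (intro AE_I2 tendsto_mult tendsto_const tendsto_cnj lim_m)
    show "AE x in lborel. norm (f x * cnj (m k x)) \<le> cmod (f x) * (B * (2 * pi) ^ DIM('a))" for k
      unfolding norm_mult complex_mod_cnj by (intro AE_I2 mult_left_mono m_bnd norm_ge_zero)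
  qed measurable
  also have "(\<integral>x. f x * cnj (f x * of_real ((2 * pi) ^ DIM('a))) \<partial>lborel) = (\<integral>x. complex_of_real ((2 * pi) ^ DIM('a) * (cmod (f x))\<^sup>2) \<partial>lborel)"
    by (intro Bochner_Integration.integral_cong) (auto simp: complex_norm_square simp del: of_real_power)
  also have "\<dots> = of_real ((2 * pi) ^ DIM('a) * (\<integral>x. (cmod (f x))\<^sup>2 \<partial>lborel))"
    by (simp only: integral_complex_of_real integral_mult_right_zero)
  finally have lim2: "(\<lambda>k. complex_of_real (\<integral>\<xi>. (cmod (fourier f \<xi>))\<^sup>2 * gauss (s k *\<^sub>R \<xi>) \<partial>lborel)) \<longlonglongrightarrow> of_real ((2 * pi) ^ DIM('a) * (\<integral>x. (cmod (f x))\<^sup>2 \<partial>lborel))"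
    by (simp add: fourier_gauss_mean[OF f s] m_def)
  show ?thesis using LIMSEQ_unique[OF lim1 lim2] by (simp only: of_real_eq_iff)
qed

section \<open>Plancherel's theorem\<close>

lemma lebesgue_measurableI: "f \<in> borel_measurable borel \<Longrightarrow> f \<in> borel_measurable lebesgue"
  by (intro measurable_completion) simp

text \<open>The bridge between \<open>lebesgue\<close> and \<open>lborel\<close>: a function
  measurable for the completion is replaced by a Borel one, to which the Fubini-based results apply.
  Real and imaginary parts are treated separately.\<close>

lemma borel_representative:
  fixes f :: "real^'n \<Rightarrow> complex"
  assumes f: "f \<in> borel_measurable lebesgue"
  obtains f' where "f' \<in> borel_measurable borel" "AE x in lebesgue. f x = f' x"
proof -
  have "(\<lambda>x. Re (f x)) \<in> borel_measurable (completion lborel)" "(\<lambda>x. Im (f x)) \<in> borel_measurable (completion lborel)"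
    using f by auto
  then obtain a b where ab: "a \<in> borel_measurable lborel" "AE x in lborel. Re (f x) = a x"
    "b \<in> borel_measurable lborel" "AE x in lborel. Im (f x) = b x"
    using completion_ex_borel_measurable_real[of "\<lambda>x. Re (f x)" lborel] completion_ex_borel_measurable_real[of "\<lambda>x. Im (f x)" lborel]
    by blast
  have "AE x in lborel. f x = Complex (a x) (b x)"
    using ab(2,4) by eventually_elim (simp add: complex_eq_iff)
  then have AE: "AE x in lebesgue. f x = Complex (a x) (b x)"
    by (rule AE_completion)
  have "(\<lambda>x. complex_of_real (a x) + \<i> * complex_of_real (b x)) \<in> borel_measurable borel"
    using ab by auto
  then have "(\<lambda>x. Complex (a x) (b x)) \<in> borel_measurable borel"
    by (simp add: complex_eq[symmetric] Complex_eq)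
  with AE show thesis by (intro that)
qed

lemma fourier_L1_eq_fourier:
  assumes [measurable]: "f \<in> borel_measurable borel"
  shows "fourier_L1 f = fourier f"
  unfolding fourier_L1_def fourier_def by (intro ext integral_completion) measurable

lemma exp_inner_measurable [measurable]: "(\<lambda>x. exp (- \<i> * complex_of_real (x \<bullet> \<xi>))) \<in> borel_measurable lebesgue"
  by (rule lebesgue_measurableI) measurable

lemma fourier_L1_cong_AE:
  fixes f g :: "real^'n \<Rightarrow> complex"
  assumes [measurable]: "f \<in> borel_measurable lebesgue" "g \<in> borel_measurable lebesgue"
    and "AE x in lebesgue. f x = g x"
  shows "fourier_L1 f = fourier_L1 g"
  unfolding fourier_L1_def using assms(3)
  by (intro ext integral_cong_AE borel_measurable_times[OF exp_inner_measurable] assms(1,2)) auto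

lemma fourier_L1_integrable:
  fixes f :: "real^'n \<Rightarrow> complex"
  assumes f: "integrable lebesgue f"
  shows "integrable lebesgue (\<lambda>x. exp (- \<i> * complex_of_real (x \<bullet> \<xi>)) * f x)"
proof (rule Bochner_Integration.integrable_bound[OF f])
  have [measurable]: "f \<in> borel_measurable lebesgue" using f by auto
  show "(\<lambda>x. exp (- \<i> * complex_of_real (x \<bullet> \<xi>)) * f x) \<in> borel_measurable lebesgue" by measurable
qed (auto simp: norm_mult)

lemma fourier_L1_lincomb:
  fixes f g :: "real^'n \<Rightarrow> complex"
  assumes f: "integrable lebesgue f" and g: "integrable lebesgue g"
  shows "fourier_L1 (\<lambda>x. a * f x + b * g x) \<xi> = a * fourier_L1 f \<xi> + b * fourier_L1 g \<xi>"
proof -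
  have "fourier_L1 (\<lambda>x. a * f x + b * g x) \<xi> = (\<integral>x. a * (exp (- \<i> * complex_of_real (x \<bullet> \<xi>)) * f x) + b * (exp (- \<i> * complex_of_real (x \<bullet> \<xi>)) * g x) \<partial>lebesgue)"
    unfolding fourier_L1_def by (simp add: algebra_simps)
  also have "\<dots> = a * fourier_L1 f \<xi> + b * fourier_L1 g \<xi>"
    unfolding fourier_L1_def
    by (subst Bochner_Integration.integral_add) (use fourier_L1_integrable[OF f] fourier_L1_integrable[OF g] in auto)
  finally show ?thesis .
qed

text \<open>At this generality an inequality suffices: it makes transforms of Cauchy sequences
  Cauchy and gives uniqueness of the extension. Equality is then obtained on all of L2 by
  density.\<close>

lemma fourier_L1_L2_bound:
  fixes f :: "real^'n \<Rightarrow> complex"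
  assumes f: "integrable lebesgue f" and f2: "f \<in> L2_space"
  shows "fourier_L1 f \<in> L2_space" "L2_norm (fourier_L1 f) \<le> sqrt ((2 * pi) ^ CARD('n)) * L2_norm f"
proof -
  have fm [measurable]: "f \<in> borel_measurable lebesgue" using f by auto
  obtain h where h [measurable]: "h \<in> borel_measurable borel" and fh: "AE x in lebesgue. f x = h x"
    using borel_representative[OF fm] by blast
  have hm [measurable]: "h \<in> borel_measurable lebesgue" by (rule lebesgue_measurableI[OF h])
  have eq: "fourier_L1 f = fourier h"
    using fourier_L1_cong_AE[OF fm hm fh] fourier_L1_eq_fourier[OF h] by simp
  have "integrable lebesgue h" using integrable_cong_AE_imp[OF f hm] fh by simp
  then have hi: "integrable lborel h" using integrable_completion[of h lborel] by simp
  have Fm [measurable]: "fourier h \<in> borel_measurable lebesgue" by (rule lebesgue_measurableI) measurable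
  have "(\<integral>\<^sup>+\<xi>. ennreal ((cmod (fourier h \<xi>))\<^sup>2) \<partial>lebesgue) = (\<integral>\<^sup>+\<xi>. ennreal ((cmod (fourier h \<xi>))\<^sup>2) \<partial>lborel)"
    by (rule nn_integral_completion)
  also have "\<dots> \<le> ennreal ((2 * pi) ^ CARD('n)) * (\<integral>\<^sup>+x. ennreal ((cmod (h x))\<^sup>2) \<partial>lborel)"
    using nn_integral_fourier_le[OF hi] by simp
  also have "(\<integral>\<^sup>+x. ennreal ((cmod (h x))\<^sup>2) \<partial>lborel) = (\<integral>\<^sup>+x. ennreal ((cmod (h x))\<^sup>2) \<partial>lebesgue)"
    by (rule nn_integral_completion[symmetric])
  also have "\<dots> = (\<integral>\<^sup>+x. ennreal ((cmod (f x))\<^sup>2) \<partial>lebesgue)"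
    by (rule nn_integral_cong_AE) (use fh in eventually_elim, simp)
  also have "\<dots> = ennreal ((L2_norm f)\<^sup>2)"
    unfolding L2_norm_sq by (rule nn_integral_eq_integral[OF L2_integrable[OF f2]]) auto
  finally have le: "(\<integral>\<^sup>+\<xi>. ennreal ((cmod (fourier h \<xi>))\<^sup>2) \<partial>lebesgue) \<le> ennreal ((2 * pi) ^ CARD('n) * (L2_norm f)\<^sup>2)"
    by (subst ennreal_mult) auto
  have "integrable lebesgue (\<lambda>\<xi>. (cmod (fourier h \<xi>))\<^sup>2)"
    by (rule integrableI_bounded) (use le in \<open>auto intro: le_less_trans\<close>)
  then show S: "fourier_L1 f \<in> L2_space" unfolding eq by (intro L2_spaceI Fm)
  have "ennreal ((L2_norm (fourier_L1 f))\<^sup>2) \<le> ennreal ((2 * pi) ^ CARD('n) * (L2_norm f)\<^sup>2)"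
    unfolding L2_norm_sq[of "fourier_L1 f"] using le nn_integral_eq_integral[OF L2_integrable[OF S]] eq by simp
  then have "(L2_norm (fourier_L1 f))\<^sup>2 \<le> (sqrt ((2 * pi) ^ CARD('n)) * L2_norm f)\<^sup>2"
    by (subst (asm) ennreal_le_iff) (auto simp: power_mult_distrib)
  then show "L2_norm (fourier_L1 f) \<le> sqrt ((2 * pi) ^ CARD('n)) * L2_norm f"
    by (rule power2_le_imp_le) simp
qed

lemma fourier_L1_Plancherel:
  fixes f :: "real^'n \<Rightarrow> complex"
  assumes f: "compactly_supported f"
  shows "L2_norm (fourier_L1 f) = sqrt ((2 * pi) ^ CARD('n)) * L2_norm f"
proof -
  note [measurable] = compactly_supported_borel[OF f]
  obtain R B where RB: "R > 0" "B > 0" "\<And>x. cmod (f x) \<le> B * indicator (ball 0 R) x"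
    using compactly_supported_bounded[OF f] by blast
  have B: "cmod (f x) \<le> B" for x
    using RB(3)[of x] RB(2) by (cases "x \<in> ball 0 R") (simp_all add: indicator_def)
  have "(\<integral>\<xi>. (cmod (fourier f \<xi>))\<^sup>2 \<partial>lborel) = (2 * pi) ^ DIM(real^'n) * (\<integral>x. (cmod (f x))\<^sup>2 \<partial>lborel)"
  proof (rule Plancherel_bounded_support[OF _ B])
    show "continuous_on UNIV f" using f by (simp add: compactly_supported_def)
    show "integrable lborel f"
      using compactly_supported_integrable[OF f] integrable_completion[of f lborel] by simp
    show "integrable lborel (\<lambda>x. (cmod (f x))\<^sup>2)"
      using L2_integrable[OF compactly_supported_L2[OF f]] integrable_completion[of "\<lambda>x. (cmod (f x))\<^sup>2" lborel] by simp
  qed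
  then have "(\<integral>\<xi>. (cmod (fourier f \<xi>))\<^sup>2 \<partial>lebesgue) = (2 * pi) ^ CARD('n) * (\<integral>x. (cmod (f x))\<^sup>2 \<partial>lebesgue)"
    by (simp add: integral_completion)
  then show ?thesis
    by (simp add: L2_norm_def fourier_L1_eq_fourier real_sqrt_mult)
qed

lemma fourier_L1_multiplication:
  fixes f g :: "real^'n \<Rightarrow> complex"
  assumes f: "compactly_supported f" and g: "compactly_supported g"
  shows "(\<integral>\<xi>. fourier_L1 f \<xi> * g \<xi> \<partial>lebesgue) = (\<integral>x. f x * fourier_L1 g x \<partial>lebesgue)"
proof -
  note [measurable] = compactly_supported_borel[OF f] compactly_supported_borel[OF g]
  have "integrable lborel f" "integrable lborel g"
    using compactly_supported_integrable[OF f] integrable_completion[of f lborel]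
      compactly_supported_integrable[OF g] integrable_completion[of g lborel] by simp_all
  then have "(\<integral>\<xi>. fourier f \<xi> * g \<xi> \<partial>lborel) = (\<integral>x. f x * fourier g x \<partial>lborel)"
    by (rule fourier_multiplication)
  then show ?thesis by (simp add: fourier_L1_eq_fourier integral_completion)
qed

section \<open>Extension of the transform from integrable functions to L2\<close>

lemma L2_norm_lincomb_tendsto_0:
  assumes F: "\<And>k. F k \<in> L2_space" "f \<in> L2_space" "((\<lambda>k. L2_norm (\<lambda>x. F k x - f x)) \<longlongrightarrow> 0) A"
    and G: "\<And>k. G k \<in> L2_space" "g \<in> L2_space" "((\<lambda>k. L2_norm (\<lambda>x. G k x - g x)) \<longlongrightarrow> 0) A"
  shows "((\<lambda>k. L2_norm (\<lambda>x. (a * F k x + b * G k x) - (a * f x + b * g x))) \<longlongrightarrow> 0) A"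
proof (rule Lim_null_comparison)
  have "((\<lambda>k. cmod a * L2_norm (\<lambda>x. F k x - f x) + cmod b * L2_norm (\<lambda>x. G k x - g x)) \<longlongrightarrow> cmod a * 0 + cmod b * 0) A"
    by (intro tendsto_intros F G)
  then show "((\<lambda>k. cmod a * L2_norm (\<lambda>x. F k x - f x) + cmod b * L2_norm (\<lambda>x. G k x - g x)) \<longlongrightarrow> 0) A"
    by simp
  have "L2_norm (\<lambda>x. (a * F k x + b * G k x) - (a * f x + b * g x)) \<le> cmod a * L2_norm (\<lambda>x. F k x - f x) + cmod b * L2_norm (\<lambda>x. G k x - g x)" for k
  proof -
    have "(\<lambda>x. (a * F k x + b * G k x) - (a * f x + b * g x)) = (\<lambda>x. a * (F k x - f x) + b * (G k x - g x))"
      by (auto simp: algebra_simps)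
    then show ?thesis
      using L2_add(2)[OF L2_mult_left(1)[OF L2_diff(1)[OF F(1,2)], where c=a] L2_mult_left(1)[OF L2_diff(1)[OF G(1,2)], where c=b], of k k]
        L2_mult_left(2)[OF L2_diff(1)[OF F(1,2)], of a k] L2_mult_left(2)[OF L2_diff(1)[OF G(1,2)], of b k] by simp
  qed
  then show "\<forall>\<^sub>F k in A. norm (L2_norm (\<lambda>x. (a * F k x + b * G k x) - (a * f x + b * g x))) \<le> cmod a * L2_norm (\<lambda>x. F k x - f x) + cmod b * L2_norm (\<lambda>x. G k x - g x)"
    by (intro always_eventually) auto
qed

lemma L2_lincomb: "f \<in> L2_space \<Longrightarrow> g \<in> L2_space \<Longrightarrow> (\<lambda>x. a * f x + b * g x) \<in> L2_space"
  by (intro L2_add L2_mult_left)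

lemma is_fourier_L2_lincomb:
  fixes f g f' g' :: "real^'n \<Rightarrow> complex"
  assumes "is_fourier_L2 f g" "is_fourier_L2 f' g'"
  shows "is_fourier_L2 (\<lambda>x. a * f x + b * f' x) (\<lambda>x. a * g x + b * g' x)"
proof -
  obtain F where F: "\<And>k. integrable lebesgue (F k)" "\<And>k. F k \<in> L2_space" "\<And>k. fourier_L1 (F k) \<in> L2_space"
    "(\<lambda>k. L2_norm (\<lambda>x. F k x - f x)) \<longlonglongrightarrow> 0" "(\<lambda>k. L2_norm (\<lambda>\<xi>. fourier_L1 (F k) \<xi> - g \<xi>)) \<longlonglongrightarrow> 0"
    using assms(1) unfolding is_fourier_L2_def by blast
  obtain G where G: "\<And>k. integrable lebesgue (G k)" "\<And>k. G k \<in> L2_space" "\<And>k. fourier_L1 (G k) \<in> L2_space"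
    "(\<lambda>k. L2_norm (\<lambda>x. G k x - f' x)) \<longlonglongrightarrow> 0" "(\<lambda>k. L2_norm (\<lambda>\<xi>. fourier_L1 (G k) \<xi> - g' \<xi>)) \<longlonglongrightarrow> 0"
    using assms(2) unfolding is_fourier_L2_def by blast
  have S: "f \<in> L2_space" "g \<in> L2_space" "f' \<in> L2_space" "g' \<in> L2_space"
    using assms unfolding is_fourier_L2_def by auto
  have eq: "fourier_L1 (\<lambda>x. a * F k x + b * G k x) = (\<lambda>\<xi>. a * fourier_L1 (F k) \<xi> + b * fourier_L1 (G k) \<xi>)" for k
    by (rule ext, rule fourier_L1_lincomb[OF F(1) G(1)])
  show ?thesis
    unfolding is_fourier_L2_def
  proof (intro conjI exI[of _ "\<lambda>k x. a * F k x + b * G k x"] allI)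
    show "integrable lebesgue (\<lambda>x. a * F k x + b * G k x)" for k
      using F(1) G(1) by (intro Bochner_Integration.integrable_add integrable_mult_right) auto
    show "(\<lambda>k. L2_norm (\<lambda>x. a * F k x + b * G k x - (a * f x + b * f' x))) \<longlonglongrightarrow> 0"
      by (intro L2_norm_lincomb_tendsto_0 F G S)
    show "(\<lambda>k. L2_norm (\<lambda>\<xi>. fourier_L1 (\<lambda>x. a * F k x + b * G k x) \<xi> - (a * g \<xi> + b * g' \<xi>))) \<longlonglongrightarrow> 0"
      unfolding eq by (intro L2_norm_lincomb_tendsto_0 F G S)
  qed (auto simp: eq intro!: L2_lincomb F G S)
qed

text \<open>Any approximating sequence tends to 0 in norm, hence so do its transforms by the L2
  bound. By linearity this special case makes the closure of the graph single-valued up to null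
  sets.\<close>

lemma is_fourier_L2_zero_unique:
  fixes f g :: "real^'n \<Rightarrow> complex"
  assumes fg: "is_fourier_L2 f g" and f0: "AE x in lebesgue. f x = 0"
  shows "AE x in lebesgue. g x = 0"
proof -
  obtain F where F: "\<And>k. integrable lebesgue (F k)" "\<And>k. F k \<in> L2_space" "\<And>k. fourier_L1 (F k) \<in> L2_space"
    "(\<lambda>k. L2_norm (\<lambda>x. F k x - f x)) \<longlonglongrightarrow> 0" "(\<lambda>k. L2_norm (\<lambda>\<xi>. fourier_L1 (F k) \<xi> - g \<xi>)) \<longlonglongrightarrow> 0"
    using fg unfolding is_fourier_L2_def by blast
  have S: "f \<in> L2_space" "g \<in> L2_space"
    using fg unfolding is_fourier_L2_def by auto
  have "L2_norm f = L2_norm (\<lambda>x::real^'n. 0)"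
    by (rule L2_norm_cong_AE) (use f0 L2_measurable[OF S(1)] in auto)
  then have "(\<lambda>k. L2_norm (F k)) \<longlonglongrightarrow> 0"
    using L2_norm_tendsto[OF F(2) S(1) F(4)] by simp
  then have lim: "(\<lambda>k. sqrt ((2 * pi) ^ CARD('n)) * L2_norm (F k)) \<longlonglongrightarrow> 0"
    by (rule tendsto_mult_right_zero)
  have "(\<lambda>k. L2_norm (fourier_L1 (F k))) \<longlonglongrightarrow> 0"
    by (rule Lim_null_comparison[OF always_eventually lim]) (use fourier_L1_L2_bound(2)[OF F(1,2)] in auto)
  moreover have "(\<lambda>k. L2_norm (fourier_L1 (F k))) \<longlonglongrightarrow> L2_norm g"
    by (rule L2_norm_tendsto[OF F(3) S(2) F(5)])
  ultimately have "L2_norm g = 0" by (rule LIMSEQ_unique[symmetric])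
  then show ?thesis by (rule L2_norm_eq_0D[OF S(2)])
qed

lemma is_fourier_L2_unique:
  assumes "is_fourier_L2 f g" "is_fourier_L2 f' g'" "AE x in lebesgue. f x = f' x"
  shows "AE x in lebesgue. g x = g' x"
proof -
  have "AE x in lebesgue. 1 * g x + (- 1) * g' x = 0"
    by (rule is_fourier_L2_zero_unique[OF is_fourier_L2_lincomb[OF assms(1,2)]]) (use assms(3) in auto)
  then show ?thesis by auto
qed

text \<open>The approximating sequence is exported together with the transform, because the exact
  identities are known for compactly supported functions and have to pass to the limit along
  it.\<close>

lemma is_fourier_L2_ex:
  fixes f :: "real^'n \<Rightarrow> complex"
  assumes f: "f \<in> L2_space"
  obtains F g where "is_fourier_L2 f g" "\<And>k. compactly_supported (F k)" "(\<lambda>k. L2_norm (\<lambda>x. F k x - f x)) \<longlonglongrightarrow> 0"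
    "(\<lambda>k. L2_norm (\<lambda>\<xi>. fourier_L1 (F k) \<xi> - g \<xi>)) \<longlonglongrightarrow> 0"
proof -
  obtain F where F: "\<And>k. compactly_supported (F k)" "(\<lambda>k. L2_norm (\<lambda>x. F k x - f x)) \<longlonglongrightarrow> 0"
    using L2_dense_compactly_supported[OF f] by blast
  note FI = compactly_supported_integrable[OF F(1)] and FS = compactly_supported_L2[OF F(1)]
  let ?c = "sqrt ((2 * pi) ^ CARD('n))"
  have c: "?c > 0" by simp
  have "\<exists>K. \<forall>i\<ge>K. \<forall>j\<ge>K. L2_norm (\<lambda>\<xi>. fourier_L1 (F i) \<xi> - fourier_L1 (F j) \<xi>) < e" if e: "e > 0" for e
  proof -
    have "\<forall>\<^sub>F k in sequentially. L2_norm (\<lambda>x. F k x - f x) < e / (2 * ?c)"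
      using e c by (intro order_tendstoD[OF F(2)]) auto
    then obtain K where K: "\<And>k. k \<ge> K \<Longrightarrow> L2_norm (\<lambda>x. F k x - f x) < e / (2 * ?c)"
      by (auto simp: eventually_sequentially)
    have "L2_norm (\<lambda>\<xi>. fourier_L1 (F i) \<xi> - fourier_L1 (F j) \<xi>) < e" if ij: "i \<ge> K" "j \<ge> K" for i j
    proof -
      have eq: "fourier_L1 (\<lambda>x. F i x - F j x) = (\<lambda>\<xi>. fourier_L1 (F i) \<xi> - fourier_L1 (F j) \<xi>)"
        using fourier_L1_lincomb[OF FI FI, of 1 i "-1" j] by auto
      have "L2_norm (\<lambda>\<xi>. fourier_L1 (F i) \<xi> - fourier_L1 (F j) \<xi>) \<le> ?c * L2_norm (\<lambda>x. F i x - F j x)"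
        unfolding eq[symmetric] by (intro fourier_L1_L2_bound Bochner_Integration.integrable_diff FI L2_diff FS)
      also have "\<dots> \<le> ?c * (L2_norm (\<lambda>x. F i x - f x) + L2_norm (\<lambda>x. f x - F j x))"
        by (intro mult_left_mono L2_norm_triangle FS f) auto
      also have "\<dots> < ?c * (e / (2 * ?c) + e / (2 * ?c))"
        using K[OF ij(1)] K[OF ij(2)] L2_norm_minus_commute[of f "F j"] by (intro mult_strict_left_mono c) simp
      also have "\<dots> = e" using c by (simp add: field_simps)
      finally show ?thesis .
    qed
    then show ?thesis by blast
  qed
  then obtain g where g: "g \<in> L2_space" "(\<lambda>k. L2_norm (\<lambda>x. fourier_L1 (F k) x - g x)) \<longlonglongrightarrow> 0"
    using L2_complete[of "\<lambda>k. fourier_L1 (F k)"] fourier_L1_L2_bound(1)[OF FI FS] by blast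
  have "is_fourier_L2 f g"
    unfolding is_fourier_L2_def using f g F FI FS fourier_L1_L2_bound(1)[OF FI FS] by blast
  with F g show thesis by (intro that) auto
qed

lemma is_fourier_L2_fourier_L2: "f \<in> L2_space \<Longrightarrow> is_fourier_L2 f (fourier_L2 f)"
  unfolding fourier_L2_def by (metis is_fourier_L2_ex someI_ex)

lemma fourier_L2_in_L2: "f \<in> L2_space \<Longrightarrow> fourier_L2 f \<in> L2_space"
  using is_fourier_L2_fourier_L2 unfolding is_fourier_L2_def by blast

lemma fourier_L2_AE_eqI: "is_fourier_L2 f g \<Longrightarrow> AE x in lebesgue. fourier_L2 f x = g x"
  using is_fourier_L2_unique[OF is_fourier_L2_fourier_L2, of f f g] unfolding is_fourier_L2_def by auto

lemma fourier_L2_cong_AE: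
  "f \<in> L2_space \<Longrightarrow> g \<in> L2_space \<Longrightarrow> AE x in lebesgue. f x = g x \<Longrightarrow> AE x in lebesgue. fourier_L2 f x = fourier_L2 g x"
  by (rule is_fourier_L2_unique[OF is_fourier_L2_fourier_L2 is_fourier_L2_fourier_L2])

lemma fourier_L2_lincomb:
  "f \<in> L2_space \<Longrightarrow> g \<in> L2_space \<Longrightarrow>
    AE x in lebesgue. fourier_L2 (\<lambda>x. a * f x + b * g x) x = a * fourier_L2 f x + b * fourier_L2 g x"
  by (intro fourier_L2_AE_eqI is_fourier_L2_lincomb is_fourier_L2_fourier_L2)

lemma fourier_L2_eq_fourier_L1:
  assumes "integrable lebesgue f" "f \<in> L2_space"
  shows "AE x in lebesgue. fourier_L2 f x = fourier_L1 f x"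
proof (rule fourier_L2_AE_eqI)
  \<comment> \<open>The constant sequence \<open>f\<close> is an admissible approximation.\<close>
  show "is_fourier_L2 f (fourier_L1 f)"
    unfolding is_fourier_L2_def using assms fourier_L1_L2_bound(1)[OF assms]
    by (intro conjI exI[of _ "\<lambda>_. f"]) auto
qed

text \<open>\<open>fourier_L2 f\<close> is a chosen representative and need not be the limit
  constructed above; almost everywhere equality carries the convergence over to it.\<close>

lemma fourier_L2_approx:
  fixes f :: "real^'n \<Rightarrow> complex"
  assumes f: "f \<in> L2_space"
  obtains F where "\<And>k. compactly_supported (F k)" "(\<lambda>k. L2_norm (\<lambda>x. F k x - f x)) \<longlonglongrightarrow> 0"
    "(\<lambda>k. L2_norm (\<lambda>\<xi>. fourier_L1 (F k) \<xi> - fourier_L2 f \<xi>)) \<longlonglongrightarrow> 0"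
proof -
  obtain F g where g: "is_fourier_L2 f g" and F: "\<And>k. compactly_supported (F k)" "(\<lambda>k. L2_norm (\<lambda>x. F k x - f x)) \<longlonglongrightarrow> 0"
    "(\<lambda>k. L2_norm (\<lambda>\<xi>. fourier_L1 (F k) \<xi> - g \<xi>)) \<longlonglongrightarrow> 0"
    using is_fourier_L2_ex[OF f] by blast
  have gS: "g \<in> L2_space" using g unfolding is_fourier_L2_def by blast
  have FS: "fourier_L1 (F k) \<in> L2_space" for k
    by (intro fourier_L1_L2_bound compactly_supported_integrable compactly_supported_L2 F)
  note [measurable] = L2_measurable[OF FS] L2_measurable[OF gS] L2_measurable[OF fourier_L2_in_L2[OF f]]
  have "L2_norm (\<lambda>\<xi>. fourier_L1 (F k) \<xi> - fourier_L2 f \<xi>) = L2_norm (\<lambda>\<xi>. fourier_L1 (F k) \<xi> - g \<xi>)" for k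
    by (rule L2_norm_cong_AE) (use fourier_L2_AE_eqI[OF g] in auto)
  with F show thesis by (intro that) auto
qed

theorem Plancherel:
  fixes f :: "real^'n \<Rightarrow> complex"
  assumes f: "f \<in> L2_space"
  shows "L2_norm (fourier_L2 f) = sqrt ((2 * pi) ^ CARD('n)) * L2_norm f"
proof -
  obtain F where F: "\<And>k. compactly_supported (F k)" "(\<lambda>k. L2_norm (\<lambda>x. F k x - f x)) \<longlonglongrightarrow> 0"
    "(\<lambda>k. L2_norm (\<lambda>\<xi>. fourier_L1 (F k) \<xi> - fourier_L2 f \<xi>)) \<longlonglongrightarrow> 0"
    using fourier_L2_approx[OF f] by blast
  note FI = compactly_supported_integrable[OF F(1)] and FS = compactly_supported_L2[OF F(1)]
  have "(\<lambda>k. L2_norm (fourier_L1 (F k))) \<longlonglongrightarrow> L2_norm (fourier_L2 f)"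
    by (intro L2_norm_tendsto fourier_L1_L2_bound FI FS fourier_L2_in_L2 f F)
  moreover have "(\<lambda>k. sqrt ((2 * pi) ^ CARD('n)) * L2_norm (F k)) \<longlonglongrightarrow> sqrt ((2 * pi) ^ CARD('n)) * L2_norm f"
    by (intro tendsto_intros L2_norm_tendsto FS f F)
  ultimately show ?thesis
    by (simp only: fourier_L1_Plancherel[OF F(1)]) (rule LIMSEQ_unique)
qed

lemma fourier_L2_multiplication:
  fixes f g :: "real^'n \<Rightarrow> complex"
  assumes f: "f \<in> L2_space" and g: "g \<in> L2_space"
  shows "(\<integral>\<xi>. fourier_L2 f \<xi> * g \<xi> \<partial>lebesgue) = (\<integral>x. f x * fourier_L2 g x \<partial>lebesgue)"
proof -
  obtain F where F: "\<And>k. compactly_supported (F k)" "(\<lambda>k. L2_norm (\<lambda>x. F k x - f x)) \<longlonglongrightarrow> 0"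
    "(\<lambda>k. L2_norm (\<lambda>\<xi>. fourier_L1 (F k) \<xi> - fourier_L2 f \<xi>)) \<longlonglongrightarrow> 0"
    using fourier_L2_approx[OF f] by blast
  obtain G where G: "\<And>k. compactly_supported (G k)" "(\<lambda>k. L2_norm (\<lambda>x. G k x - g x)) \<longlonglongrightarrow> 0"
    "(\<lambda>k. L2_norm (\<lambda>\<xi>. fourier_L1 (G k) \<xi> - fourier_L2 g \<xi>)) \<longlonglongrightarrow> 0"
    using fourier_L2_approx[OF g] by blast
  note FI = compactly_supported_integrable[OF F(1)] and FS = compactly_supported_L2[OF F(1)]
  note GI = compactly_supported_integrable[OF G(1)] and GS = compactly_supported_L2[OF G(1)]
  have "(\<lambda>k. \<integral>\<xi>. fourier_L1 (F k) \<xi> * G k \<xi> \<partial>lebesgue) \<longlonglongrightarrow> (\<integral>\<xi>. fourier_L2 f \<xi> * g \<xi> \<partial>lebesgue)"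
    by (intro L2_prod_tendsto fourier_L1_L2_bound FI FS GS fourier_L2_in_L2 f g F G)
  moreover have "(\<lambda>k. \<integral>\<xi>. F k \<xi> * fourier_L1 (G k) \<xi> \<partial>lebesgue) \<longlonglongrightarrow> (\<integral>\<xi>. f \<xi> * fourier_L2 g \<xi> \<partial>lebesgue)"
    by (intro L2_prod_tendsto fourier_L1_L2_bound GI FS GS fourier_L2_in_L2 f g F G)
  ultimately show ?thesis
    by (simp only: fourier_L1_multiplication[OF F(1) G(1)]) (rule LIMSEQ_unique)
qed

text \<open>With \<open>T = fourier_L2\<close> and \<open>w = cnj (T (cnj g))\<close>, the multiplication formula and the isometry property
  give \<open>\<parallel>T w - c g\<parallel>\<^sup>2 = (c\<^sup>2 - 2 c\<^sup>2 + c\<^sup>2) \<parallel>g\<parallel>\<^sup>2 = 0\<close> for \<open>c = (2 \<pi>)\<^sup>n\<close>.\<close>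

lemma fourier_L2_surj:
  fixes g :: "real^'n \<Rightarrow> complex"
  assumes g: "g \<in> L2_space"
  obtains f where "f \<in> L2_space" "AE \<xi> in lebesgue. fourier_L2 f \<xi> = g \<xi>"
proof -
  define c :: real where "c = (2 * pi) ^ CARD('n)"
  have c: "c > 0" by (simp add: c_def)
  define h where "h = fourier_L2 (\<lambda>x. cnj (g x))"
  define w where "w x = cnj (h x)" for x
  have hS: "h \<in> L2_space" unfolding h_def by (intro fourier_L2_in_L2 L2_cnj g)
  have wS: "w \<in> L2_space" unfolding w_def by (intro L2_cnj hS)
  let ?T = "fourier_L2 w"
  have TS: "?T \<in> L2_space" by (intro fourier_L2_in_L2 wS)
  have gcS: "(\<lambda>x. cnj (g x)) \<in> L2_space" by (intro L2_cnj g)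
  have Nh: "(L2_norm h)\<^sup>2 = c * (L2_norm g)\<^sup>2"
    unfolding h_def Plancherel[OF gcS] L2_cnj(2)[OF g] by (simp add: c_def power_mult_distrib)
  have NT: "(L2_norm ?T)\<^sup>2 = c\<^sup>2 * (L2_norm g)\<^sup>2"
  proof -
    have "L2_norm w = L2_norm h" unfolding w_def by (rule L2_cnj(2)[OF hS])
    moreover have "(L2_norm ?T)\<^sup>2 = c * (L2_norm w)\<^sup>2"
      unfolding Plancherel[OF wS] by (simp add: c_def power_mult_distrib)
    ultimately have "(L2_norm ?T)\<^sup>2 = c * (c * (L2_norm g)\<^sup>2)" by (simp only: Nh)
    then show ?thesis by (simp only: power2_eq_square mult.assoc)
  qed
  have inner: "(\<integral>x. ?T x * cnj (g x) \<partial>lebesgue) = of_real (c * (L2_norm g)\<^sup>2)"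
  proof -
    have "(\<integral>x. ?T x * cnj (g x) \<partial>lebesgue) = (\<integral>x. w x * h x \<partial>lebesgue)"
      unfolding h_def by (rule fourier_L2_multiplication[OF wS gcS])
    also have "\<dots> = (\<integral>x. of_real ((cmod (h x))\<^sup>2) \<partial>lebesgue)"
      unfolding w_def complex_norm_square by (simp add: mult.commute)
    also have "\<dots> = of_real ((L2_norm h)\<^sup>2)"
      unfolding L2_norm_sq by (rule integral_complex_of_real)
    finally show ?thesis by (simp add: Nh)
  qed
  have dS: "(\<lambda>x. ?T x - of_real c * g x) \<in> L2_space" by (intro L2_diff TS L2_mult_left g)
  have pt: "(cmod (?T x - of_real c * g x))\<^sup>2 = (cmod (?T x))\<^sup>2 - 2 * c * Re (?T x * cnj (g x)) + c\<^sup>2 * (cmod (g x))\<^sup>2" for x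
    unfolding cmod_power2 by (simp add: power2_eq_square algebra_simps)
  have "(L2_norm (\<lambda>x. ?T x - of_real c * g x))\<^sup>2
      = (L2_norm ?T)\<^sup>2 - 2 * c * Re (\<integral>x. ?T x * cnj (g x) \<partial>lebesgue) + c\<^sup>2 * (L2_norm g)\<^sup>2"
  proof -
    define p where "p x = ?T x * cnj (g x)" for x
    have "integrable lebesgue p" unfolding p_def by (rule L2_prod_integrable[OF TS gcS])
    then show ?thesis
      unfolding L2_norm_sq pt unfolding p_def[symmetric]
      using L2_integrable[OF TS] L2_integrable[OF g] by simp
  qed
  also have "\<dots> = 0" unfolding NT inner by (simp add: power2_eq_square)
  finally have 0: "AE x in lebesgue. ?T x - of_real c * g x = 0"
    by (intro L2_norm_eq_0D[OF dS]) simp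
  show thesis
  proof (rule that)
    \<comment> \<open>The preimage is \<open>w / c\<close>; the vanishing second summand gives it
      the shape of a linear combination, so that linearity of the transform applies.\<close>
    show "(\<lambda>x. of_real (1 / c) * w x + 0 * w x) \<in> L2_space" by (intro L2_lincomb wS)
    show "AE \<xi> in lebesgue. fourier_L2 (\<lambda>x. of_real (1 / c) * w x + 0 * w x) \<xi> = g \<xi>"
      using fourier_L2_lincomb[OF wS wS, of "of_real (1 / c)" 0] 0
    proof eventually_elim
      case (elim \<xi>)
      from elim(2) have "?T \<xi> = of_real c * g \<xi>" by simp
      then show ?case unfolding elim(1) using c by simp
    qed
  qed
qed

lemma inv_fourier_L2:
  assumes "g \<in> L2_space"
  shows "inv_fourier_L2 g \<in> L2_space" "AE \<xi> in lebesgue. fourier_L2 (inv_fourier_L2 g) \<xi> = g \<xi>"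
proof -
  obtain f where "f \<in> L2_space" "AE \<xi> in lebesgue. fourier_L2 f \<xi> = g \<xi>"
    using fourier_L2_surj[OF assms] by blast
  then have "\<exists>f. f \<in> L2_space \<and> (AE \<xi> in lebesgue. fourier_L2 f \<xi> = g \<xi>)" by blast
  from someI_ex[OF this] show "inv_fourier_L2 g \<in> L2_space" "AE \<xi> in lebesgue. fourier_L2 (inv_fourier_L2 g) \<xi> = g \<xi>"
    unfolding inv_fourier_L2_def[symmetric] by auto
qed

section \<open>The equation on the Fourier side\<close>

lemma log_symbol_nonneg [simp]: "0 \<le> log_symbol \<xi>"
  by (simp add: log_symbol_def)

lemma norm_1_plus_log_symbol [simp]: "cmod (1 + complex_of_real (log_symbol \<xi>)) = 1 + log_symbol \<xi>"
proof -
  have "cmod (complex_of_real (1 + log_symbol \<xi>)) = \<bar>1 + log_symbol \<xi>\<bar>" by (rule norm_of_real)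
  then show ?thesis by simp
qed

lemma log_symbol_measurable [measurable]: "log_symbol \<in> borel_measurable lebesgue"
proof (rule lebesgue_measurableI, rule borel_measurable_continuous_onI)
  show "continuous_on UNIV (log_symbol :: real^'n \<Rightarrow> real)"
    unfolding log_symbol_def by (intro continuous_intros) (auto simp: add_nonneg_eq_0_iff)
qed

section \<open>Multipliers, the weighted spaces and the operators of the equation\<close>

lemma L2_mult_bounded:
  fixes f m :: "real^'n \<Rightarrow> complex"
  assumes f: "f \<in> L2_space" and m: "m \<in> borel_measurable lebesgue" and bnd: "\<And>x. cmod (m x) \<le> C"
  shows "(\<lambda>x. m x * f x) \<in> L2_space" "L2_norm (\<lambda>x. m x * f x) \<le> C * L2_norm f"
proof -
  have C: "0 \<le> C" using order_trans[OF norm_ge_zero bnd] .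
  have le: "AE x in lebesgue. cmod (m x * f x) \<le> C * cmod (f x)"
    by (intro AE_I2) (auto simp: norm_mult intro!: mult_right_mono bnd)
  note meas = borel_measurable_times[OF m L2_measurable[OF f]]
  show "(\<lambda>x. m x * f x) \<in> L2_space" "L2_norm (\<lambda>x. m x * f x) \<le> C * L2_norm f"
    using L2_dominated[OF f meas le C] by auto
qed

lemma fourier_L2_eq_0D:
  fixes f :: "real^'n \<Rightarrow> complex"
  assumes f: "f \<in> L2_space" and 0: "AE \<xi> in lebesgue. fourier_L2 f \<xi> = 0"
  shows "AE x in lebesgue. f x = 0"
proof -
  have "L2_norm (fourier_L2 f) = L2_norm (\<lambda>x::real^'n. 0)"
    by (rule L2_norm_cong_AE) (use 0 L2_measurable[OF fourier_L2_in_L2[OF f]] in auto)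
  then have "L2_norm f = 0" using Plancherel[OF f] by simp
  then show ?thesis by (rule L2_norm_eq_0D[OF f])
qed

text \<open>The exponent is halved so that multiplying the transform by the weight turns the norm of
  \<open>Y_space\<close> into an L2 norm.\<close>

abbreviation Y_weight :: "real \<Rightarrow> real^'n \<Rightarrow> complex" where
  "Y_weight \<delta> \<xi> \<equiv> of_real ((1 + log_symbol \<xi>) powr (\<delta> / 2))"

lemma Y_weight_sq: "(cmod (Y_weight \<delta> \<xi> * z))\<^sup>2 = (1 + log_symbol \<xi>) powr \<delta> * (cmod z)\<^sup>2"
proof -
  have "((1 + log_symbol \<xi>) powr (\<delta> / 2))\<^sup>2 = (1 + log_symbol \<xi>) powr \<delta>"
    by (simp add: power2_eq_square flip: powr_add)
  then show ?thesis by (simp add: norm_mult power_mult_distrib)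
qed

lemma Y_space_iff: "f \<in> Y_space \<delta> \<longleftrightarrow> f \<in> L2_space \<and> (\<lambda>\<xi>. Y_weight \<delta> \<xi> * fourier_L2 f \<xi>) \<in> L2_space"
proof -
  have "(\<lambda>\<xi>. Y_weight \<delta> \<xi> * fourier_L2 f \<xi>) \<in> borel_measurable lebesgue" if "f \<in> L2_space"
    using L2_measurable[OF fourier_L2_in_L2[OF that]] by measurable
  then show ?thesis
    unfolding Y_space_def mem_Collect_eq Y_weight_sq[symmetric] by (auto intro: L2_spaceI L2_integrable)
qed

lemma Y_norm_eq: "Y_norm \<delta> f = L2_norm (\<lambda>\<xi>. Y_weight \<delta> \<xi> * fourier_L2 f \<xi>)"
  by (simp only: Y_norm_def L2_norm_def Y_weight_sq)

lemma Y_space_L2: "f \<in> Y_space \<delta> \<Longrightarrow> f \<in> L2_space"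
  by (simp add: Y_space_def)

lemma L2_norm_fourier_le_Y_norm:
  fixes f :: "real^'n \<Rightarrow> complex"
  assumes f: "f \<in> Y_space \<delta>" and \<delta>: "\<delta> \<ge> 0"
  shows "L2_norm (fourier_L2 f) \<le> Y_norm \<delta> f"
proof -
  have "L2_norm (fourier_L2 f) \<le> 1 * L2_norm (\<lambda>\<xi>. Y_weight \<delta> \<xi> * fourier_L2 f \<xi>)"
  proof (rule L2_dominated(2))
    show "AE \<xi> in lebesgue. cmod (fourier_L2 f \<xi>) \<le> 1 * cmod (Y_weight \<delta> \<xi> * fourier_L2 f \<xi>)"
    proof (intro AE_I2)
      fix \<xi> :: "real^'n"
      have "1 \<le> (1 + log_symbol \<xi>) powr (\<delta> / 2)" using \<delta> by (intro ge_one_powr_ge_zero) auto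
      from mult_right_mono[OF this norm_ge_zero[of "fourier_L2 f \<xi>"]]
      show "cmod (fourier_L2 f \<xi>) \<le> 1 * cmod (Y_weight \<delta> \<xi> * fourier_L2 f \<xi>)"
        by (simp add: norm_mult)
    qed
  qed (use f in \<open>auto simp: Y_space_iff intro: L2_measurable fourier_L2_in_L2\<close>)
  then show ?thesis by (simp add: Y_norm_eq)
qed

lemma Y_space_lincomb:
  assumes f: "f \<in> Y_space \<delta>" and g: "g \<in> Y_space \<delta>"
  shows "(\<lambda>x. a * f x + b * g x) \<in> Y_space \<delta>"
proof -
  have S: "f \<in> L2_space" "g \<in> L2_space" using f g by (auto dest: Y_space_L2)
  let ?h = "\<lambda>x. a * f x + b * g x"
  have hS: "?h \<in> L2_space" by (intro L2_lincomb S)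
  have "(\<lambda>\<xi>. Y_weight \<delta> \<xi> * fourier_L2 ?h \<xi>) \<in> L2_space"
  proof (rule L2_dominated(1)[where C=1])
    show "(\<lambda>\<xi>. a * (Y_weight \<delta> \<xi> * fourier_L2 f \<xi>) + b * (Y_weight \<delta> \<xi> * fourier_L2 g \<xi>)) \<in> L2_space"
      by (intro L2_lincomb) (use f g in \<open>auto simp: Y_space_iff\<close>)
    show "(\<lambda>\<xi>. Y_weight \<delta> \<xi> * fourier_L2 ?h \<xi>) \<in> borel_measurable lebesgue"
      using L2_measurable[OF fourier_L2_in_L2[OF hS]] by measurable
    show "AE \<xi> in lebesgue. cmod (Y_weight \<delta> \<xi> * fourier_L2 ?h \<xi>)
        \<le> 1 * cmod (a * (Y_weight \<delta> \<xi> * fourier_L2 f \<xi>) + b * (Y_weight \<delta> \<xi> * fourier_L2 g \<xi>))"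
      using fourier_L2_lincomb[OF S, of a b]
    proof eventually_elim
      case (elim \<xi>)
      show ?case unfolding elim by (simp add: algebra_simps)
    qed
  qed simp
  with hS show ?thesis by (simp add: Y_space_iff)
qed

lemma Y_space_2_dom_L:
  assumes f: "f \<in> Y_space 2"
  shows "f \<in> dom_L"
proof -
  have "(\<lambda>\<xi>. of_real (log_symbol \<xi>) * fourier_L2 f \<xi>) \<in> L2_space"
  proof (rule L2_dominated(1)[where C=1])
    show "(\<lambda>\<xi>. Y_weight 2 \<xi> * fourier_L2 f \<xi>) \<in> L2_space" using f by (simp add: Y_space_iff)
    show "(\<lambda>\<xi>. of_real (log_symbol \<xi>) * fourier_L2 f \<xi>) \<in> borel_measurable lebesgue"
      using L2_measurable[OF fourier_L2_in_L2[OF Y_space_L2[OF f]]] by measurable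
  qed (auto simp: norm_mult intro!: AE_I2 mult_right_mono)
  with f show ?thesis by (simp add: dom_L_def Y_space_L2)
qed

lemma L_op_fourier:
  assumes "f \<in> dom_L"
  shows "L_op f \<in> L2_space" "AE \<xi> in lebesgue. fourier_L2 (L_op f) \<xi> = of_real (log_symbol \<xi>) * fourier_L2 f \<xi>"
  using assms inv_fourier_L2 unfolding L_op_def dom_L_def by auto

text \<open>\<open>IL_inv\<close> is a choice, so existence comes first: dividing the transform of
  \<open>f\<close> by \<open>1 + log_symbol \<xi>\<close> and inverting yields an element of the
  domain that solves the equation. The equation then determines the transform of whatever was
  chosen.\<close>

lemma IL_inv_fourier:
  fixes f :: "real^'n \<Rightarrow> complex"
  assumes f: "f \<in> L2_space"
  shows "IL_inv f \<in> L2_space" "AE \<xi> in lebesgue. fourier_L2 (IL_inv f) \<xi> = fourier_L2 f \<xi> / of_real (1 + log_symbol \<xi>)"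
proof -
  have fS: "fourier_L2 f \<in> L2_space" by (rule fourier_L2_in_L2[OF f])
  note [measurable] = L2_measurable[OF fS]
  define G where "G \<xi> = of_real (1 / (1 + log_symbol \<xi>)) * fourier_L2 f \<xi>" for \<xi>
  have GS: "G \<in> L2_space"
    unfolding G_def[abs_def] by (rule L2_mult_bounded(1)[OF fS, where C=1]) (auto simp: norm_divide divide_le_eq add_pos_nonneg)
  define g where "g = inv_fourier_L2 G"
  have gS: "g \<in> L2_space" and gG: "AE \<xi> in lebesgue. fourier_L2 g \<xi> = G \<xi>"
    unfolding g_def using inv_fourier_L2[OF GS] by auto
  note [measurable] = L2_measurable[OF fourier_L2_in_L2[OF gS]]
  have "(\<lambda>\<xi>. of_real (log_symbol \<xi>) * fourier_L2 g \<xi>) \<in> L2_space"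
  proof (rule L2_dominated(1)[OF fS, where C=1])
    show "AE \<xi> in lebesgue. cmod (of_real (log_symbol \<xi>) * fourier_L2 g \<xi>) \<le> 1 * cmod (fourier_L2 f \<xi>)"
      using gG
    proof eventually_elim
      case (elim \<xi>)
      have "log_symbol \<xi> / (1 + log_symbol \<xi>) * cmod (fourier_L2 f \<xi>) \<le> 1 * cmod (fourier_L2 f \<xi>)"
        by (intro mult_right_mono) (auto simp: divide_le_eq add_pos_nonneg)
      then show ?case unfolding elim G_def by (simp add: norm_mult norm_divide)
    qed
  qed auto
  then have gdom: "g \<in> dom_L" using gS by (simp add: dom_L_def)
  \<comment> \<open>The residual of \<open>h + L_op h = f\<close> on the Fourier side, with the
    coefficients 1 and -1 written out to match the linearity rule. It serves for the constructed
    \<open>g\<close> and again for the chosen inverse.\<close>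
  have key: "AE \<xi> in lebesgue. fourier_L2 (\<lambda>x. 1 * (1 * h x + 1 * L_op h x) + (-1) * f x) \<xi> =
      of_real (1 + log_symbol \<xi>) * fourier_L2 h \<xi> - fourier_L2 f \<xi>" if h: "h \<in> dom_L" for h :: "real^'n \<Rightarrow> complex"
  proof -
    have hS: "h \<in> L2_space" using h by (simp add: dom_L_def)
    note Lh = L_op_fourier[OF h]
    show ?thesis
      using fourier_L2_lincomb[OF hS Lh(1), of 1 1] fourier_L2_lincomb[OF L2_lincomb[OF hS Lh(1), of 1 1] f, of 1 "-1"] Lh(2)
    proof eventually_elim
      case (elim \<xi>)
      show ?case unfolding elim(2) elim(1) elim(3) by (simp add: algebra_simps)
    qed
  qed
  have S: "(\<lambda>x. 1 * (1 * h x + 1 * L_op h x) + (-1) * f x) \<in> L2_space" if h: "h \<in> dom_L" for h :: "real^'n \<Rightarrow> complex"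
    using h L_op_fourier(1)[OF h] f by (intro L2_lincomb) (auto simp: dom_L_def)
  have "AE x in lebesgue. 1 * (1 * g x + 1 * L_op g x) + (-1) * f x = 0"
  proof (rule fourier_L2_eq_0D[OF S[OF gdom]])
    show "AE \<xi> in lebesgue. fourier_L2 (\<lambda>x. 1 * (1 * g x + 1 * L_op g x) + (-1) * f x) \<xi> = 0"
      using key[OF gdom] gG
    proof eventually_elim
      case (elim \<xi>)
      have "complex_of_real (1 + log_symbol \<xi>) \<noteq> 0"
        using log_symbol_nonneg[of \<xi>] by (metis add_nonneg_eq_0_iff of_real_eq_0_iff zero_le_one zero_neq_one)
      then show ?case unfolding elim(1) elim(2) G_def by (simp only: of_real_divide of_real_1) simp
    qed
  qed
  then have "AE x in lebesgue. g x + L_op g x = f x" by eventually_elim simp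
  with gdom have "\<exists>g. g \<in> dom_L \<and> (AE x in lebesgue. g x + L_op g x = f x)" by blast
  from someI_ex[OF this] have I: "IL_inv f \<in> dom_L" "AE x in lebesgue. IL_inv f x + L_op (IL_inv f) x = f x"
    unfolding IL_inv_def[symmetric] by auto
  show "IL_inv f \<in> L2_space" using I(1) by (simp add: dom_L_def)
  have "AE x in lebesgue. 1 * (1 * IL_inv f x + 1 * L_op (IL_inv f) x) + (-1) * f x = 0"
    using I(2) by eventually_elim simp
  from fourier_L2_cong_AE[OF S[OF I(1)] L2_zero this]
  have "AE \<xi> in lebesgue. fourier_L2 (\<lambda>x. 1 * (1 * IL_inv f x + 1 * L_op (IL_inv f) x) + (-1) * f x) \<xi> = fourier_L2 (\<lambda>x. 0) \<xi>" .
  moreover have "AE \<xi> in lebesgue. fourier_L2 (\<lambda>x::real^'n. 0) \<xi> = 0"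
    by (rule is_fourier_L2_zero_unique[OF is_fourier_L2_fourier_L2]) auto
  ultimately show "AE \<xi> in lebesgue. fourier_L2 (IL_inv f) \<xi> = fourier_L2 f \<xi> / of_real (1 + log_symbol \<xi>)"
    using key[OF I(1)]
  proof eventually_elim
    case (elim \<xi>)
    have "complex_of_real (1 + log_symbol \<xi>) \<noteq> 0"
      using log_symbol_nonneg[of \<xi>] by (metis add_nonneg_eq_0_iff of_real_eq_0_iff zero_le_one zero_neq_one)
    moreover from elim have "of_real (1 + log_symbol \<xi>) * fourier_L2 (IL_inv f) \<xi> = fourier_L2 f \<xi>" by simp
    ultimately show ?case by (simp add: field_simps)
  qed
qed

section \<open>Time derivatives in the L2 sense and the first-order factorisation\<close>

definition L2_deriv :: "(real \<Rightarrow> real^'n \<Rightarrow> complex) \<Rightarrow> (real^'n \<Rightarrow> complex) \<Rightarrow> real \<Rightarrow> bool" where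
  "L2_deriv F F' s \<longleftrightarrow> ((\<lambda>t. L2_norm (\<lambda>x. (F t x - F s x) / of_real (t - s) - F' x)) \<longlongrightarrow> 0) (at s within {0..})"

text \<open>Convergence is assumed for the transform of the difference quotient, not for the
  quotient itself, so that both regularity classes fit: the \<open>Y\<close> norm of order 1, in
  which \<open>u\<close> is differentiable, is defined through the transform, while for the velocity
  Plancherel converts the L2 limit.\<close>

lemma L2_deriv_fourier:
  fixes F :: "real \<Rightarrow> real^'n \<Rightarrow> complex"
  assumes F: "\<And>t. t \<ge> 0 \<Longrightarrow> F t \<in> L2_space" "F' \<in> L2_space" and s: "s \<ge> 0"
    and lim: "((\<lambda>t. L2_norm (fourier_L2 (\<lambda>x. (F t x - F s x) / of_real (t - s) - F' x))) \<longlongrightarrow> 0) (at s within {0..})"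
  shows "L2_deriv (\<lambda>t. fourier_L2 (F t)) (fourier_L2 F') s"
  unfolding L2_deriv_def
proof (rule Lim_transform_eventually[OF lim])
  have "L2_norm (fourier_L2 (\<lambda>x. (F t x - F s x) / of_real (t - s) - F' x)) =
      L2_norm (\<lambda>x. (fourier_L2 (F t) x - fourier_L2 (F s) x) / of_real (t - s) - fourier_L2 F' x)" if t: "t \<ge> 0" for t
  proof -
    let ?a = "1 / complex_of_real (t - s)"
    have eq: "(\<lambda>x. (F t x - F s x) / of_real (t - s) - F' x) = (\<lambda>x. 1 * (?a * F t x + (- ?a) * F s x) + (-1) * F' x)"
      by (auto simp: diff_divide_distrib)
    have S: "(\<lambda>x. ?a * F t x + (- ?a) * F s x) \<in> L2_space" by (intro L2_lincomb F t s)
    have AE: "AE x in lebesgue. fourier_L2 (\<lambda>x. (F t x - F s x) / of_real (t - s) - F' x) x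
        = (fourier_L2 (F t) x - fourier_L2 (F s) x) / of_real (t - s) - fourier_L2 F' x"
      unfolding eq using fourier_L2_lincomb[OF F(1)[OF t] F(1)[OF s], of ?a "- ?a"] fourier_L2_lincomb[OF S F(2), of 1 "-1"]
    proof eventually_elim
      case (elim x)
      show ?case unfolding elim(2) elim(1) by (simp add: diff_divide_distrib)
    qed
    have "(\<lambda>x. (F t x - F s x) / of_real (t - s) - F' x) \<in> L2_space"
      unfolding eq by (intro L2_lincomb S F)
    then show ?thesis
      by (intro L2_norm_cong_AE AE L2_measurable fourier_L2_in_L2 L2_diff L2_divide F t s)
  qed
  then show "\<forall>\<^sub>F t in at s within {0..}. L2_norm (fourier_L2 (\<lambda>x. (F t x - F s x) / of_real (t - s) - F' x)) =
      L2_norm (\<lambda>x. (fourier_L2 (F t) x - fourier_L2 (F s) x) / of_real (t - s) - fourier_L2 F' x)"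
    by (auto simp: eventually_at_filter)
qed

lemma solution_fourier:
  fixes u0 u1 :: "real^'n \<Rightarrow> complex"
  assumes sol: "is_solution u0 u1 u" and u0: "u0 \<in> L2_space" and u1: "u1 \<in> L2_space"
  obtains V W where
    "\<And>t. t \<ge> 0 \<Longrightarrow> u t \<in> L2_space" "\<And>t. t \<ge> 0 \<Longrightarrow> V t \<in> L2_space" "\<And>t. t \<ge> 0 \<Longrightarrow> W t \<in> L2_space"
    "\<And>s. s \<ge> 0 \<Longrightarrow> L2_deriv (\<lambda>t. fourier_L2 (u t)) (V s) s"
    "\<And>s. s \<ge> 0 \<Longrightarrow> L2_deriv V (W s) s"
    "\<And>t. t > 0 \<Longrightarrow> AE \<xi> in lebesgue. W t \<xi> + of_real (log_symbol \<xi>) * fourier_L2 (u t) \<xi> + V t \<xi> / of_real (1 + log_symbol \<xi>) = 0"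
    "AE \<xi> in lebesgue. fourier_L2 (u 0) \<xi> = fourier_L2 u0 \<xi>"
    "AE \<xi> in lebesgue. V 0 \<xi> = fourier_L2 u1 \<xi>"
proof -
  obtain ut utt where sol': "continuous_into (Y_space 2) (Y_norm 2) u" "C1_into (Y_space 1) (Y_norm 1) u ut"
    "C1_into L2_space L2_norm ut utt"
    "\<And>t. t > 0 \<Longrightarrow> AE x in lebesgue. utt t x + L_op (u t) x + IL_inv (ut t) x = 0"
    "AE x in lebesgue. u 0 x = u0 x" "AE x in lebesgue. ut 0 x = u1 x"
    using sol unfolding is_solution_def by blast
  have uY2: "u t \<in> Y_space 2" and uY1: "u t \<in> Y_space 1" and utY1: "ut t \<in> Y_space 1" and uttS: "utt t \<in> L2_space" if "t \<ge> 0" for t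
    using sol'(1-3) that unfolding C1_into_def continuous_into_def by auto
  have uS: "u t \<in> L2_space" and utS: "ut t \<in> L2_space" if "t \<ge> 0" for t
    using uY1[OF that] utY1[OF that] by (auto dest: Y_space_L2)
  show thesis
  proof (rule that[of "\<lambda>t. fourier_L2 (ut t)" "\<lambda>t. fourier_L2 (utt t)"])
    fix s :: real assume s: "s \<ge> 0"
    show "L2_deriv (\<lambda>t. fourier_L2 (u t)) (fourier_L2 (ut s)) s"
    proof (rule L2_deriv_fourier[OF uS utS[OF s] s])
      let ?q = "\<lambda>t x. (u t x - u s x) / of_real (t - s) - ut s x"
      have lim: "((\<lambda>t. Y_norm 1 (?q t)) \<longlongrightarrow> 0) (at s within {0..})"
        using sol'(2) s unfolding C1_into_def by auto
      have "L2_norm (fourier_L2 (?q t)) \<le> Y_norm 1 (?q t)" if t: "t \<ge> 0" for t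
      proof (rule L2_norm_fourier_le_Y_norm)
        have "(\<lambda>x. 1 * (1 / complex_of_real (t - s) * u t x + (- (1 / complex_of_real (t - s))) * u s x) + (-1) * ut s x) \<in> Y_space 1"
          by (intro Y_space_lincomb uY1 utY1 t s)
        also have "(\<lambda>x. 1 * (1 / complex_of_real (t - s) * u t x + (- (1 / complex_of_real (t - s))) * u s x) + (-1) * ut s x) = ?q t"
          by (auto simp: diff_divide_distrib)
        finally show "?q t \<in> Y_space 1" .
      qed simp
      then have "\<forall>\<^sub>F t in at s within {0..}. norm (L2_norm (fourier_L2 (?q t))) \<le> Y_norm 1 (?q t)"
        by (auto simp: eventually_at_filter)
      then show "((\<lambda>t. L2_norm (fourier_L2 (?q t))) \<longlongrightarrow> 0) (at s within {0..})"
        by (rule Lim_null_comparison[OF _ lim])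
    qed
    show "L2_deriv (\<lambda>t. fourier_L2 (ut t)) (fourier_L2 (utt s)) s"
    proof (rule L2_deriv_fourier[OF utS uttS[OF s] s])
      let ?q = "\<lambda>t x. (ut t x - ut s x) / of_real (t - s) - utt s x"
      have "((\<lambda>t. L2_norm (?q t)) \<longlongrightarrow> 0) (at s within {0..})"
        using sol'(3) s unfolding C1_into_def by auto
      then have lim: "((\<lambda>t. sqrt ((2 * pi) ^ CARD('n)) * L2_norm (?q t)) \<longlongrightarrow> 0) (at s within {0..})"
        by (rule tendsto_mult_right_zero)
      have "L2_norm (fourier_L2 (?q t)) = sqrt ((2 * pi) ^ CARD('n)) * L2_norm (?q t)" if t: "t \<ge> 0" for t
        by (intro Plancherel L2_diff L2_divide utS uttS t s)
      then show "((\<lambda>t. L2_norm (fourier_L2 (?q t))) \<longlongrightarrow> 0) (at s within {0..})"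
        by (intro Lim_transform_eventually[OF lim]) (auto simp: eventually_at_filter)
    qed
  next
    fix t :: real assume "t > 0"
    then have t: "t \<ge> 0" by simp
    note L = L_op_fourier[OF Y_space_2_dom_L[OF uY2[OF t]]] and I = IL_inv_fourier[OF utS[OF t]]
    have S: "(\<lambda>x. 1 * utt t x + 1 * L_op (u t) x) \<in> L2_space" by (intro L2_lincomb uttS L t)
    have "AE x in lebesgue. 1 * (1 * utt t x + 1 * L_op (u t) x) + 1 * IL_inv (ut t) x = 0"
      using sol'(4)[OF \<open>t > 0\<close>] by simp
    from is_fourier_L2_zero_unique[OF is_fourier_L2_fourier_L2[OF L2_lincomb[OF S I(1)]] this]
      fourier_L2_lincomb[OF S I(1), of 1 1] fourier_L2_lincomb[OF uttS[OF t] L(1), of 1 1] L(2) I(2)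
    show "AE \<xi> in lebesgue. fourier_L2 (utt t) \<xi> + of_real (log_symbol \<xi>) * fourier_L2 (u t) \<xi> + fourier_L2 (ut t) \<xi> / of_real (1 + log_symbol \<xi>) = 0"
      by eventually_elim simp
  qed (use uS utS uttS fourier_L2_in_L2 fourier_L2_cong_AE[OF uS u0 sol'(5)] fourier_L2_cong_AE[OF utS u1 sol'(6)] in auto)
qed

lemma norm_exp_minus_1_le: "cmod (exp z - 1) \<le> exp (cmod z) * cmod z"
proof -
  have "cmod (exp z - (\<Sum>i\<le>0. z ^ i / fact i)) \<le> exp \<bar>Re z\<bar> * cmod z ^ Suc 0 / fact 0"
    by (rule Taylor_exp)
  also have "\<dots> \<le> exp (cmod z) * cmod z"
    using abs_Re_le_cmod[of z] by (auto intro!: mult_right_mono)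
  finally show ?thesis by simp
qed

lemma norm_exp_minus_1_minus_le: "cmod (exp z - 1 - z) \<le> exp (cmod z) * (cmod z)\<^sup>2"
proof -
  have "cmod (exp z - (\<Sum>i\<le>1. z ^ i / fact i)) \<le> exp \<bar>Re z\<bar> * cmod z ^ Suc 1 / fact 1"
    by (rule Taylor_exp)
  also have "\<dots> \<le> exp (cmod z) * (cmod z)\<^sup>2"
    using abs_Re_le_cmod[of z] by (auto simp: power2_eq_square intro!: mult_right_mono)
  finally show ?thesis by (simp add: algebra_simps)
qed

lemma L2_deriv_mult_bounded:
  fixes F :: "real \<Rightarrow> real^'n \<Rightarrow> complex"
  assumes F: "\<And>t. t \<ge> 0 \<Longrightarrow> F t \<in> L2_space" "F' \<in> L2_space" "s \<ge> 0" and der: "L2_deriv F F' s"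
    and m: "m \<in> borel_measurable lebesgue" "\<And>x. cmod (m x) \<le> C"
  shows "L2_deriv (\<lambda>t x. m x * F t x) (\<lambda>x. m x * F' x) s"
  unfolding L2_deriv_def
proof (rule Lim_null_comparison)
  show "((\<lambda>t. C * L2_norm (\<lambda>x. (F t x - F s x) / of_real (t - s) - F' x)) \<longlongrightarrow> 0) (at s within {0..})"
    using der unfolding L2_deriv_def by (rule tendsto_mult_right_zero)
  have "L2_norm (\<lambda>x. (m x * F t x - m x * F s x) / of_real (t - s) - m x * F' x) \<le> C * L2_norm (\<lambda>x. (F t x - F s x) / of_real (t - s) - F' x)"
    if t: "t \<ge> 0" for t
  proof -
    have "(\<lambda>x. (m x * F t x - m x * F s x) / of_real (t - s) - m x * F' x) = (\<lambda>x. m x * ((F t x - F s x) / of_real (t - s) - F' x))"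
      by (auto simp: right_diff_distrib)
    then show ?thesis
      using L2_mult_bounded(2)[OF L2_diff(1)[OF L2_divide(1)[OF L2_diff(1)[OF F(1)[OF t] F(1)[OF F(3)]]] F(2)] m] by simp
  qed
  then show "\<forall>\<^sub>F t in at s within {0..}. norm (L2_norm (\<lambda>x. (m x * F t x - m x * F s x) / of_real (t - s) - m x * F' x)) \<le> C * L2_norm (\<lambda>x. (F t x - F s x) / of_real (t - s) - F' x)"
    by (auto simp: eventually_at_filter)
qed

lemma L2_deriv_diff:
  fixes F G :: "real \<Rightarrow> real^'n \<Rightarrow> complex"
  assumes F: "\<And>t. t \<ge> 0 \<Longrightarrow> F t \<in> L2_space" "F' \<in> L2_space" "L2_deriv F F' s"
    and G: "\<And>t. t \<ge> 0 \<Longrightarrow> G t \<in> L2_space" "G' \<in> L2_space" "L2_deriv G G' s" and s: "s \<ge> 0"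
  shows "L2_deriv (\<lambda>t x. F t x - G t x) (\<lambda>x. F' x - G' x) s"
  unfolding L2_deriv_def
proof (rule Lim_null_comparison)
  show "((\<lambda>t. L2_norm (\<lambda>x. (F t x - F s x) / of_real (t - s) - F' x) + L2_norm (\<lambda>x. (G t x - G s x) / of_real (t - s) - G' x)) \<longlongrightarrow> 0) (at s within {0..})"
    using F(3) G(3) unfolding L2_deriv_def by (rule tendsto_add_zero)
  have "L2_norm (\<lambda>x. (F t x - G t x - (F s x - G s x)) / of_real (t - s) - (F' x - G' x))
    \<le> L2_norm (\<lambda>x. (F t x - F s x) / of_real (t - s) - F' x) + L2_norm (\<lambda>x. (G t x - G s x) / of_real (t - s) - G' x)" if t: "t \<ge> 0" for t
  proof -
    have "(\<lambda>x. (F t x - G t x - (F s x - G s x)) / of_real (t - s) - (F' x - G' x)) =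
        (\<lambda>x. ((F t x - F s x) / of_real (t - s) - F' x) - ((G t x - G s x) / of_real (t - s) - G' x))"
      by (auto simp: diff_divide_distrib)
    then show ?thesis by (simp only:) (intro L2_diff L2_divide F G t s)
  qed
  then show "\<forall>\<^sub>F t in at s within {0..}. norm (L2_norm (\<lambda>x. (F t x - G t x - (F s x - G s x)) / of_real (t - s) - (F' x - G' x)))
    \<le> L2_norm (\<lambda>x. (F t x - F s x) / of_real (t - s) - F' x) + L2_norm (\<lambda>x. (G t x - G s x) / of_real (t - s) - G' x)"
    by (auto simp: eventually_at_filter)
qed

text \<open>Product rule. The error splits into the error for \<open>z\<close> times a bounded
  exponential, the increment of the exponential times \<open>z'\<close>, and the second-order Taylor
  remainder of the exponential times \<open>z s\<close>. Boundedness of \<open>r\<close> makes the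
  last two of order \<open>t - s\<close>, uniformly in the frequency.\<close>

lemma L2_deriv_exp_mult:
  fixes z :: "real \<Rightarrow> real^'n \<Rightarrow> complex"
  assumes z: "\<And>t. t \<ge> 0 \<Longrightarrow> z t \<in> L2_space" "z' \<in> L2_space" "s \<ge> 0" "L2_deriv z z' s"
    and r [measurable]: "r \<in> borel_measurable lebesgue" and bnd: "\<And>x. cmod (r x) \<le> M"
  shows "L2_deriv (\<lambda>t x. exp (r x * of_real t) * z t x) (\<lambda>x. exp (r x * of_real s) * (z' x + r x * z s x)) s"
  unfolding L2_deriv_def
proof (rule Lim_null_comparison)
  have M: "0 \<le> M" using order_trans[OF norm_ge_zero bnd] .
  \<comment> \<open>A bound for the exponential at all times up to \<open>s + 1\<close>; only
    \<open>t\<close> within distance 1 of \<open>s\<close> matters for the limit.\<close>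
  define K where "K = exp (M * (s + 1))"
  let ?e = "\<lambda>t x. exp (r x * complex_of_real t)"
  let ?B = "\<lambda>t. K * L2_norm (\<lambda>x. (z t x - z s x) / of_real (t - s) - z' x) + (K * exp M * M * \<bar>t - s\<bar>) * L2_norm z' + (K * exp M * M\<^sup>2 * \<bar>t - s\<bar>) * L2_norm (z s)"
  have "(?B \<longlongrightarrow> K * 0 + (K * exp M * M * \<bar>s - s\<bar>) * L2_norm z' + (K * exp M * M\<^sup>2 * \<bar>s - s\<bar>) * L2_norm (z s)) (at s within {0..})"
    using z(4) unfolding L2_deriv_def by (intro tendsto_intros) auto
  then show "(?B \<longlongrightarrow> 0) (at s within {0..})" by simp
  have e_meas [measurable]: "?e t \<in> borel_measurable lebesgue" for t by measurable
  have e_bnd: "cmod (?e t x) \<le> K" if "0 \<le> t" "t \<le> s + 1" for t x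
  proof -
    have "cmod (r x * of_real t) \<le> M * (s + 1)"
      unfolding norm_mult using that M by (intro mult_mono bnd) auto
    then show ?thesis unfolding K_def by (intro order_trans[OF norm_exp]) simp
  qed
  have main: "L2_norm (\<lambda>x. (?e t x * z t x - ?e s x * z s x) / of_real (t - s) - ?e s x * (z' x + r x * z s x)) \<le> ?B t"
    if t: "0 \<le> t" "\<bar>t - s\<bar> \<le> 1" "t \<noteq> s" for t
  proof -
    let ?h = "t - s"
    have h: "complex_of_real ?h \<noteq> 0" using t by simp
    have rh: "cmod (r x * of_real ?h) \<le> M * \<bar>?h\<bar>" for x
      unfolding norm_mult norm_of_real by (intro mult_right_mono bnd) auto
    have rh1: "cmod (r x * of_real ?h) \<le> M" for x
      using rh[of x] mult_left_mono[OF t(2) M] by simp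
    have split: "?e t x = ?e s x * exp (r x * of_real ?h)" for x
      by (simp add: exp_add[symmetric] algebra_simps)
    define A where "A x = ?e t x * ((z t x - z s x) / of_real ?h - z' x)" for x
    define B where "B x = (?e t x - ?e s x) * z' x" for x
    define C where "C x = ((?e t x - ?e s x) / of_real ?h - r x * ?e s x) * z s x" for x
    have eq: "(\<lambda>x. (?e t x * z t x - ?e s x * z s x) / of_real ?h - ?e s x * (z' x + r x * z s x)) = (\<lambda>x. A x + B x + C x)"
    proof -
      have "(et * zt - es * zs) / h - es * (w + q * zs) = et * ((zt - zs) / h - w) + (et - es) * w + ((et - es) / h - q * es) * zs"
        if "h \<noteq> 0" for et es zt zs w q h :: complex
        using that by (simp add: field_simps)
      from this[OF h] show ?thesis unfolding A_def B_def C_def by blast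
    qed
    have zt: "z t \<in> L2_space" "z s \<in> L2_space" using z t by auto
    have A: "A \<in> L2_space" "L2_norm A \<le> K * L2_norm (\<lambda>x. (z t x - z s x) / of_real ?h - z' x)"
    proof -
      have eb: "cmod (?e t x) \<le> K" for x using t by (intro e_bnd) auto
      show "A \<in> L2_space" "L2_norm A \<le> K * L2_norm (\<lambda>x. (z t x - z s x) / of_real ?h - z' x)"
        unfolding A_def[abs_def]
        using L2_mult_bounded[OF L2_diff(1)[OF L2_divide(1)[OF L2_diff(1)[OF zt]] z(2)] e_meas eb] by auto
    qed
    have Bb: "cmod (?e t x - ?e s x) \<le> K * exp M * M * \<bar>?h\<bar>" for x
    proof -
      have "?e t x - ?e s x = ?e s x * (exp (r x * of_real ?h) - 1)" unfolding split by (simp add: algebra_simps)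
      also have "cmod \<dots> \<le> K * (exp M * (M * \<bar>?h\<bar>))"
        unfolding norm_mult[of "?e s x"] using z(3)
        by (intro mult_mono e_bnd order_trans[OF norm_exp_minus_1_le] rh) (auto simp: K_def rh1 simp del: of_real_diff)
      finally show ?thesis by (simp add: mult.assoc)
    qed
    have B: "B \<in> L2_space" "L2_norm B \<le> (K * exp M * M * \<bar>?h\<bar>) * L2_norm z'"
      unfolding B_def[abs_def] using L2_mult_bounded[OF z(2) _ Bb] by auto
    have Cb: "cmod ((?e t x - ?e s x) / of_real ?h - r x * ?e s x) \<le> K * exp M * M\<^sup>2 * \<bar>?h\<bar>" for x
    proof -
      have "(?e t x - ?e s x) / of_real ?h - r x * ?e s x = ?e s x * ((exp (r x * of_real ?h) - 1 - r x * of_real ?h) / of_real ?h)"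
        unfolding split using h by (simp add: field_simps)
      also have "cmod \<dots> = cmod (?e s x) * (cmod (exp (r x * of_real ?h) - 1 - r x * of_real ?h) / \<bar>?h\<bar>)"
        unfolding norm_mult[of "?e s x"] norm_divide norm_of_real ..
      also have "\<dots> \<le> K * (exp M * (M * \<bar>?h\<bar>)\<^sup>2 / \<bar>?h\<bar>)"
        using z(3) by (intro mult_mono e_bnd divide_right_mono order_trans[OF norm_exp_minus_1_minus_le] power_mono rh) (auto simp: K_def rh1 simp del: of_real_diff)
      also have "\<dots> = K * exp M * M\<^sup>2 * \<bar>?h\<bar>"
        using t(3) by (simp add: power2_eq_square field_simps)
      finally show ?thesis .
    qed
    have C: "C \<in> L2_space" "L2_norm C \<le> (K * exp M * M\<^sup>2 * \<bar>?h\<bar>) * L2_norm (z s)"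
      unfolding C_def[abs_def] using L2_mult_bounded[OF zt(2) _ Cb] by auto
    show ?thesis
      unfolding eq using L2_add(2)[OF L2_add(1)[OF A(1) B(1)] C(1)] L2_add(2)[OF A(1) B(1)] A(2) B(2) C(2) by linarith
  qed
  have "\<forall>\<^sub>F t in at s within {0..}. t \<in> {0..} \<and> t \<noteq> s \<and> dist t s < 1"
    by (auto simp: eventually_at intro!: exI[of _ 1])
  then show "\<forall>\<^sub>F t in at s within {0..}. norm (L2_norm (\<lambda>x. (?e t x * z t x - ?e s x * z s x) / of_real (t - s) - ?e s x * (z' x + r x * z s x))) \<le> ?B t"
    by eventually_elim (use main in \<open>auto simp: dist_real_def\<close>)
qed

text \<open>The mean value theorem is applied to the real function \<open>d t\<close>, the distance
  from \<open>Z t\<close> to \<open>Z 0\<close>; the reverse triangle inequality controls its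
  difference quotients by those of \<open>Z\<close>. The derivative vanishes only at positive times,
  where the equation is imposed, and continuity covers time 0.\<close>

lemma L2_deriv_zero_constant:
  fixes Z :: "real \<Rightarrow> real^'n \<Rightarrow> complex"
  assumes Z: "\<And>t. t \<ge> 0 \<Longrightarrow> Z t \<in> L2_space" and D: "\<And>t. t \<ge> 0 \<Longrightarrow> D t \<in> L2_space"
    and der: "\<And>s. s \<ge> 0 \<Longrightarrow> L2_deriv Z (D s) s" and D0: "\<And>s. s > 0 \<Longrightarrow> AE x in lebesgue. D s x = 0"
    and T: "T \<ge> 0"
  shows "AE x in lebesgue. Z T x = Z 0 x"
proof -
  define d where "d t = L2_norm (\<lambda>x. Z t x - Z 0 x)" for t
  have quot: "\<bar>d t - d s\<bar> / \<bar>t - s\<bar> \<le> L2_norm (\<lambda>x. (Z t x - Z s x) / of_real (t - s) - D s x) + L2_norm (D s)" if "t \<ge> 0" "s \<ge> 0" for s t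
  proof -
    have "\<bar>d t - d s\<bar> \<le> L2_norm (\<lambda>x. Z t x - Z s x)"
      using L2_norm_diff_le[OF L2_diff(1)[OF Z[of t] Z[of 0]] L2_diff(1)[OF Z[of s] Z[of 0]]] that unfolding d_def by simp
    then have "\<bar>d t - d s\<bar> / \<bar>t - s\<bar> \<le> L2_norm (\<lambda>x. Z t x - Z s x) / \<bar>t - s\<bar>"
      by (intro divide_right_mono) auto
    also have "\<dots> = L2_norm (\<lambda>x. (Z t x - Z s x) / of_real (t - s))"
      using L2_divide(2)[OF L2_diff(1)[OF Z[of t] Z[of s]], of "of_real (t - s)"] that by (simp flip: of_real_diff)
    also have "\<dots> \<le> L2_norm (\<lambda>x. (Z t x - Z s x) / of_real (t - s) - D s x) + L2_norm (D s)"
      using L2_add(2)[OF L2_diff(1)[OF L2_divide(1)[OF L2_diff(1)[OF Z[of t] Z[of s]], of "of_real (t - s)"] D[of s]] D[of s]] that by simp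
    finally show ?thesis .
  qed
  have cont: "(d \<longlongrightarrow> d s) (at s within {0..})" if s: "s \<ge> 0" for s
  proof (rule LIM_zero_cancel, rule Lim_null_comparison)
    let ?B = "\<lambda>t. \<bar>t - s\<bar> * (L2_norm (\<lambda>x. (Z t x - Z s x) / of_real (t - s) - D s x) + L2_norm (D s))"
    have "(?B \<longlongrightarrow> \<bar>s - s\<bar> * (0 + L2_norm (D s))) (at s within {0..})"
      using der[OF s] unfolding L2_deriv_def by (intro tendsto_intros) auto
    then show "(?B \<longlongrightarrow> 0) (at s within {0..})" by simp
    show "\<forall>\<^sub>F t in at s within {0..}. norm (d t - d s) \<le> ?B t"
    proof -
      have "\<bar>d t - d s\<bar> \<le> ?B t" if t: "t \<ge> 0" "t \<noteq> s" for t
        unfolding mult.commute[of "\<bar>t - s\<bar>"]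
        by (rule iffD1[OF pos_divide_le_eq quot[OF t(1) s]]) (use t in simp)
      then show ?thesis by (auto simp: eventually_at_filter intro!: always_eventually)
    qed
  qed
  have deriv: "DERIV d s :> 0" if s: "s > 0" for s
  proof -
    have Ds: "L2_norm (D s) = 0"
      using L2_norm_cong_AE[of "D s" "\<lambda>x. 0"] D0[OF s] L2_measurable[OF D[of s]] s by simp
    have "((\<lambda>t. (d t - d s) / (t - s)) \<longlongrightarrow> 0) (at s within {0..})"
    proof (rule Lim_null_comparison)
      show "((\<lambda>t. L2_norm (\<lambda>x. (Z t x - Z s x) / of_real (t - s) - D s x)) \<longlongrightarrow> 0) (at s within {0..})"
        using der[of s] s unfolding L2_deriv_def by simp
      show "\<forall>\<^sub>F t in at s within {0..}. norm ((d t - d s) / (t - s)) \<le> L2_norm (\<lambda>x. (Z t x - Z s x) / of_real (t - s) - D s x)"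
        using quot[of _ s] s Ds by (auto simp: eventually_at_filter abs_divide intro!: always_eventually)
    qed
    moreover have "at s within {0..} = at s"
      using s by (intro at_within_open_subset[of s "{0<..}"]) auto
    ultimately show ?thesis by (simp add: has_field_derivative_iff)
  qed
  have "d T = d 0"
  proof (cases "T = 0")
    case False
    then have "0 < T" using T by simp
    then show ?thesis
    proof (rule DERIV_isconst2)
      show "continuous_on {0..T} d"
        unfolding continuous_on by (intro ballI tendsto_within_subset[OF cont]) auto
      show "\<And>x. 0 < x \<Longrightarrow> x < T \<Longrightarrow> DERIV d x :> 0" using deriv by blast
    qed (use T in auto)
  qed simp
  then have "L2_norm (\<lambda>x. Z T x - Z 0 x) = 0" by (simp add: d_def)
  then have "AE x in lebesgue. Z T x - Z 0 x = 0"
    using T by (intro L2_norm_eq_0D L2_diff Z) auto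
  then show ?thesis by eventually_elim simp
qed

text \<open>The equation gives \<open>W - r' * V = r * (V - r' * U)\<close>, so
  \<open>V - r' * U\<close> solves a first-order equation with rate \<open>r\<close>. Since
  \<open>r\<close> and \<open>r'\<close> are bounded only on balls, everything is multiplied by the
  indicator of a ball; countably many balls cover the space, which keeps the exceptional set
  null.\<close>

lemma diagonal_variable:
  fixes U V W :: "real \<Rightarrow> real^'n \<Rightarrow> complex"
  assumes S: "\<And>t. t \<ge> 0 \<Longrightarrow> U t \<in> L2_space" "\<And>t. t \<ge> 0 \<Longrightarrow> V t \<in> L2_space" "\<And>t. t \<ge> 0 \<Longrightarrow> W t \<in> L2_space"
    and dU: "\<And>s. s \<ge> 0 \<Longrightarrow> L2_deriv U (V s) s" and dV: "\<And>s. s \<ge> 0 \<Longrightarrow> L2_deriv V (W s) s"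
    and ode: "\<And>t. t > 0 \<Longrightarrow> AE \<xi> in lebesgue. W t \<xi> = (r \<xi> + r' \<xi>) * V t \<xi> - r \<xi> * r' \<xi> * U t \<xi>"
    and r: "r \<in> borel_measurable lebesgue" "r' \<in> borel_measurable lebesgue"
    and bnd: "\<And>R. \<exists>M. \<forall>\<xi>\<in>ball 0 R. cmod (r \<xi>) \<le> M \<and> cmod (r' \<xi>) \<le> M"
    and T: "T \<ge> 0"
  shows "AE \<xi> in lebesgue. V T \<xi> - r' \<xi> * U T \<xi> = exp (r \<xi> * of_real T) * (V 0 \<xi> - r' \<xi> * U 0 \<xi>)"
proof -
  have local: "AE \<xi> in lebesgue. \<xi> \<in> ball 0 (real k) \<longrightarrow> V T \<xi> - r' \<xi> * U T \<xi> = exp (r \<xi> * of_real T) * (V 0 \<xi> - r' \<xi> * U 0 \<xi>)" for k :: nat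
  proof -
    obtain M0 where M0: "\<And>\<xi>. \<xi> \<in> ball 0 (real k) \<Longrightarrow> cmod (r \<xi>) \<le> M0 \<and> cmod (r' \<xi>) \<le> M0"
      using bnd by blast
    define M where "M = max M0 0"
    define i where "i \<xi> = (indicator (ball 0 (real k)) \<xi> :: complex)" for \<xi> :: "real^'n"
    \<comment> \<open>The sign makes \<open>exp (q \<xi> * of_real t)\<close> an integrating factor;
      outside the ball both \<open>q\<close> and the localised unknown vanish.\<close>
    define q where "q \<xi> = - (i \<xi> * r \<xi>)" for \<xi>
    define q' where "q' \<xi> = i \<xi> * r' \<xi>" for \<xi>
    have im [measurable]: "i \<in> borel_measurable lebesgue"
      unfolding i_def by (rule lebesgue_measurableI, rule borel_measurable_indicator) simp
    have qm: "q \<in> borel_measurable lebesgue" "q' \<in> borel_measurable lebesgue"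
      unfolding q_def q'_def using r by auto
    have ib: "cmod (i \<xi>) \<le> 1" for \<xi> by (simp add: i_def indicator_def)
    have qb: "cmod (q \<xi>) \<le> M" "cmod (q' \<xi>) \<le> M" for \<xi>
      using M0[of \<xi>] by (auto simp: q_def q'_def i_def indicator_def M_def le_max_iff_disj)
    have iS: "(\<lambda>\<xi>. i \<xi> * f \<xi>) \<in> L2_space" and qS: "(\<lambda>\<xi>. q \<xi> * f \<xi>) \<in> L2_space" and q'S: "(\<lambda>\<xi>. q' \<xi> * f \<xi>) \<in> L2_space"
      if "f \<in> L2_space" for f
      using L2_mult_bounded(1)[OF that im ib] L2_mult_bounded(1)[OF that qm(1) qb(1)] L2_mult_bounded(1)[OF that qm(2) qb(2)] by auto
    define z where "z t \<xi> = i \<xi> * V t \<xi> - q' \<xi> * U t \<xi>" for t \<xi>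
    define z' where "z' s \<xi> = i \<xi> * W s \<xi> - q' \<xi> * V s \<xi>" for s \<xi>
    have zS: "z t \<in> L2_space" "z' t \<in> L2_space" if "t \<ge> 0" for t
      unfolding z_def[abs_def] z'_def[abs_def] using that by (auto intro!: L2_diff(1) iS q'S S)
    have dz: "L2_deriv z (z' s) s" if s: "s \<ge> 0" for s
      unfolding z_def[abs_def] z'_def[abs_def] using s
      by (intro L2_deriv_diff L2_deriv_mult_bounded[OF _ _ _ _ im ib] L2_deriv_mult_bounded[OF _ _ _ _ qm(2) qb(2)] dU dV iS q'S S)
    define Z where "Z t \<xi> = exp (q \<xi> * of_real t) * z t \<xi>" for t \<xi>
    define D where "D s \<xi> = exp (q \<xi> * of_real s) * (z' s \<xi> + q \<xi> * z s \<xi>)" for s \<xi>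
    have eb: "cmod (exp (q \<xi> * of_real t)) \<le> exp (M * t)" if "t \<ge> 0" for t \<xi>
      by (rule order_trans[OF norm_exp]) (use that qb in \<open>auto simp: norm_mult intro!: mult_right_mono\<close>)
    have em: "(\<lambda>\<xi>. exp (q \<xi> * of_real t)) \<in> borel_measurable lebesgue" for t
      using qm by measurable
    have ZS: "Z t \<in> L2_space" and DS: "D t \<in> L2_space" if "t \<ge> 0" for t
      unfolding Z_def[abs_def] D_def[abs_def] using that by (auto intro!: L2_mult_bounded(1)[OF _ em eb] L2_add(1) qS zS)
    have dZ: "L2_deriv Z (D s) s" if s: "s \<ge> 0" for s
      unfolding Z_def[abs_def] D_def[abs_def] by (rule L2_deriv_exp_mult[OF zS(1) zS(2)[OF s] s dz[OF s] qm(1) qb(1)])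
    have D0: "AE \<xi> in lebesgue. D s \<xi> = 0" if s: "s > 0" for s
      using ode[OF s]
    proof eventually_elim
      case (elim \<xi>)
      show ?case
        unfolding D_def z'_def z_def q_def q'_def elim by (simp add: i_def indicator_def algebra_simps)
    qed
    have "AE \<xi> in lebesgue. Z T \<xi> = Z 0 \<xi>"
      by (rule L2_deriv_zero_constant[where D=D, OF ZS DS dZ D0 T])
    then show ?thesis
    proof eventually_elim
      case (elim \<xi>)
      show ?case
      proof
        assume "\<xi> \<in> ball 0 (real k)"
        then have "exp (- (r \<xi> * of_real T)) * (V T \<xi> - r' \<xi> * U T \<xi>) = V 0 \<xi> - r' \<xi> * U 0 \<xi>"
          using elim by (simp add: Z_def z_def q_def q'_def i_def)
        then show "V T \<xi> - r' \<xi> * U T \<xi> = exp (r \<xi> * of_real T) * (V 0 \<xi> - r' \<xi> * U 0 \<xi>)"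
          by (auto simp: exp_minus field_simps)
      qed
    qed
  qed
  then have "AE \<xi> in lebesgue. \<forall>k::nat. \<xi> \<in> ball 0 (real k) \<longrightarrow> V T \<xi> - r' \<xi> * U T \<xi> = exp (r \<xi> * of_real T) * (V 0 \<xi> - r' \<xi> * U 0 \<xi>)"
    by (subst AE_all_countable) blast
  then show ?thesis
  proof eventually_elim
    case (elim \<xi>)
    obtain k :: nat where "norm \<xi> < real k" using reals_Archimedean2 by blast
    then show ?case using elim by auto
  qed
qed

section \<open>Characteristic roots and high frequencies\<close>

definition disc :: "real \<Rightarrow> real" where
  "disc x = (1 / (1 + x))\<^sup>2 - 4 * x"

text \<open>A square root of \<open>disc x\<close> for either sign of \<open>disc x\<close>: one of the two summands vanishes.\<close>

definition root_diff :: "real \<Rightarrow> complex" where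
  "root_diff x = of_real (sqrt (max 0 (disc x))) + \<i> * of_real (sqrt (max 0 (- disc x)))"

text \<open>The root with the larger real part when the discriminant is positive, hence the slow
  mode at low frequency. Once the discriminant is negative, \<open>root_p\<close> and
  \<open>root_m\<close> are conjugate with real part \<open>- 1 / (2 * (1 + x))\<close>.\<close>

definition root_p :: "real \<Rightarrow> complex" where
  "root_p x = (- of_real (1 / (1 + x)) + root_diff x) / 2"

definition root_m :: "real \<Rightarrow> complex" where
  "root_m x = (- of_real (1 / (1 + x)) - root_diff x) / 2"

lemma Re_root_diff: "Re (root_diff x) = sqrt (max 0 (disc x))"
  and Im_root_diff: "Im (root_diff x) = sqrt (max 0 (- disc x))"
  by (simp_all add: root_diff_def)

lemma root_diff_sq: "root_diff x * root_diff x = of_real (disc x)"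
  by (auto simp: complex_eq_iff Re_root_diff Im_root_diff max_def)

lemma norm_root_diff_sq: "(cmod (root_diff x))\<^sup>2 = \<bar>disc x\<bar>"
  using arg_cong[OF root_diff_sq[of x], of cmod] by (simp add: norm_mult power2_eq_square)

lemma root_sum: "root_p x + root_m x = - of_real (1 / (1 + x))"
proof -
  have "(- b + d) / 2 + (- b - d) / 2 = - b" for b d :: complex by (simp add: field_simps)
  then show ?thesis unfolding root_p_def root_m_def by blast
qed

lemma root_minus: "root_p x - root_m x = root_diff x"
proof -
  have "(- b + d) / 2 - (- b - d) / 2 = d" for b d :: complex by (simp add: field_simps)
  then show ?thesis unfolding root_p_def root_m_def by blast
qed

lemma root_prod: "root_p x * root_m x = of_real x"
proof -
  have "(- b + d) / 2 * ((- b - d) / 2) = (b * b - d * d) / 4" for b d :: complex by (simp add: field_simps)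
  then have "root_p x * root_m x = (of_real (1 / (1 + x)) * of_real (1 / (1 + x)) - root_diff x * root_diff x) / 4"
    unfolding root_p_def root_m_def by blast
  also have "\<dots> = of_real (((1 / (1 + x))\<^sup>2 - disc x) / 4)"
    unfolding root_diff_sq by (simp add: power2_eq_square)
  finally show ?thesis by (simp add: disc_def)
qed

lemma inverse_1_plus: assumes "0 \<le> x" shows "0 < 1 / (1 + x)" "1 / (1 + x) \<le> (1::real)"
  using assms by auto

lemma norm_root_diff_le: assumes x: "0 \<le> x" shows "cmod (root_diff x) \<le> 1 + 2 * x"
proof (rule power2_le_imp_le)
  have "(1 / (1 + x))\<^sup>2 \<le> 1" using inverse_1_plus[OF x] by (simp add: power_le_one)
  moreover have "0 \<le> (1 / (1 + x))\<^sup>2" by simp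
  ultimately have "\<bar>disc x\<bar> \<le> 1 + 4 * x" unfolding disc_def using x by linarith
  also have "\<dots> \<le> (1 + 2 * x)\<^sup>2" using x by (simp add: power2_eq_square algebra_simps)
  finally show "(cmod (root_diff x))\<^sup>2 \<le> (1 + 2 * x)\<^sup>2" by (simp add: norm_root_diff_sq)
qed (use x in simp)

lemma norm_root_le_half:
  assumes x: "0 \<le> x"
  shows "cmod (root_p x) \<le> (1 + cmod (root_diff x)) / 2" "cmod (root_m x) \<le> (1 + cmod (root_diff x)) / 2"
proof -
  have 1: "cmod (- of_real (1 / (1 + x))) \<le> 1"
    using inverse_1_plus[OF x] unfolding norm_minus_cancel norm_of_real by simp
  show "cmod (root_p x) \<le> (1 + cmod (root_diff x)) / 2"
    unfolding root_p_def norm_divide using norm_triangle_ineq[of "- of_real (1 / (1 + x))" "root_diff x"] 1 by simp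
  show "cmod (root_m x) \<le> (1 + cmod (root_diff x)) / 2"
    unfolding root_m_def norm_divide using norm_triangle_ineq4[of "- of_real (1 / (1 + x))" "root_diff x"] 1 by simp
qed

lemma norm_root_le:
  assumes x: "0 \<le> x"
  shows "cmod (root_p x) \<le> 1 + x" "cmod (root_m x) \<le> 1 + x"
  using norm_root_le_half[OF x] norm_root_diff_le[OF x] by auto

text \<open>With \<open>b = 1 / (1 + x)\<close>, which is at most 1, the term \<open>4 * x\<close>
  is at least 4/10 and so exceeds 36/100 of \<open>b^2\<close>. Thus the real part of
  \<open>root_diff\<close> is at most 8/10 of \<open>b\<close>, and half of the remaining 2/10 of
  \<open>b\<close> is the damping.\<close>

lemma Re_root_le:
  assumes x: "1 / 10 \<le> x"
  shows "Re (root_p x) \<le> - (1 / 10) / (1 + x)" "Re (root_m x) \<le> - (1 / 10) / (1 + x)"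
proof -
  let ?b = "1 / (1 + x)"
  have b: "0 < ?b" "?b \<le> 1" using inverse_1_plus[of x] x by auto
  have "?b\<^sup>2 \<le> 1" using b by (simp add: power_le_one)
  then have "disc x \<le> 64 / 100 * ?b\<^sup>2" using x unfolding disc_def by linarith
  also have "64 / 100 * ?b\<^sup>2 = (8 / 10 * ?b)\<^sup>2" unfolding power_mult_distrib by (simp add: power_divide)
  finally have "max 0 (disc x) \<le> (8 / 10 * ?b)\<^sup>2" by simp
  then have s: "sqrt (max 0 (disc x)) \<le> 8 / 10 * ?b"
    using b by (intro real_le_lsqrt) auto
  have s0: "0 \<le> sqrt (max 0 (disc x))" by simp
  have "Re (root_p x) = (- ?b + sqrt (max 0 (disc x))) / 2" "Re (root_m x) = (- ?b - sqrt (max 0 (disc x))) / 2"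
    by (simp_all add: root_p_def root_m_def Re_root_diff)
  moreover have "(- c + r) / 2 \<le> - (1 / 10) * c" "(- c - r) / 2 \<le> - (1 / 10) * c" if "r \<le> 8 / 10 * c" "0 \<le> r" "0 < c" for c r :: real
    using that by auto
  from this[OF s s0 b(1)] calculation
  have "Re (root_p x) \<le> - (1 / 10) * ?b" "Re (root_m x) \<le> - (1 / 10) * ?b"
    by (simp_all only:)
  moreover have "- (1 / 10) / (1 + x) = - (1 / 10) * ?b" by simp
  ultimately show "Re (root_p x) \<le> - (1 / 10) / (1 + x)" "Re (root_m x) \<le> - (1 / 10) / (1 + x)"
    by (simp_all only:)
qed

text \<open>The discriminant is strictly decreasing for nonnegative \<open>x\<close>. Consequently
  the frequencies with a double root lie on a single sphere.\<close>

lemma disc_zero_unique: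
  assumes "0 \<le> x" "0 \<le> y" "disc x = 0" "disc y = 0"
  shows "x = y"
proof -
  have *: "\<not> x < y" if "0 \<le> x" "0 \<le> y" "disc x = 0" "disc y = 0" for x y
  proof
    assume "x < y"
    then have "(1 / (1 + y))\<^sup>2 \<le> (1 / (1 + x))\<^sup>2"
      using that by (intro power_mono frac_le) auto
    then show False using that \<open>x < y\<close> unfolding disc_def by linarith
  qed
  show ?thesis using *[of x y] *[of y x] assms by linarith
qed

lemma AE_root_diff_nonzero: "AE \<xi> in lebesgue. root_diff (log_symbol (\<xi> :: real^'n)) \<noteq> 0"
proof (cases "\<exists>\<eta> :: real^'n. root_diff (log_symbol \<eta>) = 0")
  case True
  then obtain \<eta> :: "real^'n" where \<eta>: "root_diff (log_symbol \<eta>) = 0" by blast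
  have d0: "disc (log_symbol \<xi>) = 0" if "root_diff (log_symbol \<xi>) = 0" for \<xi> :: "real^'n"
    using root_diff_sq[of "log_symbol \<xi>"] that by simp
  have "norm \<xi> = norm \<eta>" if "root_diff (log_symbol \<xi>) = 0" for \<xi> :: "real^'n"
  proof -
    have "log_symbol \<xi> = log_symbol \<eta>"
      by (rule disc_zero_unique) (use d0[OF that] d0[OF \<eta>] in auto)
    then have "1 + (norm \<xi>)\<^sup>2 = 1 + (norm \<eta>)\<^sup>2"
      unfolding log_symbol_def by (subst (asm) ln_inj_iff) (auto simp: add_pos_nonneg)
    then show ?thesis by (simp add: power2_eq_iff_nonneg)
  qed
  then have "{\<xi> :: real^'n. root_diff (log_symbol \<xi>) = 0} \<subseteq> sphere 0 (norm \<eta>)"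
    by auto
  then have "negligible {\<xi> :: real^'n. root_diff (log_symbol \<xi>) = 0}"
    using negligible_sphere negligible_subset by blast
  then show ?thesis
    by (intro AE_I'[of "{\<xi> :: real^'n. root_diff (log_symbol \<xi>) = 0}"]) (auto simp: negligible_iff_null_sets)
qed auto

lemma root_measurable [measurable]:
  "(\<lambda>\<xi>::real^'n. root_p (log_symbol \<xi>)) \<in> borel_measurable lebesgue"
  "(\<lambda>\<xi>::real^'n. root_m (log_symbol \<xi>)) \<in> borel_measurable lebesgue"
  unfolding root_p_def root_m_def root_diff_def disc_def by measurable

text \<open>The diagonalisation is used with the two roots in either order, and subtracting the
  results eliminates the velocity \<open>V T\<close>. The factor \<open>root_diff\<close> is left on
  the left-hand side, to be divided out only in combination with the difference of the
  exponentials.\<close>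

lemma solution_formula:
  fixes u0 u1 :: "real^'n \<Rightarrow> complex"
  assumes sol: "is_solution u0 u1 u" and u0: "u0 \<in> L2_space" and u1: "u1 \<in> L2_space" and T: "T \<ge> 0"
  shows "AE \<xi> in lebesgue. root_diff (log_symbol \<xi>) \<noteq> 0 \<and>
    root_diff (log_symbol \<xi>) * fourier_L2 (u T) \<xi> =
      exp (root_p (log_symbol \<xi>) * of_real T) * (fourier_L2 u1 \<xi> - root_m (log_symbol \<xi>) * fourier_L2 u0 \<xi>)
      - exp (root_m (log_symbol \<xi>) * of_real T) * (fourier_L2 u1 \<xi> - root_p (log_symbol \<xi>) * fourier_L2 u0 \<xi>)"
proof -
  obtain V W where
    uS: "\<And>t. t \<ge> 0 \<Longrightarrow> u t \<in> L2_space" and VS: "\<And>t. t \<ge> 0 \<Longrightarrow> V t \<in> L2_space" and WS: "\<And>t. t \<ge> 0 \<Longrightarrow> W t \<in> L2_space"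
    and dU: "\<And>s. s \<ge> 0 \<Longrightarrow> L2_deriv (\<lambda>t. fourier_L2 (u t)) (V s) s"
    and dV: "\<And>s. s \<ge> 0 \<Longrightarrow> L2_deriv V (W s) s"
    and ode: "\<And>t. t > 0 \<Longrightarrow> AE \<xi> in lebesgue. W t \<xi> + of_real (log_symbol \<xi>) * fourier_L2 (u t) \<xi> + V t \<xi> / of_real (1 + log_symbol \<xi>) = 0"
    and U0: "AE \<xi> in lebesgue. fourier_L2 (u 0) \<xi> = fourier_L2 u0 \<xi>"
    and V0: "AE \<xi> in lebesgue. V 0 \<xi> = fourier_L2 u1 \<xi>"
    using solution_fourier[OF sol u0 u1] by blast
  have US: "fourier_L2 (u t) \<in> L2_space" if "t \<ge> 0" for t using fourier_L2_in_L2[OF uS[OF that]] .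
  have bnd: "\<exists>M. \<forall>\<xi>::real^'n\<in>ball 0 R. cmod (root_p (log_symbol \<xi>)) \<le> M \<and> cmod (root_m (log_symbol \<xi>)) \<le> M" for R
  proof (intro exI[of _ "1 + ln (1 + R\<^sup>2)"] ballI conjI)
    fix \<xi> :: "real^'n" assume "\<xi> \<in> ball 0 R"
    then have "(norm \<xi>)\<^sup>2 \<le> R\<^sup>2" by (intro power_mono) auto
    then have "log_symbol \<xi> \<le> ln (1 + R\<^sup>2)" unfolding log_symbol_def by (subst ln_le_cancel_iff) (auto simp: add_pos_nonneg)
    then show "cmod (root_p (log_symbol \<xi>)) \<le> 1 + ln (1 + R\<^sup>2)" "cmod (root_m (log_symbol \<xi>)) \<le> 1 + ln (1 + R\<^sup>2)"
      using norm_root_le[of "log_symbol \<xi>"] by auto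
  qed
  then have bnd': "\<exists>M. \<forall>\<xi>::real^'n\<in>ball 0 R. cmod (root_m (log_symbol \<xi>)) \<le> M \<and> cmod (root_p (log_symbol \<xi>)) \<le> M" for R
    by meson
  have ode': "AE \<xi> in lebesgue. W t \<xi> = (root_p (log_symbol \<xi>) + root_m (log_symbol \<xi>)) * V t \<xi> - root_p (log_symbol \<xi>) * root_m (log_symbol \<xi>) * fourier_L2 (u t) \<xi>" if "t > 0" for t
    using ode[OF that]
  proof eventually_elim
    case (elim \<xi>)
    have "V t \<xi> / of_real (1 + log_symbol \<xi>) = of_real (1 / (1 + log_symbol \<xi>)) * V t \<xi>" by simp
    then show ?case using elim unfolding root_sum root_prod by (simp add: algebra_simps eq_neg_iff_add_eq_0)
  qed
  then have ode'': "AE \<xi> in lebesgue. W t \<xi> = (root_m (log_symbol \<xi>) + root_p (log_symbol \<xi>)) * V t \<xi> - root_m (log_symbol \<xi>) * root_p (log_symbol \<xi>) * fourier_L2 (u t) \<xi>" if "t > 0" for t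
    using that by (simp add: add.commute mult.commute)
  have "AE \<xi> in lebesgue. V T \<xi> - root_m (log_symbol \<xi>) * fourier_L2 (u T) \<xi> = exp (root_p (log_symbol \<xi>) * of_real T) * (V 0 \<xi> - root_m (log_symbol \<xi>) * fourier_L2 (u 0) \<xi>)"
    by (rule diagonal_variable[OF US VS WS dU dV ode' root_measurable(1,2) bnd T])
  moreover have "AE \<xi> in lebesgue. V T \<xi> - root_p (log_symbol \<xi>) * fourier_L2 (u T) \<xi> = exp (root_m (log_symbol \<xi>) * of_real T) * (V 0 \<xi> - root_p (log_symbol \<xi>) * fourier_L2 (u 0) \<xi>)"
    by (rule diagonal_variable[OF US VS WS dU dV ode'' root_measurable(2,1) bnd' T])
  ultimately show ?thesis
    using U0 V0 AE_root_diff_nonzero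
  proof eventually_elim
    case (elim \<xi>)
    have "root_diff (log_symbol \<xi>) * fourier_L2 (u T) \<xi> =
        (V T \<xi> - root_m (log_symbol \<xi>) * fourier_L2 (u T) \<xi>) - (V T \<xi> - root_p (log_symbol \<xi>) * fourier_L2 (u T) \<xi>)"
      unfolding root_minus[symmetric] by (simp add: algebra_simps)
    then show ?case using elim by simp
  qed
qed

section \<open>Decay of the modes at high frequency\<close>

lemma norm_exp_diff_le:
  assumes "Re z \<le> k" "Re w \<le> k"
  shows "cmod (exp z - exp w) \<le> exp k * cmod (z - w)"
proof (rule field_differentiable_bound[where S="{z. Re z \<le> k}" and f'=exp])
  show "convex {z. Re z \<le> k}" by (rule convex_halfspace_Re_le)
qed (use assms in \<open>auto intro!: derivative_eq_intros\<close>)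

text \<open>The inequality \<open>y / p \<le> exp (y / p)\<close> raised to the power
  \<open>p\<close>.\<close>

lemma exp_minus_le_powr:
  assumes p: "0 < p" and y: "0 < (y::real)"
  shows "exp (- y) \<le> p powr p * y powr (- p)"
proof -
  have "y / p \<le> exp (y / p)" using exp_ge_add_one_self[of "y / p"] by linarith
  then have "(y / p) powr p \<le> exp (y / p) powr p"
    using p y by (intro powr_mono2) auto
  also have "\<dots> = exp y" using p by (simp add: powr_def)
  finally have "y powr p \<le> exp y * p powr p"
    using p y by (simp add: powr_divide divide_le_eq)
  then show ?thesis
    using y by (simp add: exp_minus powr_minus field_simps)
qed

lemma sum_sq_le: "(x + y)\<^sup>2 \<le> 2 * x\<^sup>2 + 2 * (y::real)\<^sup>2"
  using sum_squares_bound[of x y] by (simp add: power2_sum)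

text \<open>The singular factor \<open>1 / root_diff x\<close> is confined to the divided difference
  of the exponentials, which stays bounded for fixed \<open>t\<close> as the two roots
  merge.\<close>

lemma mode_representation:
  assumes nz: "root_diff x \<noteq> 0"
    and eq: "root_diff x * U = exp (root_p x * of_real t) * (b - root_m x * a) - exp (root_m x * of_real t) * (b - root_p x * a)"
  shows "U = exp (root_p x * of_real t) * a + (b - root_p x * a) * ((exp (root_p x * of_real t) - exp (root_m x * of_real t)) / root_diff x)"
proof -
  let ?P = "exp (root_p x * of_real t)" and ?M = "exp (root_m x * of_real t)"
  have "root_diff x * U = root_diff x * (?P * a) + (b - root_p x * a) * (?P - ?M)"
    unfolding eq unfolding root_minus[symmetric] by (simp add: algebra_simps)
  then show ?thesis using nz by (simp add: field_simps)
qed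

text \<open>This range contains the double root, so \<open>root_diff x\<close> is not bounded below; the mean value bound on the
  difference of the exponentials costs a factor \<open>t\<close>.\<close>

lemma high_frequency_middle:
  assumes x: "1 / 10 \<le> x" "x \<le> 1" and t: "1 \<le> t" and l: "0 \<le> l" and nz: "root_diff x \<noteq> 0"
    and eq: "root_diff x * U = exp (root_p x * of_real t) * (b - root_m x * a) - exp (root_m x * of_real t) * (b - root_p x * a)"
  shows "(cmod U)\<^sup>2 \<le> 18 * ((l + 3) powr (l + 3) * 10 powr (l + 3)) * t powr (- (l + 1)) * ((cmod a)\<^sup>2 + (cmod b)\<^sup>2)"
proof -
  let ?P = "exp (root_p x * of_real t)" and ?M = "exp (root_m x * of_real t)"
  define e where "e = exp (- (t / 20))"
  have "- (1 / 10) / (1 + x) \<le> - (1 / 20)" using x by (simp add: field_simps)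
  then have r: "Re (root_p x) \<le> - (1 / 20)" "Re (root_m x) \<le> - (1 / 20)"
    using Re_root_le[OF x(1)] by auto
  have Re: "Re (root_p x * of_real t) \<le> - (t / 20)" "Re (root_m x * of_real t) \<le> - (t / 20)"
    using mult_right_mono[OF r(1), of t] mult_right_mono[OF r(2), of t] t by auto
  have e: "0 < e" by (simp add: e_def)
  have P: "cmod ?P \<le> e" unfolding norm_exp_eq_Re e_def using Re by simp
  have "cmod (?P - ?M) \<le> e * cmod (root_p x * of_real t - root_m x * of_real t)"
    unfolding e_def by (rule norm_exp_diff_le[OF Re])
  also have "root_p x * of_real t - root_m x * of_real t = root_diff x * of_real t"
    unfolding root_minus[symmetric] by (simp add: algebra_simps)
  finally have S: "cmod ((?P - ?M) / root_diff x) \<le> e * t"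
    using nz t by (simp add: norm_mult norm_divide divide_le_eq mult_ac)
  have rp: "cmod (root_p x) \<le> 2" using norm_root_le(1)[of x] x by simp
  have "cmod U \<le> cmod (?P * a) + cmod ((b - root_p x * a) * ((?P - ?M) / root_diff x))"
    unfolding mode_representation[OF nz eq] by (rule norm_triangle_ineq)
  also have "\<dots> \<le> e * cmod a + (cmod b + 2 * cmod a) * (e * t)"
  proof (intro add_mono)
    show "cmod (?P * a) \<le> e * cmod a" unfolding norm_mult by (intro mult_right_mono P) simp
    have "cmod (b - root_p x * a) \<le> cmod b + cmod (root_p x * a)" by (rule norm_triangle_ineq4)
    also have "\<dots> \<le> cmod b + 2 * cmod a" unfolding norm_mult by (intro add_left_mono mult_right_mono rp) simp
    finally show "cmod ((b - root_p x * a) * ((?P - ?M) / root_diff x)) \<le> (cmod b + 2 * cmod a) * (e * t)"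
      unfolding norm_mult[of "b - root_p x * a"] by (intro mult_mono S) auto
  qed
  also have "\<dots> \<le> (e * t) * cmod a + (cmod b + 2 * cmod a) * (e * t)"
    using e t by (intro add_right_mono mult_right_mono) auto
  also have "\<dots> \<le> (e * t) * (3 * (cmod a + cmod b))"
    using e t by (simp add: algebra_simps)
  finally have "(cmod U)\<^sup>2 \<le> ((e * t) * (3 * (cmod a + cmod b)))\<^sup>2"
    by (intro power_mono) auto
  also have "\<dots> = (e * t)\<^sup>2 * (9 * (cmod a + cmod b)\<^sup>2)" by (simp only: power_mult_distrib) simp
  also have "\<dots> \<le> (e * t)\<^sup>2 * (9 * (2 * (cmod a)\<^sup>2 + 2 * (cmod b)\<^sup>2))"
    by (intro mult_left_mono sum_sq_le) auto
  also have "\<dots> = 18 * (e * t)\<^sup>2 * ((cmod a)\<^sup>2 + (cmod b)\<^sup>2)" by (simp add: algebra_simps)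
  also have "\<dots> \<le> 18 * ((l + 3) powr (l + 3) * 10 powr (l + 3) * t powr (- (l + 1))) * ((cmod a)\<^sup>2 + (cmod b)\<^sup>2)"
  proof (intro mult_right_mono mult_left_mono)
    have "e\<^sup>2 = exp (- (t / 10))" by (simp add: e_def power2_eq_square flip: exp_add)
    \<comment> \<open>The exponent is \<open>l + 1\<close> plus 2, to pay for the factor
      \<open>t^2\<close> from the mean value bound.\<close>
    also have "\<dots> \<le> (l + 3) powr (l + 3) * (t / 10) powr (- (l + 3))"
      using t l by (intro exp_minus_le_powr) auto
    also have "(t / 10) powr (- (l + 3)) = 10 powr (l + 3) * t powr (- (l + 3))"
      unfolding powr_minus using t by (subst powr_divide) (auto simp: divide_inverse)
    finally have "e\<^sup>2 * t\<^sup>2 \<le> (l + 3) powr (l + 3) * (10 powr (l + 3) * t powr (- (l + 3))) * t\<^sup>2"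
      by (intro mult_right_mono) auto
    also have "t\<^sup>2 = t powr 2" using t by simp
    also have "(l + 3) powr (l + 3) * (10 powr (l + 3) * t powr (- (l + 3))) * t powr 2 = (l + 3) powr (l + 3) * 10 powr (l + 3) * (t powr (- (l + 3)) * t powr 2)"
      by (simp only: mult_ac)
    also have "t powr (- (l + 3)) * t powr 2 = t powr (- (l + 1))" unfolding powr_add[symmetric] by (simp add: algebra_simps)
    finally show "(e * t)\<^sup>2 \<le> (l + 3) powr (l + 3) * 10 powr (l + 3) * t powr (- (l + 1))"
      using t by (simp add: power_mult_distrib)
  qed auto
  finally show ?thesis by (simp add: mult.assoc)
qed

text \<open>Here \<open>root_diff\<close> has size comparable to \<open>q = sqrt (1 + x)\<close>.
  Dividing by it gains \<open>1 / q\<close> on \<open>b\<close>, which is why the weight on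
  \<open>b\<close> is one power of \<open>1 + x\<close> lower after squaring; on \<open>a\<close>
  the gain cancels against the size of \<open>root_p\<close>. The decay
  \<open>exp (- t / (5 * (1 + x)))\<close> degenerates as \<open>x\<close> grows, and trading it for
  \<open>t powr (- (l + 1))\<close> costs \<open>(1 + x) powr (l + 1)\<close>.\<close>

lemma high_frequency_large:
  assumes x: "1 \<le> x" and t: "1 \<le> t" and l: "0 \<le> l" and nz: "root_diff x \<noteq> 0"
    and eq: "root_diff x * U = exp (root_p x * of_real t) * (b - root_m x * a) - exp (root_m x * of_real t) * (b - root_p x * a)"
  shows "(cmod U)\<^sup>2 \<le> 50 * ((l + 1) powr (l + 1) * 5 powr (l + 1)) * t powr (- (l + 1)) * ((1 + x) powr (l + 1) * (cmod a)\<^sup>2 + (1 + x) powr l * (cmod b)\<^sup>2)"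
proof -
  let ?P = "exp (root_p x * of_real t)" and ?M = "exp (root_m x * of_real t)"
  define y where "y = t / 10 / (1 + x)"
  define e where "e = exp (- y)"
  define q where "q = sqrt (1 + x)"
  have q: "q \<ge> 1" "q\<^sup>2 = 1 + x" using x by (auto simp: q_def)
  have Re: "Re (root_p x * of_real t) \<le> - y" "Re (root_m x * of_real t) \<le> - y"
    using mult_right_mono[OF Re_root_le(1), of x t] mult_right_mono[OF Re_root_le(2), of x t] t x by (auto simp: y_def)
  have e: "0 < e" by (simp add: e_def)
  have P: "cmod ?P \<le> e" "cmod ?M \<le> e" unfolding norm_exp_eq_Re e_def using Re by simp_all
  have "(1 / (1 + x))\<^sup>2 \<le> (1 / 2)\<^sup>2" using x by (intro power_mono frac_le) auto
  then have b: "(1 / (1 + x))\<^sup>2 \<le> 1 / 4" by (simp add: power2_eq_square)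
  have b0: "0 \<le> (1 / (1 + x))\<^sup>2" by simp
  \<comment> \<open>For \<open>x \<ge> 1\<close> the square of \<open>1 / (1 + x)\<close> is at most
    1/4, so \<open>4 * x\<close> dominates the discriminant.\<close>
  have "1 + x \<le> - disc x" "- disc x \<le> 4 * (1 + x)"
    unfolding disc_def using b b0 x by (simp_all add: algebra_simps)
  then have "1 + x \<le> \<bar>disc x\<bar>" "\<bar>disc x\<bar> \<le> 4 * (1 + x)"
    using x by - (linarith+)
  then have "q\<^sup>2 \<le> \<bar>disc x\<bar>" "\<bar>disc x\<bar> \<le> (2 * q)\<^sup>2"
    unfolding power_mult_distrib q(2) by auto
  then have D: "q \<le> cmod (root_diff x)" "cmod (root_diff x) \<le> 2 * q"
    unfolding norm_root_diff_sq[symmetric] using q(1) by (auto intro: power2_le_imp_le)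
  have S: "cmod ((?P - ?M) / root_diff x) \<le> 2 * e / q"
    unfolding norm_divide using norm_triangle_ineq4[of ?P ?M] P D q e by (intro frac_le) auto
  have rp: "cmod (root_p x) \<le> 2 * q" using norm_root_le_half(1)[of x] x D q by simp
  have "cmod U \<le> cmod (?P * a) + cmod ((b - root_p x * a) * ((?P - ?M) / root_diff x))"
    unfolding mode_representation[OF nz eq] by (rule norm_triangle_ineq)
  also have "\<dots> \<le> e * cmod a + (cmod b + 2 * q * cmod a) * (2 * e / q)"
  proof (intro add_mono)
    show "cmod (?P * a) \<le> e * cmod a" unfolding norm_mult by (intro mult_right_mono P) simp
    have "cmod (b - root_p x * a) \<le> cmod b + cmod (root_p x * a)" by (rule norm_triangle_ineq4)
    also have "\<dots> \<le> cmod b + 2 * q * cmod a" unfolding norm_mult by (intro add_left_mono mult_right_mono rp) simp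
    finally show "cmod ((b - root_p x * a) * ((?P - ?M) / root_diff x)) \<le> (cmod b + 2 * q * cmod a) * (2 * e / q)"
      unfolding norm_mult[of "b - root_p x * a"] using q by (intro mult_mono S) auto
  qed
  also have "\<dots> = e * (5 * cmod a + 2 * (cmod b / q))"
    using q by (simp add: field_simps)
  finally have "(cmod U)\<^sup>2 \<le> (e * (5 * cmod a + 2 * (cmod b / q)))\<^sup>2"
    by (intro power_mono) auto
  also have "\<dots> = e\<^sup>2 * (5 * cmod a + 2 * (cmod b / q))\<^sup>2" by (simp add: power_mult_distrib)
  also have "\<dots> \<le> e\<^sup>2 * (2 * (5 * cmod a)\<^sup>2 + 2 * (2 * (cmod b / q))\<^sup>2)"
    by (intro mult_left_mono sum_sq_le) auto
  also have "\<dots> \<le> e\<^sup>2 * (50 * ((cmod a)\<^sup>2 + (cmod b)\<^sup>2 / (1 + x)))"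
    using q x by (intro mult_left_mono) (auto simp: power_mult_distrib power_divide intro!: divide_right_mono)
  also have "\<dots> \<le> ((l + 1) powr (l + 1) * (5 powr (l + 1) * ((1 + x) powr (l + 1) * t powr (- (l + 1))))) * (50 * ((cmod a)\<^sup>2 + (cmod b)\<^sup>2 / (1 + x)))"
  proof (intro mult_right_mono)
    have "e\<^sup>2 = exp (- (2 * y))" by (simp add: e_def power2_eq_square flip: exp_add)
    also have "\<dots> \<le> (l + 1) powr (l + 1) * (2 * y) powr (- (l + 1))"
      using t l x by (intro exp_minus_le_powr) (auto simp: y_def)
    also have "2 * y = t / (5 * (1 + x))" using x by (simp add: y_def field_simps)
    also have "(t / (5 * (1 + x))) powr (- (l + 1)) = 5 powr (l + 1) * ((1 + x) powr (l + 1) * t powr (- (l + 1)))"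
      unfolding powr_minus using t x by (simp only: powr_divide powr_mult) (simp add: field_simps)
    finally show "e\<^sup>2 \<le> (l + 1) powr (l + 1) * (5 powr (l + 1) * ((1 + x) powr (l + 1) * t powr (- (l + 1))))" .
  qed (use x in auto)
  also have "\<dots> = 50 * ((l + 1) powr (l + 1) * 5 powr (l + 1)) * t powr (- (l + 1)) * ((1 + x) powr (l + 1) * (cmod a)\<^sup>2 + ((1 + x) powr (l + 1) / (1 + x)) * (cmod b)\<^sup>2)"
    by (simp add: algebra_simps)
  also have "(1 + x) powr (l + 1) / (1 + x) = (1 + x) powr l"
    using x by (simp add: powr_add)
  finally show ?thesis .
qed

lemma high_frequency:
  assumes l: "0 \<le> l"
  obtains C where "C > 0" "\<And>x t U a b. 1 / 10 \<le> x \<Longrightarrow> 1 \<le> t \<Longrightarrow> root_diff x \<noteq> 0 \<Longrightarrow>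
    root_diff x * U = exp (root_p x * of_real t) * (b - root_m x * a) - exp (root_m x * of_real t) * (b - root_p x * a) \<Longrightarrow>
    (cmod U)\<^sup>2 \<le> C * t powr (- (l + 1)) * ((1 + x) powr (l + 1) * (cmod a)\<^sup>2 + (1 + x) powr l * (cmod b)\<^sup>2)"
proof -
  define C1 where "C1 = 18 * ((l + 3) powr (l + 3) * 10 powr (l + 3))"
  define C2 where "C2 = 50 * ((l + 1) powr (l + 1) * 5 powr (l + 1))"
  have C: "C1 > 0" "C2 > 0" using l by (simp_all add: C1_def C2_def)
  show thesis
  proof (rule that[of "C1 + C2"])
    fix x t :: real and U a b :: complex
    assume x: "1 / 10 \<le> x" and t: "1 \<le> t" and h: "root_diff x \<noteq> 0"
      "root_diff x * U = exp (root_p x * of_real t) * (b - root_m x * a) - exp (root_m x * of_real t) * (b - root_p x * a)"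
    let ?W = "(1 + x) powr (l + 1) * (cmod a)\<^sup>2 + (1 + x) powr l * (cmod b)\<^sup>2"
    have W: "0 \<le> ?W" by simp
    have mono: "c * t powr (- (l + 1)) * ?W \<le> (C1 + C2) * t powr (- (l + 1)) * ?W" if "c \<le> C1 + C2" for c
      using that by (intro mult_right_mono W) auto
    show "(cmod U)\<^sup>2 \<le> (C1 + C2) * t powr (- (l + 1)) * ?W"
    proof (cases "x \<le> 1")
      case True
      have "1 * (cmod a)\<^sup>2 + 1 * (cmod b)\<^sup>2 \<le> ?W"
        using x l by (intro add_mono mult_right_mono ge_one_powr_ge_zero) auto
      then have "C1 * t powr (- (l + 1)) * ((cmod a)\<^sup>2 + (cmod b)\<^sup>2) \<le> C1 * t powr (- (l + 1)) * ?W"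
        using C by (intro mult_left_mono) auto
      with high_frequency_middle[OF x True t l h] mono[of C1] C show ?thesis unfolding C1_def[symmetric] by linarith
    next
      case False
      then show ?thesis using high_frequency_large[OF _ t l h] mono[of C2] C unfolding C2_def[symmetric] by linarith
    qed
  qed (use C in auto)
qed

section \<open>Low frequencies\<close>

text \<open>With \<open>b = 1 / (1 + x)\<close> everything follows from
  \<open>(b - D) * (b + D) = 4 * x\<close>. The bounds \<open>3/2 \<le> b + D \<le> 2 * b\<close>
  place \<open>b - D = - 2 * p\<close> between \<open>2 * x * (1 + x)\<close> and
  \<open>3 * x\<close>. So the slow root always lies below the exponent of the profile, and it
  remains to see that the gap is quadratic in \<open>x\<close>.\<close>

lemma low_frequency_roots:
  assumes x: "0 \<le> x" "x \<le> 1 / 10"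
  obtains D p m where "root_diff x = of_real D" "root_p x = of_real p" "root_m x = of_real m" "6 / 10 \<le> D"
    "\<bar>1 / D - 1\<bar> \<le> 10 * x" "\<bar>- m / D - 1\<bar> \<le> 10 * x" "p \<le> - (x * (1 + x))" "- (x * (1 + x)) - p \<le> 3 * x\<^sup>2" "m \<le> - (4 / 10)" "\<bar>p\<bar> \<le> 1"
proof -
  define b where "b = 1 / (1 + x)"
  have bx: "b * (1 + x) = 1" using x by (simp add: b_def)
  have b: "0 < b" "b \<le> 1" using inverse_1_plus[OF x(1)] by (auto simp: b_def)
  have b9: "9 / 10 \<le> b" using x by (simp add: b_def field_simps)
  have b1: "1 - b \<le> x"
  proof -
    have "1 - b = b * x" using bx by (simp add: algebra_simps)
    also have "\<dots> \<le> 1 * x" using b x by (intro mult_right_mono) auto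
    finally show ?thesis by simp
  qed
  \<comment> \<open>81/100 minus \<open>4 * x \<le> 40/100\<close> leaves at least 36/100, a perfect
    square convenient for the bound on \<open>D\<close>.\<close>
  have bsq: "(9 / 10)\<^sup>2 \<le> b\<^sup>2" using b9 by (intro power_mono) auto
  then have disc: "36 / 100 \<le> disc x" using x unfolding disc_def b_def[symmetric] by (simp add: power2_eq_square)
  define D where "D = sqrt (disc x)"
  have D2: "D\<^sup>2 = b\<^sup>2 - 4 * x" using disc unfolding D_def by (simp add: disc_def b_def)
  have rd: "root_diff x = of_real D"
  proof -
    have "max 0 (disc x) = disc x" "max 0 (- disc x) = 0" using disc by auto
    then show ?thesis unfolding root_diff_def D_def by simp
  qed
  have D6: "6 / 10 \<le> D"
    unfolding D_def by (rule real_le_rsqrt) (use disc in \<open>simp add: power2_eq_square\<close>)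
  have Db: "D \<le> b" by (rule power2_le_imp_le) (use D2 x b in auto)
  have prod: "(b - D) * (b + D) = 4 * x" using D2 by (simp add: power2_eq_square algebra_simps)
  have bD3: "b - D \<le> 3 * x"
  proof -
    have "(b - D) * (3 / 2) \<le> (b - D) * (b + D)" using b9 D6 Db by (intro mult_left_mono) auto
    then show ?thesis unfolding prod using x by simp
  qed
  have bDlow: "2 * x * (1 + x) \<le> b - D"
  proof -
    have "(b - D) * (b + D) \<le> (b - D) * (2 * b)" using Db by (intro mult_left_mono) auto
    then have "4 * x * (1 + x) \<le> (b - D) * (2 * b) * (1 + x)"
      unfolding prod using x by (intro mult_right_mono) auto
    also have "\<dots> = 2 * (b - D) * (b * (1 + x))" by (simp only: mult_ac)
    finally show ?thesis unfolding bx by simp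
  qed
  define p where "p = (- b + D) / 2"
  define m where "m = (- b - D) / 2"
  have rp: "root_p x = of_real p" "root_m x = of_real m"
    by (simp_all add: root_p_def root_m_def rd p_def m_def b_def)
  have D1: "1 - D \<le> 6 * x"
  proof -
    have "1 - D \<le> (1 - D) * (1 + D)" using D6 Db b by (simp add: mult_le_cancel_left1)
    also have "\<dots> = (1 - b) * (1 + b) + 4 * x" using D2 by (simp add: power2_eq_square algebra_simps)
    also have "(1 - b) * (1 + b) \<le> x * 2" using b b1 x by (intro mult_mono) auto
    finally show ?thesis by simp
  qed
  have D_le1: "D \<le> 1" using Db b by simp
  have "1 - D \<le> 10 * x * D"
  proof -
    have "10 * x * (6 / 10) \<le> 10 * x * D" using D6 x by (intro mult_left_mono) auto
    then show ?thesis using D1 by linarith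
  qed
  then have c1: "\<bar>1 / D - 1\<bar> \<le> 10 * x" using D6 D_le1 by (simp add: abs_le_iff field_simps)
  \<comment> \<open>The coefficient to be controlled is
    \<open>- m / D - 1 = (b - D) / (2 * D)\<close>.\<close>
  have "(b - D) / 2 \<le> 10 * x * D"
  proof -
    have "(b - D) / 2 \<le> 10 * x * (6 / 10)" using bD3 x by simp
    also have "\<dots> \<le> 10 * x * D" using D6 x by (intro mult_left_mono) auto
    finally show ?thesis .
  qed
  then have c2: "\<bar>- m / D - 1\<bar> \<le> 10 * x" using D6 Db x unfolding m_def by (simp add: abs_le_iff field_simps)
  have c3: "p \<le> - (x * (1 + x))" 
  proof -
    have "2 * (x * (1 + x)) \<le> b - D" using bDlow by (simp only: mult.assoc)
    then show ?thesis unfolding p_def by simp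
  qed
  have c4: "- (x * (1 + x)) - p \<le> 3 * x\<^sup>2"
  proof -
    \<comment> \<open>In terms of \<open>h\<close> the product relation reads
      \<open>h * b = 2 * x + h^2 / 2\<close>; as \<open>b * (1 + x) = 1\<close>, the deviation of
      \<open>h\<close> from \<open>2 * x * (1 + x)\<close> is of order \<open>h^2\<close>.\<close>
    define h where "h = b - D"
    have h: "0 \<le> h" "h \<le> 3 * x" "h * (2 * b - h) = 4 * x"
      using Db bD3 prod by (auto simp: h_def algebra_simps)
    have "b * (h - 2 * x * (1 + x)) = h * b - 2 * x * (b * (1 + x))" by (simp add: algebra_simps)
    also have "\<dots> = h\<^sup>2 / 2" unfolding bx using h(3) by (simp add: power2_eq_square algebra_simps)
    finally have eq: "b * (h - 2 * x * (1 + x)) = h\<^sup>2 / 2" .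
    have "h\<^sup>2 \<le> (3 * x)\<^sup>2" using h by (intro power_mono) auto
    then have "b * (h - 2 * x * (1 + x)) \<le> 9 / 2 * x\<^sup>2" using eq by (simp add: power_mult_distrib)
    moreover have "9 / 10 * (h - 2 * x * (1 + x)) \<le> b * (h - 2 * x * (1 + x))"
      using b9 bDlow by (intro mult_right_mono) (auto simp: h_def)
    ultimately have le: "9 / 10 * (h - 2 * x * (1 + x)) \<le> 9 / 2 * x\<^sup>2" by linarith
    have "H / 2 \<le> 3 * X" if "9 / 10 * H \<le> 9 / 2 * X" "0 \<le> X" for H X :: real using that by simp
    from this[OF le] have "(h - 2 * x * (1 + x)) / 2 \<le> 3 * x\<^sup>2" by simp
    moreover have "- (x * (1 + x)) - p = (h - 2 * x * (1 + x)) / 2" unfolding p_def h_def by (simp add: field_simps)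
    ultimately show ?thesis by simp
  qed
  have c5: "m \<le> - (4 / 10)" unfolding m_def using b9 D6 by simp
  have c6: "\<bar>p\<bar> \<le> 1" unfolding p_def using b D_le1 D6 by (simp add: abs_le_iff)
  show thesis by (rule that[OF rd rp D6 c1 c2 c3 c4 c5 c6])
qed

lemma exp_diff_le_real:
  fixes u v :: real
  assumes "u \<le> v"
  shows "\<bar>exp u - exp v\<bar> \<le> (v - u) * exp v"
proof -
  have "1 + (u - v) \<le> exp (u - v)" by (rule exp_ge_add_one_self)
  then have "exp v * (1 + (u - v)) \<le> exp v * exp (u - v)" by (intro mult_left_mono) auto
  also have "exp v * exp (u - v) = exp u" by (simp flip: exp_add)
  finally have "exp v - exp u \<le> (v - u) * exp v" by (simp add: algebra_simps)
  then show ?thesis using assms by simp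
qed

text \<open>Since \<open>1 / D\<close> and \<open>- m / D\<close> tend to 1, the slow mode carries
  the amplitude \<open>b + a\<close>, hence the profile \<open>P0 + P1\<close>. Three errors remain:
  amplitudes and data replaced by their values at frequency zero (\<open>11 * s\<close>), the
  exponent replaced by that of the profile (\<open>12 * s\<close>), and the fast mode, which decays
  exponentially in \<open>t\<close>.\<close>

lemma low_frequency:
  fixes a b U P0 P1 :: complex and s :: real
  assumes x: "0 \<le> x" "x \<le> 1 / 10" and s: "0 \<le> s" "s \<le> 1" "s\<^sup>2 / 2 \<le> x" "x \<le> s\<^sup>2" and t: "1 \<le> t"
    and a: "cmod a \<le> n0" "cmod (a - P0) \<le> s * n0" "cmod P0 \<le> n0"
    and b: "cmod b \<le> n1" "cmod (b - P1) \<le> s * n1" "cmod P1 \<le> n1"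
    and eq: "root_diff x * U = exp (root_p x * of_real t) * (b - root_m x * a) - exp (root_m x * of_real t) * (b - root_p x * a)"
  shows "cmod (U - of_real (exp (- t * x * (1 + x))) * (P0 + P1)) \<le> (n0 + n1) * (23 * s * exp (- (t * s\<^sup>2 / 4)) + 2 * exp (- (4 / 10 * t)))"
proof -
  obtain D p m where r: "root_diff x = of_real D" "root_p x = of_real p" "root_m x = of_real m" and D: "6 / 10 \<le> D"
    and c: "\<bar>1 / D - 1\<bar> \<le> 10 * x" "\<bar>- m / D - 1\<bar> \<le> 10 * x" "p \<le> - (x * (1 + x))" "- (x * (1 + x)) - p \<le> 3 * x\<^sup>2" "m \<le> - (4 / 10)" "\<bar>p\<bar> \<le> 1"
    using low_frequency_roots[OF x] by blast
  define N where "N = n0 + n1"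
  have n: "0 \<le> n0" "0 \<le> n1" using a(1) b(1) norm_ge_zero order_trans by blast+
  have N: "0 \<le> N" using n by (simp add: N_def)
  define E where "E = exp (- t * x * (1 + x))"
  \<comment> \<open>Half of the available decay: \<open>t * x * (1 + x)\<close> is at least
    \<open>2 * y\<close>. One factor \<open>exp (- y)\<close> survives in the result, the other
    absorbs a power of \<open>t\<close>.\<close>
  define y where "y = t * s\<^sup>2 / 4"
  have y: "0 \<le> y" using t by (simp add: y_def)
  have x_s: "x \<le> s" using s(4) mult_left_le[OF s(2) s(1)] by (simp add: power2_eq_square)
  have w: "- t * x * (1 + x) \<le> - (2 * y)"
  proof -
    have "s\<^sup>2 / 2 * 1 \<le> x * (1 + x)" using s x by (intro mult_mono) auto
    then have "t * (s\<^sup>2 / 2) \<le> t * (x * (1 + x))" using t by (intro mult_left_mono) auto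
    then show ?thesis by (simp add: y_def algebra_simps)
  qed
  have pw: "p * t \<le> - t * x * (1 + x)"
    using mult_right_mono[OF c(3), of t] t by (simp add: algebra_simps)
  have ep: "exp (p * t) \<le> exp (- y)" using w pw y by simp
  have em: "exp (m * t) \<le> exp (- (4 / 10 * t))"
    using mult_right_mono[OF c(5), of t] t by simp
  have ye: "y * exp (- y) \<le> 1"
  proof -
    have "y \<le> exp y" using exp_ge_add_one_self[of y] by linarith
    then show ?thesis by (simp add: exp_minus field_simps)
  qed
  \<comment> \<open>The amplitude error of the slow mode: each summand is a deviation from the limit
    at frequency zero and is of order \<open>s\<close>.\<close>
  define Q where "Q = of_real (1 / D - 1) * b + of_real (- m / D - 1) * a + (a - P0) + (b - P1)"
  have "of_real D * U = of_real (exp (p * t)) * (b - of_real m * a) - of_real (exp (m * t)) * (b - of_real p * a)"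
    using eq unfolding r by (simp add: exp_of_real[symmetric])
  then have "U = (of_real (exp (p * t)) * (b - of_real m * a) - of_real (exp (m * t)) * (b - of_real p * a)) / of_real D"
    using D by (simp add: eq_divide_eq mult.commute)
  moreover have "(P * (b - w * a) - M * (b - v * a)) / d - E * (P0 + P1)
      = P * ((1 / d - 1) * b + (- w / d - 1) * a + (a - P0) + (b - P1)) + (P - E) * (P0 + P1) - M / d * (b - v * a)"
    if "d \<noteq> 0" for P M E w v d :: complex
    using that by (simp add: field_simps)
  ultimately have split: "U - of_real E * (P0 + P1) = of_real (exp (p * t)) * Q + of_real (exp (p * t) - E) * (P0 + P1)
      - of_real (exp (m * t) / D) * (b - of_real p * a)"
    unfolding Q_def using D by simp
  have Q: "cmod Q \<le> 11 * s * N"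
  proof -
    have "cmod Q \<le> cmod (of_real (1 / D - 1) * b) + cmod (of_real (- m / D - 1) * a) + cmod (a - P0) + cmod (b - P1)"
      unfolding Q_def by (intro norm_triangle_le add_right_mono norm_triangle_ineq)
    also have "\<dots> \<le> 10 * s * n1 + 10 * s * n0 + s * n0 + s * n1"
      unfolding norm_mult norm_of_real using c(1,2) x_s s n a b by (intro add_mono mult_mono) auto
    also have "\<dots> = 11 * s * N" by (simp add: N_def algebra_simps)
    finally show ?thesis .
  qed
  have P: "cmod (P0 + P1) \<le> N" unfolding N_def using a(3) b(3) norm_triangle_le by (meson add_mono norm_triangle_mono)
  have T1: "cmod (of_real (exp (p * t)) * Q) \<le> exp (- y) * (11 * s * N)"
    unfolding norm_mult using ep Q by (intro mult_mono) auto
  have E2: "\<bar>exp (p * t) - E\<bar> \<le> 12 * s * exp (- y)"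
  proof -
    have "\<bar>exp (p * t) - E\<bar> \<le> (- t * x * (1 + x) - p * t) * E"
      unfolding E_def by (rule exp_diff_le_real[OF pw])
    also have "- t * x * (1 + x) - p * t = t * (- (x * (1 + x)) - p)" by (simp add: algebra_simps)
    also have "t * (- (x * (1 + x)) - p) * E \<le> (t * (3 * x\<^sup>2)) * exp (- (2 * y))"
      using c(3,4) t w unfolding E_def by (intro mult_mono) auto
    also have "\<dots> \<le> (t * (3 * (s\<^sup>2 * s\<^sup>2))) * exp (- (2 * y))"
      using s x t unfolding power2_eq_square[of x] by (intro mult_right_mono mult_left_mono mult_mono) auto
    \<comment> \<open>The gap between the exponents contributes
      \<open>3 * t * s^4 = 12 * s^2 * y\<close>, and \<open>y * exp (- y) \<le> 1\<close> removes
      the factor \<open>t\<close>.\<close>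
    also have "\<dots> = (12 * s\<^sup>2 * exp (- y)) * (y * exp (- y))"
      by (simp add: y_def mult_exp_exp)
    also have "\<dots> \<le> (12 * s\<^sup>2 * exp (- y)) * 1"
      using ye by (intro mult_left_mono) auto
    also have "\<dots> \<le> 12 * s * exp (- y)"
    proof -
      have "s\<^sup>2 \<le> s" using mult_left_le[OF s(2) s(1)] by (simp add: power2_eq_square)
      then have "12 * s\<^sup>2 * exp (- y) \<le> 12 * s * exp (- y)" by (intro mult_right_mono) auto
      then show ?thesis by simp
    qed
    finally show ?thesis .
  qed
  have T2: "cmod (of_real (exp (p * t) - E) * (P0 + P1)) \<le> (12 * s * exp (- y)) * N"
    unfolding norm_mult norm_of_real using E2 P s by (intro mult_mono) auto
  have T3: "cmod (of_real (exp (m * t) / D) * (b - of_real p * a)) \<le> (2 * exp (- (4 / 10 * t))) * N"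
  proof -
    have "exp (m * t) / D \<le> exp (- (4 / 10 * t)) / (6 / 10)" using em D by (intro frac_le) auto
    also have "\<dots> \<le> 2 * exp (- (4 / 10 * t))" by simp
    finally have "\<bar>exp (m * t) / D\<bar> \<le> 2 * exp (- (4 / 10 * t))" using D by simp
    moreover have "cmod (b - of_real p * a) \<le> N"
    proof -
      have "cmod (b - of_real p * a) \<le> cmod b + \<bar>p\<bar> * cmod a"
        using norm_triangle_ineq4[of b "of_real p * a"] by (simp add: norm_mult)
      also have "\<dots> \<le> n1 + 1 * n0" using a b c(6) n by (intro add_mono mult_mono) auto
      finally show ?thesis by (simp add: N_def)
    qed
    ultimately show ?thesis unfolding norm_mult norm_of_real by (intro mult_mono) auto
  qed
  have "cmod (U - of_real E * (P0 + P1)) \<le> exp (- y) * (11 * s * N) + (12 * s * exp (- y)) * N + (2 * exp (- (4 / 10 * t))) * N"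
    unfolding split by (rule order_trans[OF norm_triangle_ineq4] add_mono order_trans[OF norm_triangle_ineq] T1 T2 T3)+
  also have "\<dots> = N * (23 * s * exp (- y) + 2 * exp (- (4 / 10 * t)))" by (simp add: algebra_simps)
  finally show ?thesis unfolding E_def N_def y_def by simp
qed

section \<open>Integrals of the error terms and behaviour near frequency zero\<close>

lemma lebesgue_integrable_lborel:
  fixes f :: "'a::euclidean_space \<Rightarrow> real"
  assumes "integrable lborel f"
  shows "integrable lebesgue f" "(\<integral>x. f x \<partial>lebesgue) = (\<integral>x. f x \<partial>lborel)"
proof -
  have "f \<in> borel_measurable lborel" using assms by auto
  then show "integrable lebesgue f" "(\<integral>x. f x \<partial>lebesgue) = (\<integral>x. f x \<partial>lborel)"
    using integrable_completion[of f lborel] integral_completion[of f lborel] assms by auto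
qed

text \<open>Each coordinate is bounded by the norm, so one factor of the power can be compared with
  each one-dimensional density \<open>inverse (1 + x^2)\<close>; the product of these is
  integrable.\<close>

lemma integrable_inverse_bracket:
  "integrable lebesgue (\<lambda>\<xi>::'a::euclidean_space. inverse ((1 + (norm \<xi>)\<^sup>2) ^ DIM('a)))"
proof (rule lebesgue_integrable_lborel(1))
  have "integrable lborel (\<lambda>x::real. inverse (1 + x\<^sup>2))"
    using integrable_inverse_1_plus_square by (simp add: set_integrable_def)
  then have "integrable lborel (\<lambda>x::real. complex_of_real (inverse (1 + x\<^sup>2)))"
    by (rule integrable_of_real)
  then have "integrable lborel (\<lambda>\<xi>::'a. \<Prod>b\<in>Basis. complex_of_real (inverse (1 + (\<xi> \<bullet> b)\<^sup>2)))"
    using has_bochner_integral_lborel_prod[of "\<lambda>_ x. complex_of_real (inverse (1 + x\<^sup>2))"] by (auto simp: has_bochner_integral_iff)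
  then show "integrable lborel (\<lambda>\<xi>::'a. inverse ((1 + (norm \<xi>)\<^sup>2) ^ DIM('a)))"
  proof (rule Bochner_Integration.integrable_bound)
    show "AE \<xi> in lborel. norm (inverse ((1 + (norm (\<xi>::'a))\<^sup>2) ^ DIM('a))) \<le> norm (\<Prod>b\<in>Basis. complex_of_real (inverse (1 + (\<xi> \<bullet> b)\<^sup>2)))"
    proof (intro AE_I2)
      fix \<xi> :: 'a
      have "inverse ((1 + (norm \<xi>)\<^sup>2) ^ DIM('a)) = (\<Prod>b\<in>(Basis::'a set). inverse (1 + (norm \<xi>)\<^sup>2))"
        by (simp add: power_inverse)
      also have "\<dots> \<le> (\<Prod>b\<in>Basis. inverse (1 + (\<xi> \<bullet> b)\<^sup>2))"
      proof (intro prod_mono conjI le_imp_inverse_le add_left_mono)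
        fix b :: 'a assume "b \<in> Basis"
        then have "\<bar>\<xi> \<bullet> b\<bar> \<le> norm \<xi>" by (rule Basis_le_norm)
        then show "(\<xi> \<bullet> b)\<^sup>2 \<le> (norm \<xi>)\<^sup>2" by (metis abs_ge_zero power2_abs power_mono)
      qed (auto simp: add_pos_nonneg)
      also have "\<dots> = norm (\<Prod>b\<in>Basis. complex_of_real (inverse (1 + (\<xi> \<bullet> b)\<^sup>2)))"
        unfolding prod_norm[symmetric] norm_of_real by (intro prod.cong refl) simp
      finally show "norm (inverse ((1 + (norm \<xi>)\<^sup>2) ^ DIM('a))) \<le> norm (\<Prod>b\<in>Basis. complex_of_real (inverse (1 + (\<xi> \<bullet> b)\<^sup>2)))"
        by simp
    qed
  qed measurable
qed

text \<open>Scaling the frequency by \<open>sqrt t\<close> gives \<open>n/2\<close> powers from the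
  volume and one from the square of the norm. The square root of this is the rate
  \<open>(n + 2) / 4\<close> of the theorem.\<close>

lemma square_gauss_integral:
  assumes t: "t > 0"
  shows "integrable lebesgue (\<lambda>\<xi>::'a::euclidean_space. (norm \<xi>)\<^sup>2 * exp (- (t * (norm \<xi>)\<^sup>2 / 2)))"
    and "(\<integral>\<xi>. (norm (\<xi>::'a))\<^sup>2 * exp (- (t * (norm \<xi>)\<^sup>2 / 2)) \<partial>lebesgue)
      = t powr (- ((real DIM('a) + 2) / 2)) * (\<integral>\<xi>. (norm (\<xi>::'a))\<^sup>2 * gauss \<xi> \<partial>lborel)"
proof -
  let ?G = "\<lambda>\<xi>::'a. (norm \<xi>)\<^sup>2 * gauss \<xi>"
  have G: "integrable lborel ?G"
  proof (rule Bochner_Integration.integrable_bound)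
    show "integrable lborel (\<lambda>\<xi>::'a. 4 * gauss ((1 / sqrt 2) *\<^sub>R \<xi>))"
      using gauss_scale_integrable[of "1 / sqrt 2", where 'a='a] by simp
    show "AE \<xi> in lborel. norm ((norm \<xi>)\<^sup>2 * gauss \<xi>) \<le> norm (4 * gauss ((1 / sqrt 2) *\<^sub>R (\<xi>::'a)))"
    proof (intro AE_I2)
      fix \<xi> :: 'a
      \<comment> \<open>Half of the Gaussian exponent absorbs the quadratic factor through
        \<open>z * exp (- z) \<le> 1\<close>; the other half is a wider, integrable
        Gaussian.\<close>
      define z where "z = (norm \<xi>)\<^sup>2 / 4"
      have z: "z * exp (- z) \<le> 1"
      proof -
        have "z \<le> exp z" using exp_ge_add_one_self[of z] by linarith
        then show ?thesis by (simp add: exp_minus field_simps)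
      qed
      have g1: "gauss \<xi> = exp (- z) * exp (- z)" by (simp add: gauss_def z_def mult_exp_exp)
      have g2: "gauss ((1 / sqrt 2) *\<^sub>R \<xi>) = exp (- z)" by (simp add: gauss_def z_def power_divide)
      have "(norm \<xi>)\<^sup>2 * gauss \<xi> = 4 * exp (- z) * (z * exp (- z))" unfolding g1 by (simp add: z_def)
      also have "\<dots> \<le> 4 * exp (- z) * 1" using z by (intro mult_left_mono) auto
      finally show "norm ((norm \<xi>)\<^sup>2 * gauss \<xi>) \<le> norm (4 * gauss ((1 / sqrt 2) *\<^sub>R \<xi>))"
        unfolding g2 by (simp add: abs_mult)
    qed
  qed measurable
  define c where "c = sqrt t"
  have c: "c > 0" "c\<^sup>2 = t" using t by (auto simp: c_def)
  have eq: "(norm \<xi>)\<^sup>2 * exp (- (t * (norm \<xi>)\<^sup>2 / 2)) = ?G (0 + c *\<^sub>R \<xi>) / t" for \<xi> :: 'a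
    using t by (simp add: gauss_def power_mult_distrib c)
  have Gm: "?G \<in> borel_measurable borel" by measurable
  have int: "integrable lborel (\<lambda>\<xi>::'a. (norm \<xi>)\<^sup>2 * exp (- (t * (norm \<xi>)\<^sup>2 / 2)))"
    unfolding eq using lborel_integral_affine(2)[OF Gm c(1), of 0] G by simp
  have "c ^ DIM('a) = t powr (real DIM('a) / 2)"
    using t by (simp add: c_def powr_half_sqrt[symmetric] powr_powr flip: powr_realpow)
  have "(\<integral>\<xi>. (norm (\<xi>::'a))\<^sup>2 * exp (- (t * (norm \<xi>)\<^sup>2 / 2)) \<partial>lborel) = (\<integral>\<xi>. ?G (0 + c *\<^sub>R \<xi>) \<partial>lborel) / t"
    unfolding eq by simp
  also have "(\<integral>\<xi>. ?G (0 + c *\<^sub>R \<xi>) \<partial>lborel) = (\<integral>\<xi>. ?G \<xi> \<partial>lborel) / c ^ DIM('a)"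
    using lborel_integral_affine(1)[OF Gm c(1), of 0] c by simp
  also have "(\<integral>\<xi>. ?G \<xi> \<partial>lborel) / c ^ DIM('a) / t = t powr (- ((real DIM('a) + 2) / 2)) * (\<integral>\<xi>. ?G \<xi> \<partial>lborel)"
  proof -
    have "c ^ DIM('a) * t = t powr (real DIM('a) / 2) * t powr 1"
      unfolding \<open>c ^ DIM('a) = _\<close> using t by simp
    also have "\<dots> = t powr ((real DIM('a) + 2) / 2)" unfolding powr_add[symmetric] by (simp add: add_divide_distrib)
    finally have "c ^ DIM('a) * t = t powr ((real DIM('a) + 2) / 2)" .
    then show ?thesis
      by (simp only: divide_divide_eq_left) (simp only: powr_minus divide_inverse mult.commute)
  qed
  finally show "(\<integral>\<xi>. (norm (\<xi>::'a))\<^sup>2 * exp (- (t * (norm \<xi>)\<^sup>2 / 2)) \<partial>lebesgue)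
      = t powr (- ((real DIM('a) + 2) / 2)) * (\<integral>\<xi>. (norm (\<xi>::'a))\<^sup>2 * gauss \<xi> \<partial>lborel)"
    using lebesgue_integrable_lborel(2)[OF int] by simp
  show "integrable lebesgue (\<lambda>\<xi>::'a. (norm \<xi>)\<^sup>2 * exp (- (t * (norm \<xi>)\<^sup>2 / 2)))"
    by (rule lebesgue_integrable_lborel(1)[OF int])
qed

lemma exp_decay_le_powr:
  fixes c p :: real
  assumes c: "0 < c" and p: "0 < p"
  obtains K where "0 < K" "\<And>t. 1 \<le> t \<Longrightarrow> exp (- (c * t)) \<le> K * t powr (- p)"
proof (rule that[of "p powr p * c powr (- p)"])
  fix t :: real assume t: "1 \<le> t"
  have "exp (- (c * t)) \<le> p powr p * (c * t) powr (- p)" using c p t by (intro exp_minus_le_powr) auto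
  also have "(c * t) powr (- p) = c powr (- p) * t powr (- p)" using c t by (simp add: powr_mult)
  finally show "exp (- (c * t)) \<le> p powr p * c powr (- p) * t powr (- p)" by (simp add: mult.assoc)
qed (use c p in auto)

text \<open>The integral of \<open>f\<close> is the transform at frequency zero. The first moment
  contained in \<open>L11_norm\<close> makes the transform Lipschitz there, because the phase
  differs from 1 by at most \<open>norm x * norm \<xi>\<close>.\<close>

lemma fourier_L1_bounds:
  fixes f :: "real^'n \<Rightarrow> complex"
  assumes f: "f \<in> L11_space"
  shows "cmod (fourier_L1 f \<xi>) \<le> L11_norm f"
    and "cmod (fourier_L1 f \<xi> - (\<integral>x. f x \<partial>lebesgue)) \<le> norm \<xi> * L11_norm f"
    and "cmod (\<integral>x. f x \<partial>lebesgue) \<le> L11_norm f"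
proof -
  have fi: "integrable lebesgue f" and fw: "integrable lebesgue (\<lambda>x. (1 + norm x) * cmod (f x))"
    using f by (auto simp: L11_space_def)
  have le: "(\<integral>x. cmod (f x) \<partial>lebesgue) \<le> L11_norm f"
    unfolding L11_norm_def by (intro integral_mono fw integrable_norm[OF fi]) (auto simp: distrib_right)
  show "cmod (\<integral>x. f x \<partial>lebesgue) \<le> L11_norm f"
    by (rule order_trans[OF integral_norm_bound le])
  have "cmod (fourier_L1 f \<xi>) \<le> (\<integral>x. cmod (exp (- \<i> * of_real (x \<bullet> \<xi>)) * f x) \<partial>lebesgue)"
    unfolding fourier_L1_def by (rule integral_norm_bound)
  also have "\<dots> = (\<integral>x. cmod (f x) \<partial>lebesgue)" by (simp add: norm_mult)
  finally show "cmod (fourier_L1 f \<xi>) \<le> L11_norm f" using le by simp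
  have int: "integrable lebesgue (\<lambda>x. exp (- \<i> * of_real (x \<bullet> \<xi>)) * f x)" by (rule fourier_L1_integrable[OF fi])
  have "fourier_L1 f \<xi> - (\<integral>x. f x \<partial>lebesgue) = (\<integral>x. exp (- \<i> * of_real (x \<bullet> \<xi>)) * f x - f x \<partial>lebesgue)"
    unfolding fourier_L1_def by (rule Bochner_Integration.integral_diff[symmetric, OF int fi])
  also have "cmod \<dots> \<le> (\<integral>x. cmod (exp (- \<i> * of_real (x \<bullet> \<xi>)) * f x - f x) \<partial>lebesgue)"
    by (rule integral_norm_bound)
  also have "\<dots> \<le> (\<integral>x. norm \<xi> * ((1 + norm x) * cmod (f x)) \<partial>lebesgue)"
  proof (intro integral_mono integrable_norm integrable_mult_right fw Bochner_Integration.integrable_diff int fi)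
    fix x :: "real^'n"
    have "cmod (exp (- \<i> * of_real (x \<bullet> \<xi>)) * f x - f x) = cmod (exp (- \<i> * of_real (x \<bullet> \<xi>)) - exp 0) * cmod (f x)"
      by (simp add: left_diff_distrib flip: norm_mult)
    also have "cmod (exp (- \<i> * of_real (x \<bullet> \<xi>)) - exp 0) \<le> exp 0 * cmod (- \<i> * of_real (x \<bullet> \<xi>) - 0)"
      by (rule norm_exp_diff_le) auto
    also have "\<dots> = \<bar>x \<bullet> \<xi>\<bar>" by (simp add: norm_mult)
    also have "\<dots> \<le> norm x * norm \<xi>" by (rule Cauchy_Schwarz_ineq2)
    also have "\<dots> \<le> norm \<xi> * (1 + norm x)" by (simp add: algebra_simps)
    finally show "cmod (exp (- \<i> * of_real (x \<bullet> \<xi>)) * f x - f x) \<le> norm \<xi> * ((1 + norm x) * cmod (f x))"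
      by (simp add: mult_right_mono mult.assoc)
  qed
  also have "\<dots> = norm \<xi> * L11_norm f" by (simp add: L11_norm_def)
  finally show "cmod (fourier_L1 f \<xi> - (\<integral>x. f x \<partial>lebesgue)) \<le> norm \<xi> * L11_norm f" .
qed

lemma exp_log_symbol: "exp (log_symbol \<xi>) = 1 + (norm \<xi>)\<^sup>2"
  unfolding log_symbol_def by (subst exp_ln) (auto simp: add_pos_nonneg)

text \<open>The bound \<open>exp (1/10) \<le> 1.11\<close> puts the squared norm below 1/2, where
  \<open>ln (1 + y)\<close> lies between \<open>y - y^2\<close> and \<open>y\<close>. This turns
  decay in the symbol into Gaussian decay in the frequency.\<close>

lemma log_symbol_small:
  assumes "log_symbol \<xi> \<le> 1 / 10"
  shows "norm \<xi> \<le> 1" "(norm \<xi>)\<^sup>2 / 2 \<le> log_symbol \<xi>" "log_symbol \<xi> \<le> (norm \<xi>)\<^sup>2"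
proof -
  have "exp (log_symbol \<xi>) \<le> exp (1 / 10)" using assms by simp
  also have "\<dots> \<le> 1 + 1 / 10 + (1 / 10)\<^sup>2" by (rule exp_bound) auto
  finally have s: "(norm \<xi>)\<^sup>2 \<le> 1 / 2" unfolding exp_log_symbol by (simp add: power2_eq_square)
  then have "(norm \<xi>)\<^sup>2 \<le> 1\<^sup>2" by simp
  then show "norm \<xi> \<le> 1" by (rule power2_le_imp_le) simp
  have "(norm \<xi>)\<^sup>2 - ((norm \<xi>)\<^sup>2)\<^sup>2 \<le> log_symbol \<xi>"
    unfolding log_symbol_def using s by (intro ln_one_plus_pos_lower_bound) auto
  moreover have "((norm \<xi>)\<^sup>2)\<^sup>2 \<le> (norm \<xi>)\<^sup>2 * (1 / 2)"
    unfolding power2_eq_square[of "(norm \<xi>)\<^sup>2"] by (intro mult_left_mono s) simp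
  ultimately show "(norm \<xi>)\<^sup>2 / 2 \<le> log_symbol \<xi>" by linarith
  show "log_symbol \<xi> \<le> (norm \<xi>)\<^sup>2"
    unfolding log_symbol_def by (rule ln_add_one_self_le_self) simp
qed

section \<open>The asymptotic profile\<close>

lemma L11_norm_nonneg [simp]: "0 \<le> L11_norm f"
  unfolding L11_norm_def by (intro Bochner_Integration.integral_nonneg) auto

lemma Y_norm_sq: "(Y_norm \<delta> f)\<^sup>2 = (\<integral>\<xi>. (1 + log_symbol \<xi>) powr \<delta> * (cmod (fourier_L2 f \<xi>))\<^sup>2 \<partial>lebesgue)"
  unfolding Y_norm_def by (rule real_sqrt_pow2) (intro Bochner_Integration.integral_nonneg, auto)

lemma phi1_bound:
  fixes u0 u1 :: "real^'n \<Rightarrow> complex"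
  assumes u0: "u0 \<in> L11_space" and u1: "u1 \<in> L11_space" and t: "real CARD('n) / 2 \<le> t"
  shows "(cmod (phi1 u0 u1 t \<xi>))\<^sup>2 \<le> (L11_norm u0 + L11_norm u1)\<^sup>2 *
    (exp (- (2 * (t - real CARD('n) / 2) * log_symbol \<xi>)) * inverse ((1 + (norm \<xi>)\<^sup>2) ^ CARD('n)))"
proof -
  let ?x = "log_symbol \<xi>" and ?N = "L11_norm u0 + L11_norm u1"
  have x: "0 \<le> ?x" by simp
  have t0: "0 \<le> t" using t by (meson divide_nonneg_nonneg of_nat_0_le_iff order_trans zero_le_numeral)
  have "cmod (phi1 u0 u1 t \<xi>) \<le> exp (- t * ?x * (1 + ?x)) * ?N"
    unfolding phi1_def norm_mult using norm_triangle_mono[OF fourier_L1_bounds(3)[OF u0] fourier_L1_bounds(3)[OF u1]] by simp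
  also have "\<dots> \<le> exp (- (t * ?x)) * ?N"
  proof (intro mult_right_mono)
    have "t * ?x * 1 \<le> t * ?x * (1 + ?x)" using t0 x by (intro mult_left_mono) auto
    then show "exp (- t * ?x * (1 + ?x)) \<le> exp (- (t * ?x))" by simp
  qed simp
  finally have "(cmod (phi1 u0 u1 t \<xi>))\<^sup>2 \<le> (exp (- (t * ?x)) * ?N)\<^sup>2"
    by (intro power_mono) auto
  also have "\<dots> = ?N\<^sup>2 * exp (- (2 * t * ?x))"
    by (simp add: power_mult_distrib mult.commute flip: exp_double)
  also have "exp (- (2 * t * ?x)) = exp (- (2 * (t - real CARD('n) / 2) * ?x)) * inverse (exp (real CARD('n) * ?x))"
    unfolding exp_minus[symmetric] exp_add[symmetric] by (simp add: algebra_simps)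
  also have "exp (real CARD('n) * ?x) = (1 + (norm \<xi>)\<^sup>2) ^ CARD('n)"
    by (simp add: exp_of_nat_mult exp_log_symbol)
  finally show ?thesis .
qed

lemma phi1_L2:
  fixes u0 u1 :: "real^'n \<Rightarrow> complex"
  assumes u0: "u0 \<in> L11_space" and u1: "u1 \<in> L11_space" and t: "real CARD('n) / 2 \<le> t"
  shows "phi1 u0 u1 t \<in> L2_space"
proof (rule L2_spaceI)
  show m [measurable]: "phi1 u0 u1 t \<in> borel_measurable lebesgue"
    unfolding phi1_def[abs_def] by measurable
  have "integrable lebesgue (\<lambda>\<xi>::real^'n. (L11_norm u0 + L11_norm u1)\<^sup>2 * inverse ((1 + (norm \<xi>)\<^sup>2) ^ CARD('n)))"
    using integrable_inverse_bracket[where 'a="real^'n"] by simp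
  then show "integrable lebesgue (\<lambda>\<xi>. (cmod (phi1 u0 u1 t \<xi>))\<^sup>2)"
  proof (rule Bochner_Integration.integrable_bound)
    show "AE \<xi> in lebesgue. norm ((cmod (phi1 u0 u1 t \<xi>))\<^sup>2) \<le> norm ((L11_norm u0 + L11_norm u1)\<^sup>2 * inverse ((1 + (norm \<xi>)\<^sup>2) ^ CARD('n)))"
    proof (intro AE_I2)
      fix \<xi> :: "real^'n"
      have "exp (- (2 * (t - real CARD('n) / 2) * log_symbol \<xi>)) \<le> 1" using t by simp
      then have "exp (- (2 * (t - real CARD('n) / 2) * log_symbol \<xi>)) * inverse ((1 + (norm \<xi>)\<^sup>2) ^ CARD('n)) \<le> 1 * inverse ((1 + (norm \<xi>)\<^sup>2) ^ CARD('n))"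
        by (intro mult_right_mono) auto
      then have "(cmod (phi1 u0 u1 t \<xi>))\<^sup>2 \<le> (L11_norm u0 + L11_norm u1)\<^sup>2 * (1 * inverse ((1 + (norm \<xi>)\<^sup>2) ^ CARD('n)))"
        by (intro order_trans[OF phi1_bound[OF u0 u1 t]] mult_left_mono) auto
      then show "norm ((cmod (phi1 u0 u1 t \<xi>))\<^sup>2) \<le> norm ((L11_norm u0 + L11_norm u1)\<^sup>2 * inverse ((1 + (norm \<xi>)\<^sup>2) ^ CARD('n)))"
        by simp
    qed
  qed measurable
qed

text \<open>The constants are \<open>1058 = 2 * 23^2\<close> and \<open>8 = 2 * 2^2\<close>, from
  squaring the low-frequency bound. The low frequencies lie in the unit ball, so the fast mode may
  carry its indicator; without it that term would not be integrable.\<close>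

lemma fourier_error_pointwise:
  fixes l :: real
  assumes l: "0 \<le> l"
  obtains C where "C > 0" "\<And>(u0 :: real^'n \<Rightarrow> complex) u1 u t. u0 \<in> L11_space \<inter> L2_space \<Longrightarrow> u1 \<in> L11_space \<inter> L2_space \<Longrightarrow>
    is_solution u0 u1 u \<Longrightarrow> real CARD('n) / 2 + 1 \<le> t \<Longrightarrow>
    AE \<xi> in lebesgue. (cmod (fourier_L2 (u t) \<xi> - phi1 u0 u1 t \<xi>))\<^sup>2 \<le>
      (L11_norm u0 + L11_norm u1)\<^sup>2 * (1058 * ((norm \<xi>)\<^sup>2 * exp (- (t * (norm \<xi>)\<^sup>2 / 2))) + 8 * exp (- (8 / 10 * t)) * indicator (cball 0 1) \<xi>
        + 2 * exp (- ((t - real CARD('n) / 2) / 5)) * inverse ((1 + (norm \<xi>)\<^sup>2) ^ CARD('n)))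
      + C * t powr (- (l + 1)) * ((1 + log_symbol \<xi>) powr (l + 1) * (cmod (fourier_L2 u0 \<xi>))\<^sup>2 + (1 + log_symbol \<xi>) powr l * (cmod (fourier_L2 u1 \<xi>))\<^sup>2)"
proof -
  obtain C where C: "C > 0" "\<And>x t U a b. 1 / 10 \<le> x \<Longrightarrow> 1 \<le> t \<Longrightarrow> root_diff x \<noteq> 0 \<Longrightarrow>
    root_diff x * U = exp (root_p x * of_real t) * (b - root_m x * a) - exp (root_m x * of_real t) * (b - root_p x * a) \<Longrightarrow>
    (cmod U)\<^sup>2 \<le> C * t powr (- (l + 1)) * ((1 + x) powr (l + 1) * (cmod a)\<^sup>2 + (1 + x) powr l * (cmod b)\<^sup>2)"
    using high_frequency[OF l] by blast
  show thesis
  \<comment> \<open>At high frequency solution and profile are estimated separately, and the square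
    of a difference costs a factor 2.\<close>
  proof (rule that[of "2 * C"])
    fix u0 u1 :: "real^'n \<Rightarrow> complex" and u :: "real \<Rightarrow> real^'n \<Rightarrow> complex" and t :: real
    assume u0: "u0 \<in> L11_space \<inter> L2_space" and u1: "u1 \<in> L11_space \<inter> L2_space"
      and sol: "is_solution u0 u1 u" and t: "real CARD('n) / 2 + 1 \<le> t"
    have t1: "1 \<le> t" "real CARD('n) / 2 \<le> t" using t by (smt (verit) divide_nonneg_nonneg of_nat_0_le_iff)+
    let ?N = "L11_norm u0 + L11_norm u1"
    let ?J = "\<lambda>\<xi>::real^'n. inverse ((1 + (norm \<xi>)\<^sup>2) ^ CARD('n))"
    have F0: "AE \<xi> in lebesgue. fourier_L2 u0 \<xi> = fourier_L1 u0 \<xi>" and F1: "AE \<xi> in lebesgue. fourier_L2 u1 \<xi> = fourier_L1 u1 \<xi>"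
      using u0 u1 by (auto intro!: fourier_L2_eq_fourier_L1 simp: L11_space_def)
    have "AE \<xi> in lebesgue. root_diff (log_symbol \<xi>) \<noteq> 0 \<and>
      root_diff (log_symbol \<xi>) * fourier_L2 (u t) \<xi> =
        exp (root_p (log_symbol \<xi>) * of_real t) * (fourier_L2 u1 \<xi> - root_m (log_symbol \<xi>) * fourier_L2 u0 \<xi>)
        - exp (root_m (log_symbol \<xi>) * of_real t) * (fourier_L2 u1 \<xi> - root_p (log_symbol \<xi>) * fourier_L2 u0 \<xi>)"
      using u0 u1 t1 by (intro solution_formula[OF sol]) auto
    with F0 F1 show "AE \<xi> in lebesgue. (cmod (fourier_L2 (u t) \<xi> - phi1 u0 u1 t \<xi>))\<^sup>2 \<le>
      ?N\<^sup>2 * (1058 * ((norm \<xi>)\<^sup>2 * exp (- (t * (norm \<xi>)\<^sup>2 / 2))) + 8 * exp (- (8 / 10 * t)) * indicator (cball 0 1) \<xi>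
        + 2 * exp (- ((t - real CARD('n) / 2) / 5)) * ?J \<xi>)
      + 2 * C * t powr (- (l + 1)) * ((1 + log_symbol \<xi>) powr (l + 1) * (cmod (fourier_L2 u0 \<xi>))\<^sup>2 + (1 + log_symbol \<xi>) powr l * (cmod (fourier_L2 u1 \<xi>))\<^sup>2)"
    proof eventually_elim
      case (elim \<xi>)
      let ?x = "log_symbol \<xi>" and ?s = "norm \<xi>" and ?U = "fourier_L2 (u t) \<xi>" and ?a = "fourier_L2 u0 \<xi>" and ?b = "fourier_L2 u1 \<xi>"
      define B where "B = (1 + ?x) powr (l + 1) * (cmod ?a)\<^sup>2 + (1 + ?x) powr l * (cmod ?b)\<^sup>2"
      define A1 where "A1 = 1058 * (?s\<^sup>2 * exp (- (t * ?s\<^sup>2 / 2)))"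
      define A2 where "A2 = 8 * exp (- (8 / 10 * t)) * indicator (cball 0 1) \<xi>"
      define A3 where "A3 = 2 * exp (- ((t - real CARD('n) / 2) / 5)) * ?J \<xi>"
      have nn: "0 \<le> A1" "0 \<le> A2" "0 \<le> A3" "0 \<le> t powr (- (l + 1)) * B"
        by (auto simp: A1_def A2_def A3_def B_def)
      have "(cmod (?U - phi1 u0 u1 t \<xi>))\<^sup>2 \<le> ?N\<^sup>2 * (A1 + A2 + A3) + 2 * C * (t powr (- (l + 1)) * B)"
      proof (cases "?x \<le> 1 / 10")
        case True
        note small = log_symbol_small[OF True]
        define e where "e = exp (- (t * ?s\<^sup>2 / 4))"
        define e' where "e' = exp (- (4 / 10 * t))"
        have "cmod (?U - of_real (exp (- t * ?x * (1 + ?x))) * ((\<integral>x. u0 x \<partial>lebesgue) + (\<integral>x. u1 x \<partial>lebesgue)))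
            \<le> ?N * (23 * ?s * exp (- (t * ?s\<^sup>2 / 4)) + 2 * exp (- (4 / 10 * t)))"
        proof (rule low_frequency[OF log_symbol_nonneg True norm_ge_zero small t1(1) _ _ _ _ _ _ conjunct2[OF elim(3)]])
          show "cmod ?a \<le> L11_norm u0" "cmod (?a - (\<integral>x. u0 x \<partial>lebesgue)) \<le> ?s * L11_norm u0"
            "cmod ?b \<le> L11_norm u1" "cmod (?b - (\<integral>x. u1 x \<partial>lebesgue)) \<le> ?s * L11_norm u1"
            "cmod (\<integral>x. u0 x \<partial>lebesgue) \<le> L11_norm u0" "cmod (\<integral>x. u1 x \<partial>lebesgue) \<le> L11_norm u1"
            unfolding elim(1,2) using u0 u1 by (auto intro: fourier_L1_bounds)
        qed
        then have le: "cmod (?U - phi1 u0 u1 t \<xi>) \<le> ?N * (23 * ?s * e + 2 * e')"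
          unfolding phi1_def e_def e'_def by simp
        have e2: "e\<^sup>2 = exp (- (t * ?s\<^sup>2 / 2))" "e'\<^sup>2 = exp (- (8 / 10 * t))"
          by (simp_all add: e_def e'_def flip: exp_double)
        have ind: "indicator (cball 0 1) \<xi> = (1::real)" using small(1) by simp
        have "(cmod (?U - phi1 u0 u1 t \<xi>))\<^sup>2 \<le> (?N * (23 * ?s * e + 2 * e'))\<^sup>2"
          using le by (intro power_mono) auto
        also have "\<dots> = ?N\<^sup>2 * (23 * ?s * e + 2 * e')\<^sup>2" by (rule power_mult_distrib)
        also have "\<dots> \<le> ?N\<^sup>2 * (2 * (23 * ?s * e)\<^sup>2 + 2 * (2 * e')\<^sup>2)"
          by (intro mult_left_mono sum_sq_le) auto
        also have "2 * (23 * ?s * e)\<^sup>2 + 2 * (2 * e')\<^sup>2 = A1 + A2"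
          unfolding power_mult_distrib e2 A1_def A2_def ind by simp
        also have "?N\<^sup>2 * (A1 + A2) \<le> ?N\<^sup>2 * (A1 + A2 + A3)"
          using nn by (intro mult_left_mono) auto
        finally show ?thesis using nn(4) C(1) by (smt (verit) mult_nonneg_nonneg)
      next
        case False
        then have x: "1 / 10 \<le> ?x" by simp
        have U: "(cmod ?U)\<^sup>2 \<le> C * (t powr (- (l + 1)) * B)"
          using C(2)[OF x t1(1), of ?U ?b ?a] elim unfolding B_def by (simp add: mult.assoc)
        have "2 * (t - real CARD('n) / 2) * (1 / 10) \<le> 2 * (t - real CARD('n) / 2) * ?x"
          using x t1 by (intro mult_left_mono) auto
        then have "exp (- (2 * (t - real CARD('n) / 2) * ?x)) \<le> exp (- ((t - real CARD('n) / 2) / 5))"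
          by simp
        then have "exp (- (2 * (t - real CARD('n) / 2) * ?x)) * ?J \<xi> \<le> exp (- ((t - real CARD('n) / 2) / 5)) * ?J \<xi>"
          by (intro mult_right_mono) auto
        then have "?N\<^sup>2 * (exp (- (2 * (t - real CARD('n) / 2) * ?x)) * ?J \<xi>) \<le> ?N\<^sup>2 * (A3 / 2)"
          unfolding A3_def by (intro mult_left_mono) auto
        with phi1_bound[of u0 u1 t \<xi>] u0 u1 t1 have phi: "(cmod (phi1 u0 u1 t \<xi>))\<^sup>2 \<le> ?N\<^sup>2 * (A3 / 2)"
          by force
        have "(cmod (?U - phi1 u0 u1 t \<xi>))\<^sup>2 \<le> (cmod ?U + cmod (phi1 u0 u1 t \<xi>))\<^sup>2"
          by (intro power_mono norm_triangle_ineq4) auto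
        also have "\<dots> \<le> 2 * (cmod ?U)\<^sup>2 + 2 * (cmod (phi1 u0 u1 t \<xi>))\<^sup>2" by (rule sum_sq_le)
        also have "\<dots> \<le> 2 * (C * (t powr (- (l + 1)) * B)) + 2 * (?N\<^sup>2 * (A3 / 2))"
          using U phi by simp
        also have "2 * (?N\<^sup>2 * (A3 / 2)) \<le> ?N\<^sup>2 * (A1 + A2 + A3)"
          using nn mult_left_mono[of A3 "A1 + A2 + A3" "?N\<^sup>2"] by simp
        finally show ?thesis by simp
      qed
      then show ?case unfolding A1_def A2_def A3_def B_def by (simp only: mult.assoc)
    qed
  qed (use C in simp)
qed

lemma solution_L2:
  assumes "is_solution u0 u1 u" "0 \<le> t"
  shows "u t \<in> L2_space"
proof -
  have "continuous_into (Y_space 2) (Y_norm 2) u" using assms(1) unfolding is_solution_def by blast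
  then show ?thesis using assms(2) unfolding continuous_into_def by (blast intro: Y_space_L2)
qed

text \<open>Integration of the pointwise bound. Every exponentially small term is absorbed into the
  power of \<open>t\<close> produced by the Gaussian term, and the weighted integrals are by
  definition the squared norms of the data. The factor 2 on \<open>K\<close> comes from bounding the
  square of the summed \<open>L11\<close> norms by \<open>data_norm\<close>.\<close>

lemma fourier_error_norm:
  fixes l :: real
  assumes l: "0 \<le> l"
  obtains C where "C > 0" "\<And>(u0 :: real^'n \<Rightarrow> complex) u1 u t. u0 \<in> L11_space \<inter> Y_space (l + 1) \<Longrightarrow> u1 \<in> L11_space \<inter> Y_space l \<Longrightarrow>
    is_solution u0 u1 u \<Longrightarrow> real CARD('n) / 2 + 1 \<le> t \<Longrightarrow>
    (L2_norm (\<lambda>\<xi>. fourier_L2 (u t) \<xi> - phi1 u0 u1 t \<xi>))\<^sup>2 \<le>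
      C * (data_norm l u0 u1)\<^sup>2 * (t powr (- ((real CARD('n) + 2) / 2)) + t powr (- (l + 1)))"
proof -
  define q where "q = (real CARD('n) + 2) / 2"
  have q: "0 < q" by (simp add: q_def add_pos_nonneg)
  obtain C where C: "C > 0" and pt: "\<And>(u0 :: real^'n \<Rightarrow> complex) u1 u t. u0 \<in> L11_space \<inter> L2_space \<Longrightarrow> u1 \<in> L11_space \<inter> L2_space \<Longrightarrow>
    is_solution u0 u1 u \<Longrightarrow> real CARD('n) / 2 + 1 \<le> t \<Longrightarrow>
    AE \<xi> in lebesgue. (cmod (fourier_L2 (u t) \<xi> - phi1 u0 u1 t \<xi>))\<^sup>2 \<le>
      (L11_norm u0 + L11_norm u1)\<^sup>2 * (1058 * ((norm \<xi>)\<^sup>2 * exp (- (t * (norm \<xi>)\<^sup>2 / 2))) + 8 * exp (- (8 / 10 * t)) * indicator (cball 0 1) \<xi>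
        + 2 * exp (- ((t - real CARD('n) / 2) / 5)) * inverse ((1 + (norm \<xi>)\<^sup>2) ^ CARD('n)))
      + C * t powr (- (l + 1)) * ((1 + log_symbol \<xi>) powr (l + 1) * (cmod (fourier_L2 u0 \<xi>))\<^sup>2 + (1 + log_symbol \<xi>) powr l * (cmod (fourier_L2 u1 \<xi>))\<^sup>2)"
    using fourier_error_pointwise[OF l, where 'n='n] by blast
  obtain K1 where K1: "0 < K1" "\<And>t. 1 \<le> t \<Longrightarrow> exp (- (8 / 10 * t)) \<le> K1 * t powr (- q)"
    using exp_decay_le_powr[of "8 / 10" q] q by auto
  obtain K2 where K2: "0 < K2" "\<And>t. 1 \<le> t \<Longrightarrow> exp (- (1 / 5 * t)) \<le> K2 * t powr (- q)"
    using exp_decay_le_powr[of "1 / 5" q] q by auto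
  define I1 where "I1 = (\<integral>\<xi>. (norm (\<xi>::real^'n))\<^sup>2 * gauss \<xi> \<partial>lborel)"
  define I2 where "I2 = (\<integral>\<xi>. indicator (cball 0 1) (\<xi>::real^'n) \<partial>lebesgue :: real)"
  define I3 where "I3 = (\<integral>\<xi>. inverse ((1 + (norm (\<xi>::real^'n))\<^sup>2) ^ CARD('n)) \<partial>lebesgue)"
  have I: "0 \<le> I1" "0 \<le> I2" "0 \<le> I3"
    unfolding I1_def I2_def I3_def by (intro Bochner_Integration.integral_nonneg; simp)+
  define K where "K = 1058 * I1 + 8 * K1 * I2 + 2 * (exp (real CARD('n) / 10) * K2) * I3"
  have K: "0 \<le> K" using I K1(1) K2(1) by (simp add: K_def)
  show thesis
  proof (rule that[of "2 * K + C"])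
    show "2 * K + C > 0" using K C by simp
    fix u0 u1 :: "real^'n \<Rightarrow> complex" and u :: "real \<Rightarrow> real^'n \<Rightarrow> complex" and t :: real
    assume u0: "u0 \<in> L11_space \<inter> Y_space (l + 1)" and u1: "u1 \<in> L11_space \<inter> Y_space l"
      and sol: "is_solution u0 u1 u" and t: "real CARD('n) / 2 + 1 \<le> t"
    have t1: "1 \<le> t" "real CARD('n) / 2 \<le> t" using t by (smt (verit) divide_nonneg_nonneg of_nat_0_le_iff)+
    define N where "N = L11_norm u0 + L11_norm u1"
    define Yn where "Yn = (Y_norm (l + 1) u0)\<^sup>2 + (Y_norm l u1)\<^sup>2"
    define D where "D = (data_norm l u0 u1)\<^sup>2"
    define A where "A \<xi> = 1058 * ((norm \<xi>)\<^sup>2 * exp (- (t * (norm \<xi>)\<^sup>2 / 2))) + 8 * exp (- (8 / 10 * t)) * indicator (cball 0 1) \<xi>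
        + 2 * exp (- ((t - real CARD('n) / 2) / 5)) * inverse ((1 + (norm \<xi>)\<^sup>2) ^ CARD('n))" for \<xi> :: "real^'n"
    define B where "B \<xi> = (1 + log_symbol \<xi>) powr (l + 1) * (cmod (fourier_L2 u0 \<xi>))\<^sup>2 + (1 + log_symbol \<xi>) powr l * (cmod (fourier_L2 u1 \<xi>))\<^sup>2" for \<xi>
    have Deq: "D = (L11_norm u0)\<^sup>2 + (L11_norm u1)\<^sup>2 + Yn"
      by (simp add: D_def data_norm_def Yn_def)
    have Yn0: "0 \<le> Yn" by (simp add: Yn_def)
    have "N\<^sup>2 \<le> 2 * (L11_norm u0)\<^sup>2 + 2 * (L11_norm u1)\<^sup>2" unfolding N_def by (rule sum_sq_le)
    then have ND: "N\<^sup>2 \<le> 2 * D" "Yn \<le> D" "0 \<le> D" using Deq Yn0 by (auto simp: D_def)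
    have i1: "integrable lebesgue (\<lambda>\<xi>::real^'n. (norm \<xi>)\<^sup>2 * exp (- (t * (norm \<xi>)\<^sup>2 / 2)))"
      and e1: "(\<integral>\<xi>. (norm (\<xi>::real^'n))\<^sup>2 * exp (- (t * (norm \<xi>)\<^sup>2 / 2)) \<partial>lebesgue) = t powr (- q) * I1"
      using square_gauss_integral[of t, where 'a="real^'n"] t1 by (simp_all add: q_def I1_def)
    have i2: "integrable lebesgue (indicat_real (cball 0 1) :: real^'n \<Rightarrow> real)"
      using emeasure_bounded_finite[of "cball (0::real^'n) 1"] by (intro integrable_real_indicator) auto
    have i3: "integrable lebesgue (\<lambda>\<xi>::real^'n. inverse ((1 + (norm \<xi>)\<^sup>2) ^ CARD('n)))"
      using integrable_inverse_bracket[where 'a="real^'n"] by simp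
    have iA: "integrable lebesgue A"
      unfolding A_def[abs_def] by (intro Bochner_Integration.integrable_add integrable_mult_right i1 i2 i3)
    have "(\<integral>\<xi>. A \<xi> \<partial>lebesgue) = 1058 * (t powr (- q) * I1) + 8 * exp (- (8 / 10 * t)) * I2 + 2 * exp (- ((t - real CARD('n) / 2) / 5)) * I3"
      unfolding A_def using i1 i2 i3 e1 by (simp add: I2_def I3_def)
    also have "\<dots> \<le> 1058 * (t powr (- q) * I1) + 8 * (K1 * t powr (- q)) * I2 + 2 * (exp (real CARD('n) / 10) * (K2 * t powr (- q))) * I3"
    proof (intro add_mono mult_right_mono mult_left_mono order_refl I)
      show "exp (- (8 / 10 * t)) \<le> K1 * t powr (- q)" by (rule K1(2)[OF t1(1)])
      \<comment> \<open>The shift of time by \<open>n/2\<close> costs the constant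
        \<open>exp (n/10)\<close> contained in \<open>K\<close>.\<close>
      have "exp (- ((t - real CARD('n) / 2) / 5)) = exp (real CARD('n) / 10) * exp (- (1 / 5 * t))"
        unfolding exp_add[symmetric] by (simp add: field_simps)
      also have "\<dots> \<le> exp (real CARD('n) / 10) * (K2 * t powr (- q))"
        by (intro mult_left_mono K2(2)[OF t1(1)]) simp
      finally show "exp (- ((t - real CARD('n) / 2) / 5)) \<le> exp (real CARD('n) / 10) * (K2 * t powr (- q))" .
    qed (use I in auto)
    also have "\<dots> = K * t powr (- q)" by (simp add: K_def algebra_simps)
    finally have IA: "(\<integral>\<xi>. A \<xi> \<partial>lebesgue) \<le> K * t powr (- q)" .
    have Yi: "integrable lebesgue (\<lambda>\<xi>. (1 + log_symbol \<xi>) powr (l + 1) * (cmod (fourier_L2 u0 \<xi>))\<^sup>2)"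
      "integrable lebesgue (\<lambda>\<xi>. (1 + log_symbol \<xi>) powr l * (cmod (fourier_L2 u1 \<xi>))\<^sup>2)"
      using u0 u1 by (auto simp: Y_space_def)
    have iB: "integrable lebesgue B" and IB: "(\<integral>\<xi>. B \<xi> \<partial>lebesgue) = Yn"
      unfolding B_def[abs_def] using Yi by (simp_all add: Yn_def Y_norm_sq)
    have S: "(\<lambda>\<xi>. fourier_L2 (u t) \<xi> - phi1 u0 u1 t \<xi>) \<in> L2_space"
    proof (intro L2_diff fourier_L2_in_L2 phi1_L2)
      show "u t \<in> L2_space"
        using solution_L2[OF sol] t1 by simp
    qed (use u0 u1 t1 in auto)
    have "(L2_norm (\<lambda>\<xi>. fourier_L2 (u t) \<xi> - phi1 u0 u1 t \<xi>))\<^sup>2 \<le> (\<integral>\<xi>. N\<^sup>2 * A \<xi> + C * t powr (- (l + 1)) * B \<xi> \<partial>lebesgue)"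
      unfolding L2_norm_sq
    proof (intro integral_mono_AE L2_integrable[OF S] Bochner_Integration.integrable_add integrable_mult_right iA iB)
      show "AE \<xi> in lebesgue. (cmod (fourier_L2 (u t) \<xi> - phi1 u0 u1 t \<xi>))\<^sup>2 \<le> N\<^sup>2 * A \<xi> + C * t powr (- (l + 1)) * B \<xi>"
        unfolding N_def A_def B_def by (rule pt[OF _ _ sol t]) (use u0 u1 in \<open>auto dest: Y_space_L2\<close>)
    qed
    also have "\<dots> = N\<^sup>2 * (\<integral>\<xi>. A \<xi> \<partial>lebesgue) + C * t powr (- (l + 1)) * Yn"
      using iA iB by (simp add: IB)
    also have "\<dots> \<le> (2 * D) * (K * t powr (- q)) + C * t powr (- (l + 1)) * D"
    proof (intro add_mono mult_mono ND IA)
      show "0 \<le> (\<integral>\<xi>. A \<xi> \<partial>lebesgue)" by (intro Bochner_Integration.integral_nonneg) (simp add: A_def)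
    qed (use C ND Yn0 in auto)
    also have "\<dots> \<le> (2 * K + C) * D * (t powr (- q) + t powr (- (l + 1)))"
      using ND K C by (simp add: algebra_simps)
    finally show "(L2_norm (\<lambda>\<xi>. fourier_L2 (u t) \<xi> - phi1 u0 u1 t \<xi>))\<^sup>2 \<le>
      (2 * K + C) * (data_norm l u0 u1)\<^sup>2 * (t powr (- ((real CARD('n) + 2) / 2)) + t powr (- (l + 1)))"
      unfolding D_def q_def .
  qed
qed

lemma Plancherel_inv_fourier_diff:
  fixes f g :: "real^'n \<Rightarrow> complex"
  assumes f: "f \<in> L2_space" and g: "g \<in> L2_space"
  shows "L2_norm (\<lambda>x. f x - inv_fourier_L2 g x) \<le> L2_norm (\<lambda>\<xi>. fourier_L2 f \<xi> - g \<xi>)"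
proof -
  note h = inv_fourier_L2[OF g]
  have S: "(\<lambda>x. 1 * f x + (-1) * inv_fourier_L2 g x) \<in> L2_space" by (intro L2_lincomb f h)
  have "1 \<le> (2 * pi) ^ CARD('n)" by (rule one_le_power) (use pi_gt3 in simp)
  then have "1 \<le> sqrt ((2 * pi) ^ CARD('n))" by (rule real_sqrt_ge_one)
  then have "1 * L2_norm (\<lambda>x. 1 * f x + (-1) * inv_fourier_L2 g x) \<le> sqrt ((2 * pi) ^ CARD('n)) * L2_norm (\<lambda>x. 1 * f x + (-1) * inv_fourier_L2 g x)"
    by (intro mult_right_mono) auto
  also have "\<dots> = L2_norm (fourier_L2 (\<lambda>x. 1 * f x + (-1) * inv_fourier_L2 g x))"
    by (rule Plancherel[OF S, symmetric])
  also have "\<dots> = L2_norm (\<lambda>\<xi>. fourier_L2 f \<xi> - g \<xi>)"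
  proof (rule L2_norm_cong_AE)
    show "AE \<xi> in lebesgue. fourier_L2 (\<lambda>x. 1 * f x + (-1) * inv_fourier_L2 g x) \<xi> = fourier_L2 f \<xi> - g \<xi>"
      using fourier_L2_lincomb[OF f h(1), of 1 "-1"] h(2)
    proof eventually_elim
      case (elim \<xi>)
      show ?case unfolding elim(1) elim(2) by simp
    qed
  qed (intro L2_measurable fourier_L2_in_L2 S L2_diff f g)+
  finally show ?thesis by simp
qed

theorem theorem1p1:
  fixes l :: real
  assumes "l \<ge> 1"
  shows "\<exists>C>0. \<exists>t0>1.
    \<forall>(u0 :: real^'n \<Rightarrow> complex) (u1 :: real^'n \<Rightarrow> complex) (u :: real \<Rightarrow> real^'n \<Rightarrow> complex).
      u0 \<in> L11_space \<inter> Y_space (l + 1) \<longrightarrow> u1 \<in> L11_space \<inter> Y_space l \<longrightarrow> is_solution u0 u1 u \<longrightarrow>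
      (\<forall>t\<ge>t0.
        phi1 u0 u1 t \<in> L2_space \<and>
        (\<lambda>x. u t x - inv_fourier_L2 (phi1 u0 u1 t) x) \<in> L2_space \<and>
        ((CARD('n) \<le> 2 \<and> l \<ge> 1) \<or> (CARD('n) \<ge> 3 \<and> l \<ge> real CARD('n) / 2) \<longrightarrow>
          L2_norm (\<lambda>x. u t x - inv_fourier_L2 (phi1 u0 u1 t) x)
            \<le> C * data_norm l u0 u1 * t powr (- ((real CARD('n) + 2) / 4))) \<and>
        ((CARD('n) \<ge> 4 \<and> real CARD('n) / 2 - 1 < l \<and> l \<le> real CARD('n) / 2) \<or>
         (CARD('n) = 3 \<and> 1 \<le> l \<and> l \<le> 3 / 2) \<longrightarrow>
          L2_norm (\<lambda>x. u t x - inv_fourier_L2 (phi1 u0 u1 t) x)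
            \<le> C * data_norm l u0 u1 * t powr (- ((l + 1) / 2))))"
proof -
  obtain C where C: "C > 0" and est: "\<And>(u0 :: real^'n \<Rightarrow> complex) u1 u t. u0 \<in> L11_space \<inter> Y_space (l + 1) \<Longrightarrow> u1 \<in> L11_space \<inter> Y_space l \<Longrightarrow>
    is_solution u0 u1 u \<Longrightarrow> real CARD('n) / 2 + 1 \<le> t \<Longrightarrow>
    (L2_norm (\<lambda>\<xi>. fourier_L2 (u t) \<xi> - phi1 u0 u1 t \<xi>))\<^sup>2 \<le>
      C * (data_norm l u0 u1)\<^sup>2 * (t powr (- ((real CARD('n) + 2) / 2)) + t powr (- (l + 1)))"
    using fourier_error_norm[of l, where 'n='n] assms by auto
  have n: "1 \<le> real CARD('n)" by (simp add: Suc_leI)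
  have t0: "1 < real CARD('n) / 2 + 1" using n by simp
  have sqrt_C: "sqrt (2 * C) > 0" using C by simp
  show ?thesis
  \<comment> \<open>The root undoes the squaring of the norm, and the 2 accounts for bounding the
    sum of two powers of \<open>t\<close> by twice the slower one.\<close>
  proof (rule exI[of _ "sqrt (2 * C)"], rule conjI[OF sqrt_C], rule exI[of _ "real CARD('n) / 2 + 1"], rule conjI[OF t0],
      intro allI impI conjI)
    fix u0 u1 :: "real^'n \<Rightarrow> complex" and u :: "real \<Rightarrow> real^'n \<Rightarrow> complex" and t :: real
    assume u0: "u0 \<in> L11_space \<inter> Y_space (l + 1)" and u1: "u1 \<in> L11_space \<inter> Y_space l"
      and sol: "is_solution u0 u1 u" and t: "real CARD('n) / 2 + 1 \<le> t"
    have t1: "1 \<le> t" "real CARD('n) / 2 \<le> t" using t n by auto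
    show phi: "phi1 u0 u1 t \<in> L2_space" using u0 u1 t1 by (intro phi1_L2) auto
    have uS: "u t \<in> L2_space"
      using solution_L2[OF sol] t1 by simp
    show "(\<lambda>x. u t x - inv_fourier_L2 (phi1 u0 u1 t) x) \<in> L2_space"
      by (intro L2_diff uS inv_fourier_L2 phi)
    let ?E = "L2_norm (\<lambda>x. u t x - inv_fourier_L2 (phi1 u0 u1 t) x)"
    have data: "0 \<le> data_norm l u0 u1" by (simp add: data_norm_def)
    have E: "?E\<^sup>2 \<le> C * (data_norm l u0 u1)\<^sup>2 * (t powr (- ((real CARD('n) + 2) / 2)) + t powr (- (l + 1)))"
      by (rule order_trans[OF power_mono[OF Plancherel_inv_fourier_diff[OF uS phi]] est[OF u0 u1 sol t]]) simp
    \<comment> \<open>Any \<open>p\<close> below both halved exponents is an admissible rate, since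
      \<open>t \<ge> 1\<close>. The two cases take \<open>p = (n + 2) / 4\<close> and
      \<open>p = (l + 1) / 2\<close>, which coincide at \<open>l = n/2\<close>.\<close>
    have rate: "?E \<le> sqrt (2 * C) * data_norm l u0 u1 * t powr (- p)"
      if p: "2 * p \<le> (real CARD('n) + 2) / 2" "2 * p \<le> l + 1" for p
    proof (rule power2_le_imp_le)
      have "t powr (- ((real CARD('n) + 2) / 2)) + t powr (- (l + 1)) \<le> t powr (- (2 * p)) + t powr (- (2 * p))"
        using p t1 by (intro add_mono powr_mono) auto
      then have "?E\<^sup>2 \<le> C * (data_norm l u0 u1)\<^sup>2 * (t powr (- (2 * p)) + t powr (- (2 * p)))"
        using C by (intro order_trans[OF E] mult_left_mono) auto
      also have "\<dots> = (sqrt (2 * C) * data_norm l u0 u1 * t powr (- p))\<^sup>2"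
      proof -
        have "(t powr (- p))\<^sup>2 = t powr (- (2 * p))" by (simp add: power2_eq_square flip: powr_add)
        then show ?thesis using C by (simp add: power_mult_distrib)
      qed
      finally show "?E\<^sup>2 \<le> (sqrt (2 * C) * data_norm l u0 u1 * t powr (- p))\<^sup>2" .
    qed (use C data in simp)
    show "?E \<le> sqrt (2 * C) * data_norm l u0 u1 * t powr (- ((real CARD('n) + 2) / 4))"
      if "CARD('n) \<le> 2 \<and> l \<ge> 1 \<or> CARD('n) \<ge> 3 \<and> l \<ge> real CARD('n) / 2"
    proof (rule rate)
      \<comment> \<open>In dimension at most 2 the assumption \<open>l \<ge> 1\<close> already gives
        \<open>l \<ge> n/2\<close>, so both alternatives make the Gaussian rate the slower
        one.\<close>
      have "real CARD('n) \<le> 2 \<and> l \<ge> 1 \<or> l \<ge> real CARD('n) / 2" using that by auto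
      then show "2 * ((real CARD('n) + 2) / 4) \<le> l + 1" by (auto simp: field_simps)
    qed simp
    show "?E \<le> sqrt (2 * C) * data_norm l u0 u1 * t powr (- ((l + 1) / 2))"
      if "CARD('n) \<ge> 4 \<and> real CARD('n) / 2 - 1 < l \<and> l \<le> real CARD('n) / 2 \<or> CARD('n) = 3 \<and> 1 \<le> l \<and> l \<le> 3 / 2"
      by (rule rate) (use that in auto)
  qed
qed

end
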